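(* Let $k$ be a field of characteristic $p \geq 5$. Then the $p$-th power $R^p = R\circ\cdots\circ R$ ($p$ times) of the Ramanujan vector field, as a derivation of $k[e_2,e_4,e_6]$ (i.e. a global vector field on $\mathbf{A}^3_k$), is $$R^p = \frac{\tilde B^2 - e_4 \tilde A^2}{12}\frac{\partial}{\partial e_2} + \frac{\tilde A(e_4\tilde B - e_6\tilde A)}{3}\frac{\partial}{\partial e_4} + \frac{\tilde A(e_6\tilde B - e_4^2\tilde A)}{2}\frac{\partial}{\partial e_6}.$$ Equivalently, writing $P := \frac{\tilde B - e_2\tilde A}{12}$, $$R^p = \tilde A^2\, R - P^2\, F + \tilde A\, P\, H .$$
   Context: For even $\nu\ge 2$, $E_\nu(\tau) = 1 - \frac{2\nu}{B_\nu}\sum_{n\ge1}\sigma_{\nu-1}(n)q^n$ is the normalized Eisenstein series ($B_\nu$ the Bernoulli number, $\sigma_\mu(n)=\sum_{d\mid n}d^\mu$, $q=e^{2\pi i\tau}$). The Ramanujan vector field is the derivation $R = \frac{e_2^2-e_4}{12}\frac{\partial}{\partial e_2} + \frac{e_2e_4-e_6}{3}\frac{\partial}{\partial e_4} + \frac{e_2e_6-e_4^2}{2}\frac{\partial}{\partial e_6}$; also $F = -12\frac{\partial}{\partial e_2}$ and $H = 2e_2\frac{\partial}{\partial e_2}+4e_4\frac{\partial}{\partial e_4}+6e_6\frac{\partial}{\partial e_6}$. For a prime $p\ge5$, $A,B\in\mathbf{Q}[e_4,e_6]$ are the unique polynomials with $A(E_4,E_6)=E_{p-1}$ and $B(E_4,E_6)=E_{p+1}$;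 they have $p$-integral coefficients (in $\mathbf{Z}_{(p)}$), and $\tilde A,\tilde B\in\mathbf{F}_p[e_4,e_6]\subset k[e_4,e_6]$ denote their reductions modulo $p$. *)

theory Defs
  imports "HOL-Computational_Algebra.Computational_Algebra"
begin

text \<open>Bernoulli numbers via the standard recurrence
  sum_{k=0}^{n} binom(n+1,k) B_k = 0 for n >= 1, B_0 = 1 (so B_1 = -1/2).\<close>
function bernoulli_num :: "nat \<Rightarrow> rat" where
  "bernoulli_num n = (if n = 0 then 1 else
     - (\<Sum>k<n. of_nat ((n + 1) choose k) * bernoulli_num k) / of_nat (n + 1))"
  by auto
termination by (relation "measure id") auto

definition divisor_sigma :: "nat \<Rightarrow> nat \<Rightarrow> nat" where
  "divisor_sigma m n = (\<Sum>d\<in>{d. d dvd n}. d ^ m)"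

definition eisenstein :: "nat \<Rightarrow> rat fps" where
  "eisenstein \<nu> = Abs_fps (\<lambda>n. if n = 0 then 1
      else - (2 * of_nat \<nu> / bernoulli_num \<nu>) * of_nat (divisor_sigma (\<nu> - 1) n))"

text \<open>Polynomials in Q[e4,e6] are represented as rat poly poly: the outer variable is e6,
  the inner variable is e4. Evaluation at (E4, E6):\<close>
definition eval_E4E6 :: "rat poly poly \<Rightarrow> rat fps" where
  "eval_E4E6 Q = poly (map_poly (\<lambda>c. poly (map_poly fps_const c) (eisenstein 4)) Q) (eisenstein 6)"

definition polyA :: "nat \<Rightarrow> rat poly poly" where
  "polyA p = (THE Q. eval_E4E6 Q = eisenstein (p - 1))"

definition polyB :: "nat \<Rightarrow> rat poly poly" where
  "polyB p = (THE Q. eval_E4E6 Q = eisenstein (p + 1))"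

text \<open>The natural map Z_(p) -> F_p -> k, applied to a rational a/b (lowest terms).\<close>
definition red_rat :: "rat \<Rightarrow> 'k::field" where
  "red_rat r = of_int (fst (quotient_of r)) / of_int (snd (quotient_of r))"

section \<open>k[e2,e4,e6] as 'k poly poly poly (outer e6, middle e4, inner e2)\<close>

type_synonym 'k poly3 = "'k poly poly poly"

definition const3 :: "'k::idom \<Rightarrow> 'k poly3" where
  "const3 c = [:[:[:c:]:]:]"

definition var_e2 :: "'k::idom poly3" where "var_e2 = [:[:[:0, 1:]:]:]"
definition var_e4 :: "'k::idom poly3" where "var_e4 = [:[:0, 1:]:]"
definition var_e6 :: "'k::idom poly3" where "var_e6 = [:0, 1:]"

definition d_e2 :: "'k::idom poly3 \<Rightarrow> 'k poly3" where
  "d_e2 f = map_poly (map_poly pderiv) f"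
definition d_e4 :: "'k::idom poly3 \<Rightarrow> 'k poly3" where
  "d_e4 f = map_poly pderiv f"
definition d_e6 :: "'k::idom poly3 \<Rightarrow> 'k poly3" where
  "d_e6 f = pderiv f"

definition vfield :: "'k::idom poly3 \<Rightarrow> 'k poly3 \<Rightarrow> 'k poly3 \<Rightarrow> 'k poly3 \<Rightarrow> 'k poly3" where
  "vfield a b c f = a * d_e2 f + b * d_e4 f + c * d_e6 f"

definition ramanujan :: "'k::field poly3 \<Rightarrow> 'k poly3" where
  "ramanujan = vfield
     (const3 (inverse 12) * (var_e2 ^ 2 - var_e4))
     (const3 (inverse 3) * (var_e2 * var_e4 - var_e6))
     (const3 (inverse 2) * (var_e2 * var_e6 - var_e4 ^ 2))"

definition reduce_e4e6 :: "rat poly poly \<Rightarrow> 'k::field poly3" where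
  "reduce_e4e6 Q = map_poly (map_poly (\<lambda>c. [:red_rat c:])) Q"

definition tildeA :: "nat \<Rightarrow> 'k::field poly3" where "tildeA p = reduce_e4e6 (polyA p)"
definition tildeB :: "nat \<Rightarrow> 'k::field poly3" where "tildeB p = reduce_e4e6 (polyB p)"

end

theory Submission
  imports Defs "HOL-Analysis.FPS_Convergence"
begin

text \<open>
  Let \<open>U = \<partial>/\<partial>e\<^sub>2\<close>, let \<open>H\<close> be the weighted Euler field and \<open>R\<close> the Ramanujan field. From \<open>12 [U, R] = H\<close> and
  \<open>[H, R] = 2 R\<close> one gets \<open>12 [U, R\<^sup>n] = n R\<^sup>n\<^sup>-\<^sup>1 H + n (n - 1) R\<^sup>n\<^sup>-\<^sup>1\<close>, hence \<open>U\<close> commutes with \<open>R\<^sup>p\<close>. So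
  \<open>R\<^sup>p e\<^sub>i\<close> is a polynomial in \<open>e\<^sub>2\<^sup>p\<close>, \<open>e\<^sub>4\<close>, \<open>e\<^sub>6\<close>; weights and the coefficients of \<open>e\<^sub>2\<^sup>p e\<^sub>4\<close> and \<open>e\<^sub>2\<^sup>p e\<^sub>6\<close>,
  which are multiples of \<open>p\<close>, show that \<open>e\<^sub>2\<close> does not occur at all. A weighted homogeneous form in
  \<open>e\<^sub>4\<close>, \<open>e\<^sub>6\<close> is determined by its \<open>q\<close>-expansion. On \<open>q\<close>-expansions \<open>R\<close> becomes \<open>\<theta> = q d/dq\<close>,
  which satisfies \<open>\<theta>\<^sup>p = \<theta>\<close> in characteristic \<open>p\<close>, while \<open>A\<close> and \<open>B\<close> become \<open>1\<close> and \<open>E\<^sub>2\<close> by the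
  congruences for \<open>B\<^sub>p\<^sub>-\<^sub>1\<close> and \<open>B\<^sub>p\<^sub>+\<^sub>1\<close>; so the two sides agree.

  That \<open>E\<^sub>w\<close> is a polynomial in \<open>E\<^sub>4\<close>, \<open>E\<^sub>6\<close>, and Ramanujan's differential equations, are
  derived from elementary identities for sums over \<open>a x + b y = N\<close>. Uniqueness of \<open>A\<close> and \<open>B\<close>
  (algebraic independence of \<open>E\<^sub>4\<close> and \<open>E\<^sub>6\<close>) comes from the behaviour as \<open>q\<close> tends to \<open>1\<close>:
  \<open>E\<^sub>4\<close> tends to infinity polynomially while \<open>\<Delta>\<close> vanishes to infinite order.
\<close>

section \<open>Homomorphisms, polynomial evaluation and power series\<close>

text \<open>The q-expansion is not injective in characteristic \<open>p\<close>: it kills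
  \<open>A - 1\<close>, and even the homogeneous form \<open>A e2 - B\<close> of weight
  \<open>p + 1\<close>. Comparing q-expansions is legitimate only for a fixed weight and once
  \<open>e2\<close> is gone, which is why the commutator and coefficient arguments are needed. A
  second obstacle: \<open>red_rat\<close> is meaningful only on p-integral rationals, so
  p-integrality of the coefficients of \<open>A\<close> and \<open>B\<close> must be proved. It
  follows from the same injectivity on homogeneous forms modulo \<open>p\<close>, applied to a
  smallest common denominator. The descriptions \<open>THE Q\<close> ask for uniqueness among all
  rational polynomials, not just homogeneous ones; hence the analytic argument. No complex-analytic
  theory of modular forms enters: the equation \<open>wp'' = 6 wp^2 + const\<close> of the
  Weierstrass function is verified as an identity of formal power series in \<open>z\<close> and
  \<open>q\<close>, and its coefficients in \<open>z\<close> express all Eisenstein series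
  recursively through \<open>E4\<close> and \<open>E6\<close>.\<close>

locale rhom =
  fixes h :: "'a::comm_ring_1 \<Rightarrow> 'b::comm_ring_1"
  assumes one: "h 1 = 1" and add: "h (x + y) = h x + h y" and mult: "h (x * y) = h x * h y"
begin

lemma zero: "h 0 = 0"
  using add[of 0 0] by simp

lemma minus: "h (- x) = - h x"
  using add[of x "- x"] by (simp add: zero minus_unique)

lemma diff: "h (x - y) = h x - h y"
  using add[of x "- y"] by (simp add: minus)

lemma sum: "h (sum f A) = (\<Sum>a\<in>A. h (f a))"
  by (induction A rule: infinite_finite_induct) (auto simp: zero add)

lemma power: "h (x ^ n) = h x ^ n"
  by (induction n) (auto simp: one mult)

lemma of_nat: "h (of_nat n) = of_nat n"
  by (induction n) (auto simp: one zero add)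

lemma of_int: "h (of_int n) = of_int n"
  by (cases n rule: int_cases2) (auto simp: of_nat minus)

lemma numeral: "h (numeral n) = numeral n"
  using of_nat[of "numeral n"] by simp

lemma coeff: "coeff (map_poly h p) n = h (coeff p n)"
  by (simp add: coeff_map_poly zero)

lemma map_poly: "rhom (map_poly h)"
proof
  show "map_poly h 1 = 1" by (simp add: one)
  show "map_poly h (p + q) = map_poly h p + map_poly h q" for p q
    by (rule poly_eqI) (simp add: coeff add)
  show "map_poly h (p * q) = map_poly h p * map_poly h q" for p q
    by (rule poly_eqI) (simp add: coeff coeff_mult sum mult)
qed

end

text \<open>Evaluation along a coefficient map. Nesting it evaluates iterated polynomials such as
  \<open>k[e2][e4][e6]\<close> one variable at a time.\<close>

definition poly_eval_hom :: "('a::zero \<Rightarrow> 'b::comm_ring_1) \<Rightarrow> 'b \<Rightarrow> 'a poly \<Rightarrow> 'b" where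
  "poly_eval_hom h x p = poly (map_poly h p) x"

lemma rhom_poly_eval_hom:
  assumes "rhom h" shows "rhom (poly_eval_hom h x)"
proof -
  interpret rhom h by fact
  interpret m: rhom "map_poly h" by (rule map_poly)
  show ?thesis by unfold_locales (auto simp: poly_eval_hom_def m.one m.add m.mult)
qed

lemma poly_eval_hom_0 [simp]: "poly_eval_hom h x 0 = 0"
  by (simp add: poly_eval_hom_def)

lemma poly_eval_hom_pCons: "h 0 = 0 \<Longrightarrow> poly_eval_hom h x (pCons a p) = h a + x * poly_eval_hom h x p"
  by (simp add: poly_eval_hom_def map_poly_pCons)

lemma poly_eval_hom_const: "h 0 = 0 \<Longrightarrow> poly_eval_hom h x [:a:] = h a"
  by (simp add: poly_eval_hom_pCons)

lemma poly_eval_hom_map_poly: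
  "g 0 = 0 \<Longrightarrow> h 0 = 0 \<Longrightarrow> poly_eval_hom h x (map_poly g p) = poly_eval_hom (\<lambda>c. h (g c)) x p"
  by (simp add: poly_eval_hom_def map_poly_map_poly o_def)

lemma (in rhom) poly_eval_hom: "f 0 = 0 \<Longrightarrow> h (poly_eval_hom f x p) = poly_eval_hom (\<lambda>c. h (f c)) (h x) p"
  by (induction p) (simp_all add: zero poly_eval_hom_pCons add mult)

lemma poly_eval_hom_altdef:
  assumes "h 0 = 0" "degree p \<le> n"
  shows "poly_eval_hom h x p = (\<Sum>i\<le>n. h (coeff p i) * x ^ i)"
proof -
  have deg: "degree (map_poly h p) \<le> n"
    using assms by (intro degree_le) (auto simp: coeff_map_poly coeff_eq_0)
  have "poly (map_poly h p) x = (\<Sum>i\<le>degree (map_poly h p). coeff (map_poly h p) i * x ^ i)"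
    by (rule poly_altdef)
  also have "\<dots> = (\<Sum>i\<le>n. coeff (map_poly h p) i * x ^ i)"
    using deg by (intro sum.mono_neutral_left) (auto simp: coeff_eq_0)
  finally show ?thesis using assms by (simp add: poly_eval_hom_def coeff_map_poly)
qed

definition map_fps :: "('a \<Rightarrow> 'b) \<Rightarrow> 'a fps \<Rightarrow> 'b fps" where
  "map_fps h f = Abs_fps (\<lambda>n. h (fps_nth f n))"

lemma map_fps_nth [simp]: "fps_nth (map_fps h f) n = h (fps_nth f n)"
  by (simp add: map_fps_def)

lemma (in rhom) map_fps: "rhom (map_fps h)"
  by unfold_locales (simp_all add: fps_eq_iff one add zero fps_mult_nth sum mult)

lemma (in rhom) map_fps_const: "map_fps h (fps_const c) = fps_const (h c)"
  by (simp add: fps_eq_iff zero)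

lemma (in rhom) map_fps_XD: "map_fps h (fps_XD f) = fps_XD (map_fps h f)"
  by (simp add: fps_eq_iff mult of_nat)

lemma rhom_fps_const: "rhom (fps_const :: 'a::comm_ring_1 \<Rightarrow> 'a fps)"
  by unfold_locales auto

lemma rhom_of_int: "rhom (of_int :: int \<Rightarrow> 'a::comm_ring_1)"
  by unfold_locales auto

lemma rhom_of_rat: "rhom (of_rat :: rat \<Rightarrow> 'a::field_char_0)"
  by unfold_locales (auto simp: of_rat_add of_rat_mult)

lemma rhom_const_poly: "rhom (\<lambda>c::'a::comm_ring_1. [:c:])"
  by unfold_locales (auto simp: one_pCons)

lemma fps_XD_mult: "fps_XD (f * g) = fps_XD f * g + f * fps_XD (g :: 'a::comm_ring_1 fps)"
  by (simp add: fps_XD_def algebra_simps)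

lemma fps_XD_diff: "fps_XD (f - g) = fps_XD f - fps_XD (g :: 'a::comm_ring_1 fps)"
  by (simp add: fps_eq_iff algebra_simps)

section \<open>Sums over \<open>a x + b y = N\<close>\<close>

text \<open>Index set for the coefficient of \<open>q^N\<close> in a product of two Lambert series:
  \<open>a\<close>, \<open>b\<close> are the divisors, \<open>x\<close>, \<open>y\<close> their
  cofactors.\<close>

definition quads :: "nat \<Rightarrow> (nat \<times> nat \<times> nat \<times> nat) set" where
  "quads N = {(a, b, x, y). a > 0 \<and> b > 0 \<and> x > 0 \<and> y > 0 \<and> a * x + b * y = N}"

lemma quadsD: "(a, b, x, y) \<in> quads N \<Longrightarrow> a \<le> N \<and> b \<le> N \<and> x \<le> N \<and> y \<le> N"
proof -
  assume "(a, b, x, y) \<in> quads N"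
  then have *: "a > 0" "b > 0" "x > 0" "y > 0" "a * x + b * y = N" by (auto simp: quads_def)
  then have "a * 1 \<le> a * x" "1 * x \<le> a * x" "b * 1 \<le> b * y" "1 * y \<le> b * y"
    by (intro mult_le_mono; simp)+
  then show ?thesis using * by linarith
qed

lemma finite_quads [simp]: "finite (quads N)"
  by (rule finite_subset[of _ "{..N} \<times> {..N} \<times> {..N} \<times> {..N}"]) (use quadsD in fastforce)+

text \<open>Summands see only \<open>a\<close> and \<open>b\<close>; cofactors enter through the
  predicate alone. This lets a change of variables trade a condition on \<open>a\<close>,
  \<open>b\<close> for one on \<open>x\<close>, \<open>y\<close>.\<close>

definition quad_sum :: "nat \<Rightarrow> (nat \<Rightarrow> nat \<Rightarrow> nat \<Rightarrow> nat \<Rightarrow> bool) \<Rightarrow> (nat \<Rightarrow> nat \<Rightarrow> 'r) \<Rightarrow> 'r::comm_ring_1" where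
  "quad_sum N P f = (\<Sum>(a, b, x, y)\<in>quads N. if P a b x y then f a b else 0)"

abbreviation full_sum :: "nat \<Rightarrow> (nat \<Rightarrow> nat \<Rightarrow> 'r) \<Rightarrow> 'r::comm_ring_1" where
  "full_sum N \<equiv> quad_sum N (\<lambda>a b x y. True)"

lemma quad_sum_add: "quad_sum N P (\<lambda>a b. f a b + g a b) = quad_sum N P f + quad_sum N P g"
  unfolding quad_sum_def sum.distrib[symmetric] by (intro sum.cong) auto

lemma quad_sum_diff: "quad_sum N P (\<lambda>a b. f a b - g a b) = quad_sum N P f - quad_sum N P g"
  unfolding quad_sum_def sum_subtractf[symmetric] by (intro sum.cong) auto

lemma quad_sum_cmult: "quad_sum N P (\<lambda>a b. c * f a b) = c * quad_sum N P f"
  unfolding quad_sum_def sum_distrib_left by (intro sum.cong) auto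

lemma quad_sum_cong:
  "(\<And>a b x y. P a b x y \<Longrightarrow> f a b = g a b) \<Longrightarrow> quad_sum N P f = quad_sum N P g"
  unfolding quad_sum_def by (intro sum.cong) auto

lemma quad_sum_swap: "quad_sum N P f = quad_sum N (\<lambda>a b x y. P b a y x) (\<lambda>a b. f b a)"
  unfolding quad_sum_def
  by (rule sum.reindex_bij_witness[where i = "\<lambda>(a, b, x, y). (b, a, y, x)" and j = "\<lambda>(a, b, x, y). (b, a, y, x)"])
     (auto simp: quads_def)

lemma quad_sum_split_ab:
  "full_sum N f = quad_sum N (\<lambda>a b x y. a = b) f + quad_sum N (\<lambda>a b x y. a > b) f
     + quad_sum N (\<lambda>a b x y. a < b) f"
  unfolding quad_sum_def sum.distrib[symmetric] by (intro sum.cong) auto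

lemma quad_sum_split_xy:
  "full_sum N f = quad_sum N (\<lambda>a b x y. x = y) f + quad_sum N (\<lambda>a b x y. x < y) f
     + quad_sum N (\<lambda>a b x y. y < x) f"
  unfolding quad_sum_def sum.distrib[symmetric] by (intro sum.cong) auto

text \<open>One step of Euclid's algorithm: \<open>a x + b y = (a - b) x + b (x + y)\<close>, so
  subtracting \<open>b\<close> from \<open>a\<close> maps \<open>a > b\<close> bijectively onto
  \<open>x < y\<close>.\<close>

lemma quad_sum_shift:
  "quad_sum N (\<lambda>a b x y. a > b) f = quad_sum N (\<lambda>a b x y. x < y) (\<lambda>a b. f (a + b) b)"
proof -
  have "quad_sum N (\<lambda>a b x y. a > b) f = (\<Sum>(a, b, x, y)\<in>{(a, b, x, y)\<in>quads N. a > b}. f a b)"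
    unfolding quad_sum_def by (rule sum.mono_neutral_cong_right) (auto split: if_splits)
  also have "\<dots> = (\<Sum>(a, b, x, y)\<in>{(a, b, x, y)\<in>quads N. x < y}. f (a + b) b)"
  proof (rule sum.reindex_bij_witness[where i = "\<lambda>(a, b, x, y). (a + b, b, x, y - x)"
          and j = "\<lambda>(a, b, x, y). (a - b, b, x, x + y)"], goal_cases)
    case (2 u)
    then obtain a b x y where u: "u = (a, b, x, y)" "(a, b, x, y) \<in> quads N" "a > b" by auto
    then obtain c where "a = b + c" "c > 0" using less_imp_add_positive by blast
    then show ?case using u by (auto simp: quads_def algebra_simps)
  next
    case (4 u)
    then obtain a b x y where u: "u = (a, b, x, y)" "(a, b, x, y) \<in> quads N" "x < y" by auto
    then obtain c where "y = x + c" "c > 0" using less_imp_add_positive by blast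
    then show ?case using u by (auto simp: quads_def algebra_simps)
  qed auto
  also have "\<dots> = quad_sum N (\<lambda>a b x y. x < y) (\<lambda>a b. f (a + b) b)"
    unfolding quad_sum_def by (rule sum.mono_neutral_cong_left) (auto split: if_splits)
  finally show ?thesis .
qed

lemma quad_sum_shift':
  "quad_sum N (\<lambda>a b x y. a < b) f = quad_sum N (\<lambda>a b x y. y < x) (\<lambda>a b. f a (a + b))"
  by (subst (1 2) quad_sum_swap) (simp add: quad_sum_shift add.commute)

definition absdiff :: "nat \<Rightarrow> nat \<Rightarrow> nat" where "absdiff a b = (a - b) + (b - a)"

context
  fixes N :: nat and G :: "nat \<Rightarrow> 'r::comm_ring_1"
begin

text \<open>The terms over \<open>x < y\<close> and \<open>a > b\<close> are complements of terms that the shift identifies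
  with each other, so only diagonal terms survive.\<close>

lemma quad_sum_weighted:
  "full_sum N (\<lambda>a b. of_nat (a * b) * (G (a + b) + G (absdiff a b))) =
     4 * full_sum N (\<lambda>a b. of_nat (a * b) * G a)
     + quad_sum N (\<lambda>a b x y. a = b) (\<lambda>a b. of_nat (a * a) * G 0)
     + quad_sum N (\<lambda>a b x y. x = y) (\<lambda>a b. of_nat (a * b) * G (a + b) - 2 * of_nat ((a + b) * b) * G a)"
proof -
  let ?xy = "quad_sum N (\<lambda>a b x y. x < y)" and ?yx = "quad_sum N (\<lambda>a b x y. y < x)"
  let ?ba = "quad_sum N (\<lambda>a b x y. a > b)" and ?ab = "quad_sum N (\<lambda>a b x y. a < b)"
  let ?xx = "quad_sum N (\<lambda>a b x y. x = y)" and ?aa = "quad_sum N (\<lambda>a b x y. a = b)"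
  \<comment> \<open>After the shift \<open>?f\<close> represents the terms with
    \<open>G (absdiff a b)\<close> and \<open>?g\<close> those with \<open>G (a + b)\<close>. Their
    sum is \<open>2 a b G a\<close>, and each occurs twice, whence the factor 4.\<close>
  let ?f = "\<lambda>a b. of_nat ((a + b) * b) * G a"
  let ?g = "\<lambda>a b. (of_nat a - of_nat b) * of_nat b * G a"
  have 1: "?ab (\<lambda>a b. of_nat (a * b) * G (absdiff a b)) = ?xy ?f"
  proof -
    have "?ab (\<lambda>a b. of_nat (a * b) * G (absdiff a b)) = ?yx (\<lambda>a b. of_nat (a * (a + b)) * G b)"
      by (subst quad_sum_shift') (simp add: absdiff_def)
    also have "\<dots> = ?xy ?f" by (subst quad_sum_swap) (simp add: algebra_simps)
    finally show ?thesis .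
  qed
  have 2: "?ba (\<lambda>a b. of_nat (a * b) * G (absdiff a b)) = ?xy ?f"
    by (subst quad_sum_shift) (simp add: absdiff_def)
  have 3: "?xy (\<lambda>a b. of_nat (a * b) * G (a + b)) = ?ba ?g"
    by (subst quad_sum_shift) (simp add: algebra_simps)
  have 4: "?yx (\<lambda>a b. of_nat (a * b) * G (a + b)) = ?ba ?g"
  proof -
    have "?yx (\<lambda>a b. of_nat (a * b) * G (a + b)) = ?xy (\<lambda>a b. of_nat (a * b) * G (a + b))"
      by (subst quad_sum_swap) (simp add: algebra_simps)
    then show ?thesis using 3 by simp
  qed
  have 5: "?ab ?g = - ?yx ?f"
  proof -
    have "?ab ?g = ?yx (\<lambda>a b. (-1) * ?f a b)"
      by (subst quad_sum_shift') (simp add: algebra_simps)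
    then show ?thesis by (simp only: quad_sum_cmult) simp
  qed
  have 6: "?aa ?g = 0" unfolding quad_sum_def by (intro sum.neutral) auto
  have 7: "?aa (\<lambda>a b. of_nat (a * b) * G (absdiff a b)) = ?aa (\<lambda>a b. of_nat (a * a) * G 0)"
    by (rule quad_sum_cong) (simp add: absdiff_def)
  have A: "full_sum N (\<lambda>a b. of_nat (a * b) * G (absdiff a b)) = ?aa (\<lambda>a b. of_nat (a * a) * G 0) + 2 * ?xy ?f"
    by (simp add: quad_sum_split_ab[of N "\<lambda>a b. of_nat (a * b) * G (absdiff a b)"] 1 2 7 del: of_nat_mult)
  have B: "full_sum N (\<lambda>a b. of_nat (a * b) * G (a + b)) = ?xx (\<lambda>a b. of_nat (a * b) * G (a + b)) + 2 * ?ba ?g"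
    by (simp add: quad_sum_split_xy[of N "\<lambda>a b. of_nat (a * b) * G (a + b)"] 3 4 del: of_nat_mult)
  have C: "full_sum N ?f = ?xx ?f + ?xy ?f + ?yx ?f" by (rule quad_sum_split_xy)
  have D: "full_sum N ?g = ?ba ?g - ?yx ?f" by (subst quad_sum_split_ab) (simp add: 5 6 del: of_nat_mult)
  have E: "full_sum N ?f + full_sum N ?g = 2 * full_sum N (\<lambda>a b. of_nat (a * b) * G a)"
    unfolding quad_sum_add[symmetric] quad_sum_cmult[symmetric]
    by (rule quad_sum_cong) (simp add: algebra_simps)
  have F: "?xx (\<lambda>a b. of_nat (a * b) * G (a + b) - 2 * of_nat ((a + b) * b) * G a) =
     ?xx (\<lambda>a b. of_nat (a * b) * G (a + b)) - 2 * ?xx ?f"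
    unfolding quad_sum_diff by (simp only: quad_sum_cmult mult.assoc)
  have "full_sum N (\<lambda>a b. of_nat (a * b) * (G (a + b) + G (absdiff a b))) =
    full_sum N (\<lambda>a b. of_nat (a * b) * G (a + b)) + full_sum N (\<lambda>a b. of_nat (a * b) * G (absdiff a b))"
    unfolding quad_sum_add[symmetric] by (rule quad_sum_cong) (simp add: algebra_simps)
  also have "\<dots> = ?xx (\<lambda>a b. of_nat (a * b) * G (a + b)) + ?aa (\<lambda>a b. of_nat (a * a) * G 0) + 2 * (?xy ?f + ?ba ?g)"
    unfolding A B by (simp only: algebra_simps)
  also have "?xy ?f + ?ba ?g = 2 * full_sum N (\<lambda>a b. of_nat (a * b) * G a) - ?xx ?f"
    using C D E by (simp add: algebra_simps del: of_nat_mult)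
  finally show ?thesis unfolding F by (simp add: algebra_simps del: of_nat_mult)
qed

text \<open>A Liouville identity. The shift turns the \<open>G (a + b)\<close> terms into sums of
  \<open>G a\<close> over \<open>a > b\<close> and the \<open>G (absdiff a b)\<close> terms into
  sums of \<open>G a\<close> over \<open>x < y\<close>. Splitting the full sum of \<open>G a\<close>
  once by \<open>a\<close>, \<open>b\<close> and once by \<open>x\<close>, \<open>y\<close> shows
  that these differ by diagonal terms only.\<close>

lemma quad_sum_plain:
  "full_sum N (\<lambda>a b. G (a + b) - G (absdiff a b)) =
     quad_sum N (\<lambda>a b x y. x = y) (\<lambda>a b. G (a + b) + 2 * G a)
     - quad_sum N (\<lambda>a b x y. a = b) (\<lambda>a b. G 0 + 2 * G a)"
proof -
  let ?xy = "quad_sum N (\<lambda>a b x y. x < y)" and ?yx = "quad_sum N (\<lambda>a b x y. y < x)"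
  let ?ba = "quad_sum N (\<lambda>a b x y. a > b)" and ?ab = "quad_sum N (\<lambda>a b x y. a < b)"
  let ?xx = "quad_sum N (\<lambda>a b x y. x = y)" and ?aa = "quad_sum N (\<lambda>a b x y. a = b)"
  let ?f = "\<lambda>a b. G a"
  have 1: "?ab (\<lambda>a b. G (absdiff a b)) = ?xy ?f"
    by (subst quad_sum_shift', subst quad_sum_swap) (simp add: absdiff_def)
  have 2: "?ba (\<lambda>a b. G (absdiff a b)) = ?xy ?f"
    by (subst quad_sum_shift) (simp add: absdiff_def)
  have 3: "?xy (\<lambda>a b. G (a + b)) = ?ba ?f"
    by (subst quad_sum_shift) simp
  have 4: "?yx (\<lambda>a b. G (a + b)) = ?ba ?f"
    by (subst quad_sum_swap) (simp add: 3[symmetric] add.commute)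
  have 5: "?ab ?f = ?yx ?f"
    by (subst quad_sum_shift') simp
  have 7: "?aa (\<lambda>a b. G (absdiff a b)) = ?aa (\<lambda>a b. G 0)"
    by (rule quad_sum_cong) (simp add: absdiff_def)
  have A: "full_sum N (\<lambda>a b. G (absdiff a b)) = ?aa (\<lambda>a b. G 0) + 2 * ?xy ?f"
    by (simp add: quad_sum_split_ab[of N "\<lambda>a b. G (absdiff a b)"] 1 2 7)
  have B: "full_sum N (\<lambda>a b. G (a + b)) = ?xx (\<lambda>a b. G (a + b)) + 2 * ?ba ?f"
    by (simp add: quad_sum_split_xy[of N "\<lambda>a b. G (a + b)"] 3 4)
  have C: "full_sum N ?f = ?xx ?f + ?xy ?f + ?yx ?f" by (rule quad_sum_split_xy)
  have D: "full_sum N ?f = ?aa ?f + ?ba ?f + ?yx ?f" unfolding 5[symmetric] by (rule quad_sum_split_ab)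
  have E: "?ba ?f = ?xx ?f + ?xy ?f - ?aa ?f" using C D by (simp add: algebra_simps)
  show ?thesis
    unfolding quad_sum_diff quad_sum_add quad_sum_cmult A B E by (simp add: algebra_simps)
qed

end

text \<open>For \<open>a = b = d\<close> the equation becomes \<open>d (x + y) = N\<close>, with
  \<open>N div d - 1\<close> positive solutions for each divisor \<open>d\<close>.\<close>

lemma quad_sum_diag_a:
  assumes "N > 0"
  shows "quad_sum N (\<lambda>a b x y. a = b) f = (\<Sum>d | d dvd N. of_nat (N div d - 1) * f d d)"
proof -
  have "quad_sum N (\<lambda>a b x y. a = b) f = (\<Sum>(a, b, x, y)\<in>{(a, b, x, y)\<in>quads N. a = b}. f a b)"
    unfolding quad_sum_def by (rule sum.mono_neutral_cong_right) (auto split: if_splits)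
  also have "\<dots> = (\<Sum>(d, x)\<in>(SIGMA d:{d. d dvd N}. {1..<N div d}). f d d)"
  proof (rule sum.reindex_bij_witness[where i = "\<lambda>(d, x). (d, d, x, N div d - x)"
          and j = "\<lambda>(a, b, x, y). (a, x)"], goal_cases)
    case (1 u)
    then show ?case by (auto simp: quads_def add_mult_distrib2[symmetric])
  next
    case (2 u)
    then obtain a x y where u: "u = (a, a, x, y)" and *: "a > 0" "x > 0" "y > 0" "a * (x + y) = N"
      by (auto simp: quads_def add_mult_distrib2)
    then have "N div a = x + y" by auto
    then show ?case using * u by auto
  next
    case (3 v)
    then show ?case by (cases v) auto
  next
    case (4 v)
    then obtain d x where v: "v = (d, x)" "d dvd N" "1 \<le> x" "x < N div d" by auto
    then have "d * x + d * (N div d - x) = N" by (simp add: add_mult_distrib2[symmetric])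
    moreover have "d > 0" using v assms by (cases d) auto
    ultimately show ?case using v by (auto simp: quads_def)
  next
    case (5 u) then show ?case by auto
  qed
  also have "\<dots> = (\<Sum>d | d dvd N. \<Sum>x\<in>{1..<N div d}. f d d)"
    using assms by (intro sum.Sigma[symmetric]) auto
  finally show ?thesis by simp
qed

lemma quad_sum_diag_x:
  assumes "N > 0"
  shows "quad_sum N (\<lambda>a b x y. x = y) f = (\<Sum>d | d dvd N. \<Sum>a\<in>{1..<d}. f a (d - a))"
proof -
  have "quad_sum N (\<lambda>a b x y. x = y) f = (\<Sum>(a, b, x, y)\<in>{(a, b, x, y)\<in>quads N. x = y}. f a b)"
    unfolding quad_sum_def by (rule sum.mono_neutral_cong_right) (auto split: if_splits)
  also have "\<dots> = (\<Sum>(d, a)\<in>(SIGMA d:{d. d dvd N}. {1..<d}). f a (d - a))"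
  proof (rule sum.reindex_bij_witness[where i = "\<lambda>(d, a). (a, d - a, N div d, N div d)"
          and j = "\<lambda>(a, b, x, y). (a + b, a)"], goal_cases)
    case (1 u)
    then show ?case by (auto simp: quads_def add_mult_distrib[symmetric])
  next
    case (2 u)
    then show ?case by (auto simp: quads_def add_mult_distrib[symmetric])
  next
    case (3 v)
    then show ?case by (cases v) auto
  next
    case (4 v)
    then obtain d a where v: "v = (d, a)" "d dvd N" "1 \<le> a" "a < d" by auto
    then have "a * (N div d) + (d - a) * (N div d) = N" by (simp add: add_mult_distrib[symmetric])
    moreover have "N div d > 0" using v assms by (auto simp: div_greater_zero_iff dvd_imp_le)
    ultimately show ?case using v by (auto simp: quads_def)
  next
    case (5 u) then show ?case by auto
  qed
  also have "\<dots> = (\<Sum>d | d dvd N. \<Sum>a\<in>{1..<d}. f a (d - a))"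
    using assms by (intro sum.Sigma[symmetric]) (auto intro: finite_subset)
  finally show ?thesis .
qed

section \<open>Lambert series and their products\<close>

definition lambert :: "(nat \<Rightarrow> 'r::comm_ring_1) \<Rightarrow> 'r fps" where
  "lambert f = Abs_fps (\<lambda>n. if n = 0 then 0 else \<Sum>d | d dvd n. f d)"

lemma lambert_nth: "fps_nth (lambert f) n = (if n = 0 then 0 else \<Sum>d | d dvd n. f d)"
  by (simp add: lambert_def)

lemma lambert_mult_nth:
  "fps_nth (lambert f * lambert g) N = full_sum N (\<lambda>a b. f a * g b)"
proof -
  let ?D = "\<lambda>n. {d. d dvd n}"
  have "fps_nth (lambert f * lambert g) N = (\<Sum>i\<in>{0..N}. if 0 < i \<and> i < N
      then (\<Sum>a\<in>?D i. f a) * (\<Sum>b\<in>?D (N - i). g b) else 0)"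
    unfolding fps_mult_nth lambert_nth by (intro sum.cong) auto
  also have "\<dots> = (\<Sum>i\<in>{0<..<N}. (\<Sum>a\<in>?D i. f a) * (\<Sum>b\<in>?D (N - i). g b))"
    by (rule sum.mono_neutral_cong_right) (auto split: if_splits)
  also have "\<dots> = (\<Sum>i\<in>{0<..<N}. \<Sum>(a, b)\<in>?D i \<times> ?D (N - i). f a * g b)"
    by (simp add: sum_product sum.cartesian_product)
  also have "\<dots> = (\<Sum>(i, a, b)\<in>(SIGMA i:{0<..<N}. ?D i \<times> ?D (N - i)). f a * g b)"
    by (subst sum.Sigma) (auto simp: split_beta)
  also have "\<dots> = (\<Sum>(a, b, x, y)\<in>quads N. f a * g b)"
  proof (rule sum.reindex_bij_witness[where j = "\<lambda>(i, a, b). (a, b, i div a, (N - i) div b)"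
          and i = "\<lambda>(a, b, x, y). (a * x, a, b)"], goal_cases)
    case (1 u)
    then show ?case by auto
  next
    case (2 u)
    then obtain i a b where u: "u = (i, a, b)" and i: "0 < i" "i < N" and "a dvd i" "b dvd N - i"
      by auto
    then obtain k l where kl: "i = a * k" "N - i = b * l" by (elim dvdE)
    have "a * k > 0" "b * l > 0" using i unfolding kl[symmetric] by auto
    then have "a > 0" "k > 0" "b > 0" "l > 0" by (metis gr0I mult_0 mult_0_right)+
    then show ?case using i kl u by (auto simp: quads_def)
  next
    case (3 v)
    then show ?case by (auto simp: quads_def)
  next
    case (4 v)
    then show ?case by (auto simp: quads_def)
  next
    case (5 u) then show ?case by auto
  qed
  finally show ?thesis unfolding quad_sum_def by simp
qed

section \<open>Bernoulli numbers and the double pole\<close>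

declare bernoulli_num.simps [simp del]

lemma bernoulli_num_0: "bernoulli_num 0 = 1"
  by (simp add: bernoulli_num.simps)

lemma bernoulli_num_rec:
  "n > 0 \<Longrightarrow> of_nat (n + 1) * bernoulli_num n = - (\<Sum>k<n. of_nat ((n + 1) choose k) * bernoulli_num k)"
  by (subst bernoulli_num.simps) (simp del: of_nat_Suc)

lemma bernoulli_num_sum:
  assumes "n \<ge> 2" shows "(\<Sum>k<n. of_nat (n choose k) * bernoulli_num k) = 0"
proof -
  obtain m where m: "n = Suc m" "m > 0" using assms by (cases n) auto
  show ?thesis using bernoulli_num_rec[OF m(2)] by (simp add: m(1) algebra_simps)
qed

lemma bernoulli_num_1: "bernoulli_num 1 = -1/2"
  using bernoulli_num_rec[of 1] by (simp add: bernoulli_num_0)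

lemma bernoulli_num_2: "bernoulli_num 2 = 1/6"
  using bernoulli_num_rec[of 2] bernoulli_num_1 by (simp add: bernoulli_num_0 numeral_2_eq_2 lessThan_Suc)

lemma bernoulli_num_3: "bernoulli_num 3 = 0"
  using bernoulli_num_rec[of 3] bernoulli_num_1 bernoulli_num_2
  by (simp add: bernoulli_num_0 numeral_2_eq_2 numeral_3_eq_3 lessThan_Suc)

lemma bernoulli_num_4: "bernoulli_num 4 = -1/30"
  using bernoulli_num_rec[of 4] bernoulli_num_1 bernoulli_num_2 bernoulli_num_3
  by (simp add: bernoulli_num_0 eval_nat_numeral lessThan_Suc)

lemma bernoulli_num_5: "bernoulli_num 5 = 0"
  using bernoulli_num_rec[of 5] bernoulli_num_1 bernoulli_num_2 bernoulli_num_3 bernoulli_num_4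
  by (simp add: bernoulli_num_0 eval_nat_numeral lessThan_Suc)

lemma bernoulli_num_6: "bernoulli_num 6 = 1/42"
  using bernoulli_num_rec[of 6] bernoulli_num_1 bernoulli_num_2 bernoulli_num_3 bernoulli_num_4 bernoulli_num_5
  by (simp add: bernoulli_num_0 eval_nat_numeral lessThan_Suc)

text \<open>Formally \<open>z / (exp z - 1)\<close>; \<open>bernoulli_fps_exp\<close> is the
  defining recurrence read as a Cauchy product.\<close>

definition bernoulli_fps :: "rat fps" where
  "bernoulli_fps = Abs_fps (\<lambda>n. bernoulli_num n / fact n)"

lemma bernoulli_fps_exp: "bernoulli_fps * (fps_exp 1 - 1) = fps_X"
proof (rule fps_ext)
  fix n
  have "fps_nth (bernoulli_fps * (fps_exp 1 - 1)) n =
      (\<Sum>i=0..n. bernoulli_num i / fact i * (if i = n then 0 else 1 / fact (n - i)))"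
    unfolding fps_mult_nth by (intro sum.cong) (auto simp: bernoulli_fps_def)
  also have "\<dots> = (\<Sum>i<n. bernoulli_num i / fact i * (1 / fact (n - i)))"
    by (rule sum.mono_neutral_cong_right) auto
  also have "\<dots> = (\<Sum>i<n. of_nat (n choose i) * bernoulli_num i / fact n)"
    by (intro sum.cong) (auto simp: binomial_fact)
  also have "\<dots> = (\<Sum>i<n. of_nat (n choose i) * bernoulli_num i) / fact n"
    by (simp add: sum_divide_distrib)
  also have "\<dots> = fps_nth fps_X n"
  proof (cases "n \<ge> 2")
    case True then show ?thesis using bernoulli_num_sum[OF True] by (simp add: fps_X_nth)
  next
    case False
    then consider "n = 0" | "n = 1" by linarith
    then show ?thesis by cases (auto simp: bernoulli_num_0)
  qed
  finally show "fps_nth (bernoulli_fps * (fps_exp 1 - 1)) n = fps_nth fps_X n" .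
qed

text \<open>\<open>weier_fps\<close> is \<open>z\<^sup>2\<close> times the double pole \<open>x / (1 - x)\<^sup>2\<close> at \<open>x = exp z\<close>.\<close>

definition weier_fps :: "rat fps" where
  "weier_fps = fps_exp 1 * bernoulli_fps ^ 2"

text \<open>The derivative of \<open>1 / (exp z - 1)\<close> is minus the double pole.
  Differentiating \<open>Y (exp z - 1) = z\<close> and multiplying by \<open>Y\<close> expresses
  this without denominators; it makes the Taylor coefficients of the double pole explicit in
  Bernoulli numbers.\<close>

lemma weier_fps_eq: "weier_fps = bernoulli_fps - fps_XD bernoulli_fps"
proof -
  let ?Y = bernoulli_fps and ?X = "fps_exp 1 :: rat fps"
  have "fps_deriv (?Y * (?X - 1)) = 1" unfolding bernoulli_fps_exp by simp
  then have "fps_deriv ?Y * (?X - 1) + ?Y * ?X = 1" by (simp add: add.commute)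
  then have "(fps_deriv ?Y * (?X - 1) + ?Y * ?X) * ?Y = ?Y" by simp
  then have "fps_deriv ?Y * (?Y * (?X - 1)) + ?X * ?Y ^ 2 = ?Y"
    by (simp add: algebra_simps power2_eq_square)
  then show ?thesis unfolding bernoulli_fps_exp weier_fps_def fps_XD_def
    by (simp add: algebra_simps)
qed

lemma weier_fps_nth: "fps_nth weier_fps n = (1 - of_nat n) * bernoulli_num n / fact n"
  by (simp add: weier_fps_eq bernoulli_fps_def algebra_simps diff_divide_distrib)

text \<open>The double pole \<open>P = x / (1 - x)^2\<close> with \<open>x = exp z\<close> satisfies
  \<open>P'' = P + 6 P^2\<close>. As \<open>P\<close> is not a power series, the equation is
  rewritten for \<open>z^2 P\<close> in terms of the operator \<open>z d/dz\<close>.\<close>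

lemma weier_fps_ode:
  "fps_XD (fps_XD weier_fps) = 5 * fps_XD weier_fps - 6 * weier_fps + fps_X ^ 2 * weier_fps + 6 * weier_fps ^ 2"
proof -
  let ?Y = bernoulli_fps and ?X = "fps_exp 1 :: rat fps" and ?z = "fps_X :: rat fps"
  \<comment> \<open>\<open>V\<close> is \<open>z exp z / (exp z - 1)\<close>. In terms of
    \<open>V\<close> and \<open>z\<close> both \<open>weier_fps\<close> and the derivative of
    \<open>V\<close> become polynomials, so the claim reduces to a polynomial identity.\<close>
  define V where "V = ?X * ?Y"
  have V: "V = ?Y + ?z" using bernoulli_fps_exp by (simp add: V_def algebra_simps)
  have XDX: "fps_XD ?X = ?z * ?X" and XDz: "fps_XD ?z = ?z" by (simp_all add: fps_XD_def)
  have XDY: "fps_XD ?Y = ?Y - ?X * ?Y ^ 2"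
    using weier_fps_eq by (simp add: weier_fps_def algebra_simps)
  have XDV: "fps_XD V = ?z * V + V - V ^ 2"
    by (simp add: V_def fps_XD_mult XDX XDY algebra_simps power2_eq_square)
  have w: "weier_fps = V ^ 2 - ?z * V"
  proof -
    have "weier_fps = V * ?Y" by (simp add: weier_fps_def V_def power2_eq_square mult_ac)
    also have "?Y = V - ?z" using V by simp
    finally show ?thesis by (simp add: algebra_simps power2_eq_square)
  qed
  show ?thesis
  proof -
    define q where "q = ?z * V + V - V * V"
    have q: "fps_XD V = q" by (simp add: XDV q_def power2_eq_square)
    have qq: "fps_XD q = ?z * V + ?z * q + q - (q * V + V * q)"
      unfolding q_def by (simp only: fps_XD_add fps_XD_diff fps_XD_mult XDz q) (simp add: q_def)
    have a1: "fps_XD weier_fps = q * V + V * q - (?z * V + ?z * q)"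
      unfolding w by (simp only: power2_eq_square fps_XD_diff fps_XD_mult XDz q)
    then have a2: "fps_XD (fps_XD weier_fps) =
       (fps_XD q * V + q * q) + (q * q + V * fps_XD q) - ((?z * V + ?z * q) + (?z * q + ?z * fps_XD q))"
      by (simp only: fps_XD_diff fps_XD_add fps_XD_mult XDz q)
    show ?thesis unfolding a2 unfolding a1 qq unfolding w q_def by algebra
  qed
qed

section \<open>The Fourier expansion of the Weierstrass function\<close>

definition cosh_fps :: "nat \<Rightarrow> rat fps" where
  "cosh_fps d = fps_exp (of_nat d) + fps_exp (- of_nat d)"

lemma cosh_fps_nth: "fps_nth (cosh_fps d) m = (of_nat d ^ m + (- of_nat d) ^ m) / fact m"
  by (simp add: cosh_fps_def add_divide_distrib)

lemma cosh_fps_0: "cosh_fps 0 = 2"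
  by (simp add: cosh_fps_def)

lemma cosh_fps_mult: "cosh_fps a * cosh_fps b = cosh_fps (a + b) + cosh_fps (absdiff a b)"
proof (cases "a \<le> b")
  case True
  then obtain c where "b = a + c" using le_Suc_ex by blast
  then show ?thesis
    by (simp add: cosh_fps_def absdiff_def algebra_simps flip: fps_exp_add_mult)
next
  case False
  then obtain c where "a = b + c" using le_Suc_ex nat_le_linear by blast
  then show ?thesis
    by (simp add: cosh_fps_def absdiff_def algebra_simps flip: fps_exp_add_mult)
qed

lemma cosh_fps_deriv2: "fps_deriv (fps_deriv (cosh_fps d)) = of_nat (d * d) * cosh_fps d"
proof -
  have "fps_const (- of_nat d) = (- of_nat d :: rat fps)"
    by (simp add: fps_of_nat flip: fps_const_neg)
  then show ?thesis by (simp add: cosh_fps_def algebra_simps fps_of_nat)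
qed

text \<open>The Fejer kernel: the sum of \<open>(d - |j|) x^j\<close> over \<open>|j| < d\<close>,
  which is the quotient of \<open>x^d + x^(-d) - 2\<close> by \<open>x + x^(-1) - 2\<close>.\<close>

definition fejer_fps :: "nat \<Rightarrow> rat fps" where
  "fejer_fps d = of_nat d + (\<Sum>j\<in>{1..<d}. of_nat (d - j) * cosh_fps j)"

lemma fejer_fps_Suc: "fejer_fps (Suc d) = fejer_fps d + 1 + (\<Sum>j\<in>{1..<Suc d}. cosh_fps j)"
proof -
  have "(\<Sum>j\<in>{1..<Suc d}. of_nat (Suc d - j) * cosh_fps j) =
    (\<Sum>j\<in>{1..<Suc d}. of_nat (d - j) * cosh_fps j + cosh_fps j)"
    by (intro sum.cong) (auto simp: Suc_diff_le algebra_simps)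
  also have "\<dots> = (\<Sum>j\<in>{1..<Suc d}. of_nat (d - j) * cosh_fps j) + (\<Sum>j\<in>{1..<Suc d}. cosh_fps j)"
    by (rule sum.distrib)
  also have "(\<Sum>j\<in>{1..<Suc d}. of_nat (d - j) * cosh_fps j) = (\<Sum>j\<in>{1..<d}. of_nat (d - j) * cosh_fps j)"
    by (rule sum.mono_neutral_right) auto
  finally show ?thesis by (simp add: fejer_fps_def)
qed

lemma cosh_fps_minus_2: "cosh_fps d - 2 = (cosh_fps 1 - 2) * fejer_fps d"
proof (induction d rule: induct_nat_012)
  case 0 then show ?case by (simp add: cosh_fps_0 fejer_fps_def)
next
  case 1 then show ?case by (simp add: fejer_fps_def)
next
  case (ge2 d)
  have "fejer_fps (Suc (Suc d)) = 2 * fejer_fps (Suc d) - fejer_fps d + cosh_fps (Suc d)"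
    by (simp add: fejer_fps_Suc)
  moreover have "cosh_fps (Suc d) * cosh_fps 1 = cosh_fps (Suc (Suc d)) + cosh_fps d"
    by (simp add: cosh_fps_mult absdiff_def)
  ultimately show ?case using ge2 by algebra
qed

text \<open>The double pole is \<open>1 / (x + x^(-1) - 2)\<close>, so multiplying it by
  \<open>cosh_fps d - 2\<close> cancels the pole and leaves the Fejer kernel.\<close>

lemma weier_fps_cosh: "weier_fps * (cosh_fps d - 2) = fps_X ^ 2 * fejer_fps d"
proof -
  have XXi: "fps_exp 1 * fps_exp (-1) = (1 :: rat fps)"
    by (simp flip: fps_exp_add_mult)
  have "fps_exp 1 * (cosh_fps 1 - 2) = (fps_exp 1 - 1) ^ 2"
    using XXi by (simp add: cosh_fps_def power2_eq_square algebra_simps)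
  then have "weier_fps * (cosh_fps 1 - 2) = (bernoulli_fps * (fps_exp 1 - 1)) ^ 2"
    unfolding weier_fps_def power_mult_distrib by (metis mult.commute mult.assoc)
  also have "\<dots> = fps_X ^ 2" by (simp only: bernoulli_fps_exp)
  finally show ?thesis unfolding cosh_fps_minus_2[of d] by (simp only: mult.assoc[symmetric])
qed

text \<open>The coefficient of \<open>q^N\<close> in the Weierstrass function (scaled by
  \<open>(2 pi i)^2\<close>) with its pole \<open>1 / z^2\<close> removed, as a series in
  \<open>z\<close>. The summand \<open>1/12\<close> is its usual constant term.\<close>

definition wp_coeff :: "nat \<Rightarrow> rat fps" where
  "wp_coeff N = (if N = 0 then fps_shift 2 weier_fps + fps_const (1/12)
     else \<Sum>d | d dvd N. of_nat d * (cosh_fps d - 2))"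

lemma weier_fps_wp_coeff: "weier_fps = 1 + fps_X ^ 2 * (wp_coeff 0 - fps_const (1/12))"
proof (rule fps_ext)
  fix n :: nat
  consider "n = 0" | "n = 1" | "n \<ge> 2" by linarith
  then show "fps_nth weier_fps n = fps_nth (1 + fps_X ^ 2 * (wp_coeff 0 - fps_const (1/12))) n"
  proof cases
    case 3
    then obtain k where "n = k + 2" using le_Suc_ex by (metis add.commute)
    then show ?thesis by (simp add: wp_coeff_def fps_X_power_mult_nth)
  qed (auto simp: fps_X_power_mult_nth weier_fps_nth bernoulli_num_0)
qed

text \<open>Adding \<open>1/12\<close> completes the square: \<open>P'' = P + 6 P^2\<close> becomes
  \<open>W'' = 6 W^2 - 1/24\<close> for \<open>W = P + 1/12\<close>. The term
  \<open>12 * wp_coeff 0\<close> is the cross term of \<open>6 W^2\<close> with the pole, after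
  multiplication by \<open>z^2\<close>.\<close>

lemma wp_coeff_ode_0:
  "fps_X ^ 2 * fps_deriv (fps_deriv (wp_coeff 0)) =
     12 * wp_coeff 0 + 6 * fps_X ^ 2 * wp_coeff 0 ^ 2 - fps_X ^ 2 * fps_const (1/24)"
proof -
  define r where "r = wp_coeff 0 - fps_const (1/12)"
  let ?z = "fps_X :: rat fps"
  have w: "weier_fps = 1 + ?z ^ 2 * r" by (simp add: r_def weier_fps_wp_coeff)
  define r' r'' where "r' = fps_deriv r" and "r'' = fps_deriv r'"
  have d: "fps_XD (1 + ?z * ?z * r) = 2 * (?z * ?z * r) + ?z * ?z * ?z * r'"
    by (simp add: fps_XD_def r'_def algebra_simps)
  have dd: "fps_XD (2 * (?z * ?z * r) + ?z * ?z * ?z * r') =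
      4 * (?z * ?z * r) + 2 * (?z * ?z * ?z * r') + 3 * (?z * ?z * ?z * r') + ?z * ?z * ?z * ?z * r''"
    by (simp add: fps_XD_def r'_def r''_def algebra_simps)
  have "fps_XD (fps_XD weier_fps) = 4 * (?z * ?z * r) + 2 * (?z * ?z * ?z * r') + 3 * (?z * ?z * ?z * r') + ?z * ?z * ?z * ?z * r''"
    by (simp only: w power2_eq_square d dd)
  moreover have "fps_XD weier_fps = 2 * (?z * ?z * r) + ?z * ?z * ?z * r'"
    by (simp only: w power2_eq_square d)
  ultimately have "?z ^ 2 * (?z ^ 2 * r'') = ?z ^ 2 * (1 + ?z ^ 2 * r + 12 * r + 6 * ?z ^ 2 * r ^ 2)"
    using weier_fps_ode w by algebra
  then have "?z ^ 2 * fps_deriv (fps_deriv r) = 1 + ?z ^ 2 * r + 12 * r + 6 * ?z ^ 2 * r ^ 2"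
    unfolding r''_def r'_def by (subst (asm) mult_cancel_left) simp
  moreover have "fps_deriv (fps_deriv r) = fps_deriv (fps_deriv (wp_coeff 0))" by (simp add: r_def)
  moreover have "1 + ?z ^ 2 * r + 12 * r + 6 * ?z ^ 2 * r ^ 2 =
     12 * wp_coeff 0 + 6 * fps_X ^ 2 * wp_coeff 0 ^ 2 - fps_X ^ 2 * fps_const (1/24)"
  proof -
    define c :: "rat fps" where "c = fps_const (1/24)"
    have c: "24 * c = 1" by (simp add: c_def fps_numeral_fps_const)
    have c2: "fps_const (1/12) = 2 * c" by (simp add: c_def fps_numeral_fps_const)
    show ?thesis unfolding r_def c2 c_def[symmetric] using c by algebra
  qed
  ultimately show ?thesis by simp
qed

text \<open>The leading factor is an integer, so that one definition serves over the integers, the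
  rationals, the reals and \<open>k\<close>, and is preserved by all coefficient maps.\<close>

definition eis :: "int \<Rightarrow> nat \<Rightarrow> 'a::comm_ring_1 fps" where
  "eis c m = 1 + fps_const (of_int c) * lambert (\<lambda>d. of_nat d ^ m)"

abbreviation E2 :: "'a::comm_ring_1 fps" where "E2 \<equiv> eis (-24) 1"
abbreviation E4 :: "'a::comm_ring_1 fps" where "E4 \<equiv> eis 240 3"
abbreviation E6 :: "'a::comm_ring_1 fps" where "E6 \<equiv> eis (-504) 5"

lemma eis_nth: "fps_nth (eis c m) n = (if n = 0 then 1 else of_int c * (\<Sum>d | d dvd n. of_nat d ^ m))"
  by (simp add: eis_def lambert_nth)

lemma (in rhom) map_fps_eis: "map_fps h (eis c m) = eis c m"
  by (simp add: fps_eq_iff eis_nth one mult of_int sum power of_nat)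

text \<open>The constant of the differential equation, classically \<open>- E4 / 24\<close>. The
  divisor sums deliver it in terms of \<open>E2\<close>; equating both forms yields Ramanujan's
  equation for \<open>E2\<close>.\<close>

definition wp_const :: "rat fps" where
  "wp_const = fps_const (1/2) * fps_XD E2 - fps_const (1/24) * E2 ^ 2"

lemma sum_mult_diff: "6 * (\<Sum>a\<in>{1..<d}. of_nat (a * (d - a))) = (of_nat d ^ 3 - of_nat d :: 'a::comm_ring_1)"
proof -
  have "6 * (\<Sum>a\<in>{1..<d}. a * (d - a)) + d = d ^ 3" 
  proof -
    have *: "int (\<Sum>a\<in>{1..<d}. a * (d - a)) = (\<Sum>a<d. int a * (int d - int a))"
      by (simp add: of_nat_diff) (rule sum.mono_neutral_cong_left, auto simp: of_nat_diff)
    \<comment> \<open>The upper limit \<open>n\<close> and the parameter \<open>z\<close> are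
      separated so that induction on \<open>n\<close> applies; both are then set to
      \<open>d\<close>.\<close>
    have "6 * (\<Sum>a<n. int a * (z - int a)) = 3 * z * int n * (int n - 1) - int n * (int n - 1) * (2 * int n - 1)" for n and z :: int
      by (induction n) (simp_all add: algebra_simps)
    from this[where n = d and z = "int d"] have "int (6 * (\<Sum>a\<in>{1..<d}. a * (d - a)) + d) = int (d ^ 3)"
      using * by (simp add: algebra_simps power3_eq_cube)
    then show ?thesis by (simp only: of_nat_eq_iff)
  qed
  then have "of_nat (6 * (\<Sum>a\<in>{1..<d}. a * (d - a)) + d) = (of_nat (d ^ 3) :: 'a)" by simp
  then show ?thesis by (simp add: algebra_simps eq_diff_eq)
qed

text \<open>Multiplying out gives \<open>a b (cosh_fps (a + b) + cosh_fps (absdiff a b))\<close>,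
  where \<open>quad_sum_weighted\<close> applies with \<open>G = cosh_fps\<close>. Its nondiagonal
  part cancels exactly against the mixed terms coming from the two summands
  \<open>- 2\<close>.\<close>

lemma wp_coeff_product:
  assumes N: "N > 0"
  shows "6 * full_sum N (\<lambda>a b. (of_nat a * (cosh_fps a - 2)) * (of_nat b * (cosh_fps b - 2))) =
     (\<Sum>d | d dvd N. of_nat d ^ 3 * cosh_fps d - of_nat d * cosh_fps d - 12 * of_nat d * fejer_fps d)
     + 12 * of_nat N * (\<Sum>d | d dvd N. of_nat d) + 24 * full_sum N (\<lambda>a b. of_nat a * of_nat b)"
proof -
  have swap: "full_sum N (\<lambda>a b. of_nat (a * b) * cosh_fps b) = full_sum N (\<lambda>a b. of_nat (a * b) * cosh_fps a)"
    by (subst quad_sum_swap) (simp add: mult_ac)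
  have "full_sum N (\<lambda>a b. (of_nat a * (cosh_fps a - 2)) * (of_nat b * (cosh_fps b - 2))) =
    full_sum N (\<lambda>a b. of_nat (a * b) * (cosh_fps (a + b) + cosh_fps (absdiff a b))
      - 2 * (of_nat (a * b) * cosh_fps a) - 2 * (of_nat (a * b) * cosh_fps b) + 4 * (of_nat a * of_nat b))"
    unfolding cosh_fps_mult[symmetric] by (rule quad_sum_cong) (simp add: algebra_simps)
  also have "\<dots> = full_sum N (\<lambda>a b. of_nat (a * b) * (cosh_fps (a + b) + cosh_fps (absdiff a b)))
      - 4 * full_sum N (\<lambda>a b. of_nat (a * b) * cosh_fps a) + 4 * full_sum N (\<lambda>a b. of_nat a * of_nat b)"
    unfolding quad_sum_add quad_sum_diff quad_sum_cmult swap by (simp add: algebra_simps)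
  also have "\<dots> = quad_sum N (\<lambda>a b x y. a = b) (\<lambda>a b. of_nat (a * a) * cosh_fps 0)
     + quad_sum N (\<lambda>a b x y. x = y) (\<lambda>a b. of_nat (a * b) * cosh_fps (a + b) - 2 * of_nat ((a + b) * b) * cosh_fps a)
     + 4 * full_sum N (\<lambda>a b. of_nat a * of_nat b)"
    unfolding quad_sum_weighted by (simp add: algebra_simps)
  finally have 1: "6 * full_sum N (\<lambda>a b. (of_nat a * (cosh_fps a - 2)) * (of_nat b * (cosh_fps b - 2))) =
      6 * quad_sum N (\<lambda>a b x y. a = b) (\<lambda>a b. of_nat (a * a) * cosh_fps 0)
     + 6 * quad_sum N (\<lambda>a b x y. x = y) (\<lambda>a b. of_nat (a * b) * cosh_fps (a + b) - 2 * of_nat ((a + b) * b) * cosh_fps a)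
     + 24 * full_sum N (\<lambda>a b. of_nat a * of_nat b)"
    by (simp add: algebra_simps)
  have 2: "6 * quad_sum N (\<lambda>a b x y. a = b) (\<lambda>a b. of_nat (a * a) * cosh_fps 0) =
     (\<Sum>d | d dvd N. 12 * of_nat N * of_nat d - 12 * of_nat (d * d))"
    unfolding quad_sum_diag_a[OF N] sum_distrib_left
  proof (intro sum.cong refl, goal_cases)
    case (1 d)
    then obtain k where k: "N = d * k" "d > 0" "k > 0" using N by auto
    then have "of_nat (N div d - 1) = (of_nat k - 1 :: rat fps)" by (simp add: of_nat_diff)
    then show ?case unfolding cosh_fps_0 by (simp only: k(1) of_nat_mult) (simp add: algebra_simps)
  qed
  have 3: "6 * quad_sum N (\<lambda>a b x y. x = y) (\<lambda>a b. of_nat (a * b) * cosh_fps (a + b) - 2 * of_nat ((a + b) * b) * cosh_fps a) =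
     (\<Sum>d | d dvd N. of_nat d ^ 3 * cosh_fps d - of_nat d * cosh_fps d - 12 * of_nat d * fejer_fps d + 12 * of_nat (d * d))"
    unfolding quad_sum_diag_x[OF N] sum_distrib_left[of 6 _ "{d. d dvd N}"]
  proof (intro sum.cong refl)
    fix d
    have "(\<Sum>a\<in>{1..<d}. of_nat (a * (d - a)) * cosh_fps (a + (d - a)) - 2 * of_nat ((a + (d - a)) * (d - a)) * cosh_fps a) =
      (\<Sum>a\<in>{1..<d}. of_nat (a * (d - a)) * cosh_fps d - 2 * of_nat d * (of_nat (d - a) * cosh_fps a))"
      by (intro sum.cong) auto
    also have "\<dots> = (\<Sum>a\<in>{1..<d}. of_nat (a * (d - a))) * cosh_fps d - 2 * of_nat d * (fejer_fps d - of_nat d)"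
      by (simp only: sum_subtractf sum_distrib_left[symmetric] sum_distrib_right[symmetric] fejer_fps_def) simp
    finally have "6 * (\<Sum>a\<in>{1..<d}. of_nat (a * (d - a)) * cosh_fps (a + (d - a)) - 2 * of_nat ((a + (d - a)) * (d - a)) * cosh_fps a) =
      (6 * (\<Sum>a\<in>{1..<d}. of_nat (a * (d - a)))) * cosh_fps d - 12 * of_nat d * (fejer_fps d - of_nat d)"
      by (simp only: right_diff_distrib mult.assoc) simp
    also have "\<dots> = of_nat d ^ 3 * cosh_fps d - of_nat d * cosh_fps d - 12 * of_nat d * fejer_fps d + 12 * of_nat (d * d)"
      unfolding sum_mult_diff by (simp add: algebra_simps)
    finally show "6 * (\<Sum>a\<in>{1..<d}. of_nat (a * (d - a)) * cosh_fps (a + (d - a)) - 2 * of_nat ((a + (d - a)) * (d - a)) * cosh_fps a) =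
      of_nat d ^ 3 * cosh_fps d - of_nat d * cosh_fps d - 12 * of_nat d * fejer_fps d + 12 * of_nat (d * d)" .
  qed
  show ?thesis unfolding 1 2 3
    by (simp add: sum.distrib sum_subtractf sum_distrib_left mult.assoc)
qed

lemma wp_const_nth:
  assumes N: "N > 0"
  shows "fps_nth wp_const N = 2 * (\<Sum>d | d dvd N. of_nat d) - 12 * of_nat N * (\<Sum>d | d dvd N. of_nat d)
    - 24 * full_sum N (\<lambda>a b. of_nat a * of_nat b)"
proof -
  let ?L = "lambert (\<lambda>d. of_nat d) :: rat fps"
  have "fps_const (-24) = (-24 :: rat fps)" by (simp add: fps_numeral_fps_const)
  moreover have "E2 = 1 + fps_const (-24) * ?L" by (simp add: eis_def)
  ultimately have E2: "E2 = 1 - 24 * ?L" by (simp only: mult_minus_left add_uminus_conv_diff)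
  have sq: "E2 ^ 2 = 1 - fps_const 48 * ?L + fps_const 576 * (?L * ?L)"
    unfolding E2 by (simp add: power2_eq_square algebra_simps fps_numeral_fps_const)
  have XD: "fps_XD E2 = - fps_const 24 * fps_XD ?L"
    unfolding E2 by (simp add: fps_eq_iff fps_numeral_fps_const)
  have wp: "wp_const = fps_const (-1/24) + fps_const 2 * ?L - fps_const 12 * fps_XD ?L - fps_const 24 * (?L * ?L)"
    unfolding wp_const_def sq XD
    by (rule fps_ext) (simp add: diff_divide_distrib add_divide_distrib)
  show ?thesis unfolding wp using N by (simp add: lambert_nth lambert_mult_nth)
qed

text \<open>The coefficient of \<open>q^N\<close> in \<open>wp'' = 6 wp^2 + const\<close>, written
  for the regular part of \<open>wp\<close> and multiplied by \<open>z^2\<close>;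
  \<open>12 * wp_coeff N\<close> stems from the cross term with the pole.\<close>

lemma wp_coeff_ode:
  "fps_X ^ 2 * fps_deriv (fps_deriv (wp_coeff N)) =
     12 * wp_coeff N + 6 * fps_X ^ 2 * (\<Sum>i\<le>N. wp_coeff i * wp_coeff (N - i)) + fps_X ^ 2 * fps_const (fps_nth wp_const N)"
proof (cases "N = 0")
  case True
  have "fps_nth wp_const 0 = -1/24" by (simp add: wp_const_def eis_nth power2_eq_square)
  then have "fps_const (fps_nth wp_const 0) = - fps_const (1/24)" by simp
  then show ?thesis using True wp_coeff_ode_0 by (simp add: power2_eq_square)
next
  case False
  then have N: "N > 0" by simp
  let ?z = "fps_X :: rat fps"
  let ?L = "lambert (\<lambda>d. of_nat d * (cosh_fps d - 2))"
  let ?S = "full_sum N (\<lambda>a b. (of_nat a * (cosh_fps a - 2)) * (of_nat b * (cosh_fps b - 2)))"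
  let ?T = "full_sum N (\<lambda>a b. of_nat a * of_nat b) :: rat fps"
  let ?s = "(\<Sum>d | d dvd N. of_nat d) :: rat fps"
  have wp: "wp_coeff N = (\<Sum>d | d dvd N. of_nat d * (cosh_fps d - 2))" using N by (simp add: wp_coeff_def)
  have "(\<Sum>i\<le>N. wp_coeff i * wp_coeff (N - i)) = (\<Sum>i\<in>{0<..<N}. wp_coeff i * wp_coeff (N - i)) + 2 * wp_coeff 0 * wp_coeff N"
  proof -
    have "{..N} = insert 0 (insert N {0<..<N})" using N by auto
    then show ?thesis using N by simp
  qed
  also have "(\<Sum>i\<in>{0<..<N}. wp_coeff i * wp_coeff (N - i)) = fps_nth (?L * ?L) N"
    unfolding fps_mult_nth by (rule sum.mono_neutral_cong_left) (auto simp: wp_coeff_def lambert_nth)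
  also have "\<dots> = ?S" by (simp only: lambert_mult_nth)
  finally have sum: "(\<Sum>i\<le>N. wp_coeff i * wp_coeff (N - i)) = ?S + 2 * wp_coeff 0 * wp_coeff N" .
  \<comment> \<open>Multiplying by the part constant in \<open>q\<close> produces Fejer kernels,
    which cancel those arising in \<open>wp_coeff_product\<close>.\<close>
  have w0: "?z ^ 2 * wp_coeff 0 * wp_coeff N = ?z ^ 2 * (\<Sum>d | d dvd N. of_nat d * fejer_fps d) - wp_coeff N
     + ?z ^ 2 * fps_const (1/12) * wp_coeff N"
  proof -
    have "weier_fps * wp_coeff N = ?z ^ 2 * (\<Sum>d | d dvd N. of_nat d * fejer_fps d)"
      unfolding wp sum_distrib_left
      by (intro sum.cong refl) (use weier_fps_cosh in \<open>metis mult.left_commute\<close>)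
    then show ?thesis unfolding weier_fps_wp_coeff by (simp add: algebra_simps)
  qed
  have c: "12 * (?z ^ 2 * fps_const (1/12) * wp_coeff N) = ?z ^ 2 * wp_coeff N"
  proof -
    have "12 * fps_const (1/12) = (1 :: rat fps)" by (simp add: fps_numeral_fps_const)
    then show ?thesis by algebra
  qed
  have dd: "fps_deriv (fps_deriv (wp_coeff N)) = (\<Sum>d | d dvd N. of_nat d ^ 3 * cosh_fps d)"
    unfolding wp fps_deriv_sum by (intro sum.cong refl) (simp add: cosh_fps_deriv2 power3_eq_cube mult_ac)
  have C: "fps_const (fps_nth wp_const N) = 2 * ?s - 12 * of_nat N * ?s - 24 * ?T"
  proof -
    interpret r: rhom "fps_const :: rat \<Rightarrow> rat fps" by (rule rhom_fps_const)
    have "fps_const (full_sum N (\<lambda>a b. of_nat a * of_nat b)) = ?T"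
      unfolding quad_sum_def r.sum by (intro sum.cong) (auto simp: r.mult r.of_nat simp del: fps_const_mult)
    then show ?thesis unfolding wp_const_nth[OF N]
      by (simp only: r.diff r.mult r.sum r.numeral r.of_nat)
  qed
  have P: "6 * ?S = fps_deriv (fps_deriv (wp_coeff N)) - (wp_coeff N + 2 * ?s)
      - 12 * (\<Sum>d | d dvd N. of_nat d * fejer_fps d) + 12 * of_nat N * ?s + 24 * ?T"
    unfolding wp_coeff_product[OF N] dd unfolding wp
    by (simp add: sum_subtractf sum_distrib_left right_diff_distrib mult_ac)
  have alg: "z2 * DD = 12 * w + 6 * z2 * (S + 2 * v * w) + z2 * (2 * s - 12 * n * s - 24 * T)"
    if "6 * S = DD - (w + 2 * s) - 12 * F + 12 * n * s + 24 * T" "z2 * v * w = z2 * F - w + z2 * k * w"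
      "12 * (z2 * k * w) = z2 * w" for z2 DD w S v s F n T k :: "rat fps"
  proof -
    have *: "12 * (z2 * v * w) = 12 * (z2 * F) - 12 * w + z2 * w"
      unfolding that(2) that(3)[symmetric] by (simp add: algebra_simps)
    have "12 * w + 6 * z2 * (S + 2 * v * w) + z2 * (2 * s - 12 * n * s - 24 * T) =
        12 * w + z2 * (6 * S) + 12 * (z2 * v * w) + z2 * (2 * s - 12 * n * s - 24 * T)"
      by (simp add: algebra_simps)
    also have "\<dots> = z2 * DD" unfolding that(1) * by (simp add: algebra_simps)
    finally show ?thesis ..
  qed
  show ?thesis unfolding sum C by (rule alg[OF P w0 c])
qed

text \<open>The double series read the other way: the coefficient of \<open>z^m\<close> as a series
  in \<open>q\<close>. For even \<open>m > 0\<close> it is a multiple of the Eisenstein series of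
  weight \<open>m + 2\<close>.\<close>

definition wp_series :: "nat \<Rightarrow> rat fps" where
  "wp_series m = Abs_fps (\<lambda>N. fps_nth (wp_coeff N) m)"

text \<open>Every term of the differential equation other than \<open>12 * wp_coeff N\<close>
  carries a factor \<open>z^2\<close>.\<close>

lemma wp_series_lt_2: "m < 2 \<Longrightarrow> wp_series m = 0"
proof (rule fps_ext)
  fix N assume m: "m < 2"
  have "fps_nth (fps_X ^ 2 * fps_deriv (fps_deriv (wp_coeff N))) m = 
     fps_nth (12 * wp_coeff N + fps_X ^ 2 * (6 * (\<Sum>i\<le>N. wp_coeff i * wp_coeff (N - i)) + fps_const (fps_nth wp_const N))) m"
    unfolding wp_coeff_ode by (simp only: distrib_left mult_ac add_ac)
  then show "fps_nth (wp_series m) N = fps_nth 0 N"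
    using m by (simp add: fps_X_power_mult_nth wp_series_def fps_numeral_fps_const)
qed

lemma wp_series_rec:
  assumes m: "m \<ge> 2"
  shows "fps_const (of_nat m * (of_nat m - 1) - 12) * wp_series m =
     6 * (\<Sum>j\<le>m - 2. wp_series j * wp_series (m - 2 - j)) + (if m = 2 then wp_const else 0)"
proof (rule fps_ext)
  fix N
  obtain k where k: "m = Suc (Suc k)" using m by (metis add_2_eq_Suc le_Suc_ex)
  have "fps_nth (fps_X ^ 2 * fps_deriv (fps_deriv (wp_coeff N))) m = 
     fps_nth (fps_const 12 * wp_coeff N + fps_X ^ 2 * (fps_const 6 * (\<Sum>i\<le>N. wp_coeff i * wp_coeff (N - i)) + fps_const (fps_nth wp_const N))) m"
    unfolding wp_coeff_ode by (simp only: distrib_left mult_ac add_ac fps_numeral_fps_const)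
  then have 1: "of_nat m * (of_nat m - 1) * fps_nth (wp_coeff N) m =
     12 * fps_nth (wp_coeff N) m + 6 * (\<Sum>i\<le>N. fps_nth (wp_coeff i * wp_coeff (N - i)) k) + (if k = 0 then fps_nth wp_const N else 0)"
    by (simp add: k fps_X_power_mult_nth fps_sum_nth del: fps_mult_nth_0)
       (cases "k = 0"; simp add: algebra_simps del: fps_mult_nth_0)
  have "(\<Sum>i\<le>N. fps_nth (wp_coeff i * wp_coeff (N - i)) k) =
     (\<Sum>i\<le>N. \<Sum>j\<le>k. fps_nth (wp_coeff i) j * fps_nth (wp_coeff (N - i)) (k - j))"
    by (simp add: fps_mult_nth atLeast0AtMost)
  also have "\<dots> = (\<Sum>j\<le>k. \<Sum>i\<le>N. fps_nth (wp_coeff i) j * fps_nth (wp_coeff (N - i)) (k - j))"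
    by (rule sum.swap)
  also have "\<dots> = (\<Sum>j\<le>k. fps_nth (wp_series j * wp_series (k - j)) N)"
    by (simp add: fps_mult_nth wp_series_def atLeast0AtMost)
  finally have 2: "(\<Sum>i\<le>N. fps_nth (wp_coeff i * wp_coeff (N - i)) k) = (\<Sum>j\<le>k. fps_nth (wp_series j * wp_series (k - j)) N)" .
  show "fps_nth (fps_const (of_nat m * (of_nat m - 1) - 12) * wp_series m) N =
     fps_nth (6 * (\<Sum>j\<le>m - 2. wp_series j * wp_series (m - 2 - j)) + (if m = 2 then wp_const else 0)) N"
    using 1 k unfolding 2
    by (simp add: fps_sum_nth fps_numeral_fps_const wp_series_def left_diff_distrib)
qed

lemma wp_series_nth:
  assumes "m > 0"
  shows "fps_nth (wp_series m) N = (if N = 0 then - of_nat (m + 1) * bernoulli_num (m + 2) / fact (m + 2)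
     else (1 + (-1) ^ m) * (\<Sum>d | d dvd N. of_nat d ^ (m + 1)) / fact m)"
proof (cases "N = 0")
  case True
  then show ?thesis using assms by (simp add: wp_series_def wp_coeff_def weier_fps_nth)
next
  case False
  have "fps_nth (wp_coeff N) m = (\<Sum>d | d dvd N. fps_nth (of_nat d * (cosh_fps d - 2)) m)"
    using False by (simp add: wp_coeff_def fps_sum_nth)
  also have "\<dots> = (\<Sum>d | d dvd N. (1 + (-1) ^ m) * of_nat d ^ (m + 1) / fact m)"
  proof (intro sum.cong refl)
    fix d
    have "fps_nth (of_nat d * (cosh_fps d - 2)) m = of_nat d * fps_nth (cosh_fps d - fps_const 2) m"
      unfolding fps_of_nat[symmetric] by (simp add: fps_numeral_fps_const)
    then show "fps_nth (of_nat d * (cosh_fps d - 2)) m = (1 + (-1) ^ m) * of_nat d ^ (m + 1) / fact m"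
      using assms by (simp add: cosh_fps_nth power_minus[of "of_nat d"] algebra_simps)
  qed
  finally show ?thesis using False by (simp add: wp_series_def sum_distrib_left sum_divide_distrib)
qed

lemma eisenstein_nth:
  "fps_nth (eisenstein w) n = (if n = 0 then 1 else
     - (2 * of_nat w / bernoulli_num w) * (\<Sum>d | d dvd n. of_nat d ^ (w - 1)))"
  by (simp add: eisenstein_def divisor_sigma_def)

lemma wp_series_eisenstein:
  assumes m: "even m" "m > 0" and B: "bernoulli_num (m + 2) \<noteq> 0"
  shows "wp_series m = fps_const (- of_nat (m + 1) * bernoulli_num (m + 2) / fact (m + 2)) * eisenstein (m + 2)"
proof (rule fps_ext)
  fix N
  have f: "fact (m + 2) = (of_nat (m + 2) * of_nat (m + 1) * fact m :: rat)" by simp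
  show "fps_nth (wp_series m) N = fps_nth (fps_const (- of_nat (m + 1) * bernoulli_num (m + 2) / fact (m + 2)) * eisenstein (m + 2)) N"
    unfolding wp_series_nth[OF m(2)] fps_mult_left_const_nth eisenstein_nth f
    using m B by (simp add: divide_simps del: of_nat_Suc of_nat_add)
qed

lemma eisenstein_4: "eisenstein 4 = E4"
  by (rule fps_ext) (simp add: eisenstein_nth eis_nth bernoulli_num_4)

lemma eisenstein_6: "eisenstein 6 = E6"
  by (rule fps_ext) (simp add: eisenstein_nth eis_nth bernoulli_num_6)

lemma wp_series_2: "wp_series 2 = fps_const (1/240) * E4"
  using wp_series_eisenstein[of 2] by (simp add: bernoulli_num_4 eisenstein_4 fact_numeral)

lemma wp_series_4: "wp_series 4 = fps_const (-1/6048) * E6"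
  using wp_series_eisenstein[of 4] by (simp add: bernoulli_num_6 eisenstein_6 fact_numeral)

section \<open>Ramanujan's differential equations\<close>

text \<open>At \<open>z^2\<close> the quadratic part of the recursion is zero, so
  \<open>(2 - 12) * wp_series 2 = wp_const\<close>; the left side is
  \<open>- E4 / 24\<close>.\<close>

lemma E2_ode_rat: "12 * fps_XD E2 = (E2 ^ 2 - E4 :: rat fps)"
proof -
  have "fps_const (-10) * wp_series 2 = wp_const"
    using wp_series_rec[of 2] by (simp add: wp_series_lt_2)
  then have "fps_nth (fps_const (-10 :: rat) * (fps_const (1/240) * E4)) n =
     fps_nth (fps_const (1/2) * fps_XD E2 - fps_const (1/24) * E2 ^ 2) n" for n
    by (simp only: wp_series_2 wp_const_def)
  then show ?thesis by (intro fps_ext) (simp add: fps_numeral_fps_const field_simps)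
qed

text \<open>The identity \<open>E8 = E4^2\<close>, read off from the recursion at
  \<open>z^6\<close>, where the factor is \<open>6 * 5 - 12 = 18\<close>.\<close>

lemma E8_conv:
  assumes "N > 0"
  shows "120 * full_sum N (\<lambda>a b. of_nat a ^ 3 * of_nat b ^ 3) =
    (\<Sum>d | d dvd N. of_nat d ^ 7) - (\<Sum>d | d dvd N. (of_nat d :: rat) ^ 3)"
proof -
  let ?L = "lambert (\<lambda>d. of_nat d ^ 3) :: rat fps"
  have "fps_const 18 * wp_series 6 = 6 * wp_series 2 * wp_series 2"
    using wp_series_rec[of 6] wp_series_rec[of 3] 
    by (simp add: wp_series_lt_2 eval_nat_numeral atMost_Suc)
  also have "\<dots> = 6 * (fps_const (1/240) * fps_const (1/240)) * (E4 * E4)"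
    unfolding wp_series_2 by (simp only: mult_ac)
  also have "6 * (fps_const (1/240) * fps_const (1/240)) = fps_const (1/9600 :: rat)"
    by (simp add: fps_numeral_fps_const)
  also have "E4 * E4 = 1 + fps_const 480 * ?L + fps_const 57600 * (?L * ?L)"
  proof -
    have E4: "E4 = 1 + 240 * ?L" by (rule fps_ext) (simp add: eis_def fps_numeral_fps_const)
    show ?thesis unfolding E4 fps_numeral_fps_const[symmetric] by (simp add: algebra_simps)
  qed
  finally have "fps_nth (fps_const 18 * wp_series 6) N =
     fps_nth (fps_const (1/9600) * (1 + fps_const 480 * ?L + fps_const 57600 * (?L * ?L))) N" by simp
  then show ?thesis using assms unfolding fps_mult_left_const_nth
    by (simp add: wp_series_nth lambert_nth lambert_mult_nth fact_numeral)
qed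

lemma power_sum_4: "30 * (\<Sum>a\<in>{1..<d}. of_nat a ^ 4) = (6 * of_nat d ^ 5 - 15 * of_nat d ^ 4 + 10 * of_nat d ^ 3 - of_nat d :: rat)"
proof (induction d)
  case (Suc d)
  then show ?case by (cases "d = 0") (simp_all add: distrib_left, simp add: eval_nat_numeral algebra_simps)
qed simp

lemma power_sum_6: "42 * (\<Sum>a\<in>{1..<d}. of_nat a ^ 6) =
   (6 * of_nat d ^ 7 - 21 * of_nat d ^ 6 + 21 * of_nat d ^ 5 - 7 * of_nat d ^ 3 + of_nat d :: rat)"
proof (induction d)
  case (Suc d)
  then show ?case by (cases "d = 0") (simp_all add: distrib_left, simp add: eval_nat_numeral algebra_simps)
qed simp

lemma absdiff_even_power: "even k \<Longrightarrow> of_nat (absdiff a b) ^ k = (of_nat a - of_nat b :: 'a::comm_ring_1) ^ k"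
  by (cases "a \<le> b") (auto simp: absdiff_def of_nat_diff, metis minus_diff_eq power_minus_even)

text \<open>The Liouville identity for \<open>G k = k^4\<close>, since
  \<open>(a + b)^4 - (a - b)^4 = 8 a^3 b + 8 a b^3\<close>. Faulhaber's formula evaluates the
  diagonal sums.\<close>

lemma sum_mult_3_conv:
  assumes N: "N > 0"
  shows "240 * full_sum N (\<lambda>a b. of_nat a ^ 3 * of_nat b) =
    (\<Sum>d | d dvd N. 21 * of_nat d ^ 5 + 10 * of_nat d ^ 3 - of_nat d - 30 * of_nat N * of_nat d ^ 3 :: rat)"
proof -
  let ?G = "\<lambda>k::nat. of_nat k ^ 4 :: rat"
  have swap: "full_sum N (\<lambda>a b. of_nat a * of_nat b ^ 3) = (full_sum N (\<lambda>a b. of_nat a ^ 3 * of_nat b) :: rat)"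
    by (subst quad_sum_swap) (simp add: mult_ac)
  have "full_sum N (\<lambda>a b. ?G (a + b) - ?G (absdiff a b)) =
      full_sum N (\<lambda>a b. 8 * (of_nat a ^ 3 * of_nat b) + 8 * (of_nat a * of_nat b ^ 3))"
    by (rule quad_sum_cong) (simp add: absdiff_even_power, simp add: eval_nat_numeral algebra_simps)
  also have "\<dots> = 16 * full_sum N (\<lambda>a b. of_nat a ^ 3 * of_nat b)"
    unfolding quad_sum_add quad_sum_cmult swap by simp
  finally have "240 * full_sum N (\<lambda>a b. of_nat a ^ 3 * of_nat b) =
      15 * full_sum N (\<lambda>a b. ?G (a + b) - ?G (absdiff a b))" by simp
  also have "\<dots> = (\<Sum>d | d dvd N. 15 * (\<Sum>a\<in>{1..<d}. of_nat d ^ 4 + 2 * of_nat a ^ 4)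
      - 15 * (of_nat (N div d - 1) * (2 * of_nat d ^ 4)))"
    unfolding quad_sum_plain[of N ?G] quad_sum_diag_a[OF N] quad_sum_diag_x[OF N] right_diff_distrib
      sum_distrib_left[of 15 _ "{d. d dvd N}"] sum_subtractf[symmetric]
    by (intro sum.cong refl arg_cong2[where f = "(-)"] arg_cong2[where f = "(*)"]) auto
  also have "\<dots> = (\<Sum>d | d dvd N. 21 * of_nat d ^ 5 + 10 * of_nat d ^ 3 - of_nat d - 30 * of_nat N * of_nat d ^ 3)"
  proof (intro sum.cong refl, goal_cases)
    case (1 d)
    then obtain k where k: "N = d * k" "d > 0" "k > 0" using N by auto
    have 1: "of_nat (N div d - 1) = (of_nat k - 1 :: rat)" using k by (simp add: of_nat_diff)
    have "15 * (\<Sum>a\<in>{1..<d}. of_nat d ^ 4 + 2 * of_nat a ^ 4) = 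
      15 * (of_nat d - 1) * of_nat d ^ 4 + 30 * (\<Sum>a\<in>{1..<d}. (of_nat a :: rat) ^ 4)"
      using k by (simp add: sum.distrib sum_distrib_left of_nat_diff)
    then show ?case unfolding 1 power_sum_4 by (simp add: k(1), simp add: eval_nat_numeral algebra_simps)
  qed
  finally show ?thesis .
qed

text \<open>As for \<open>k^4\<close>, now with \<open>G k = k^6\<close>. The additional middle term
  \<open>40 a^3 b^3\<close> is eliminated by means of \<open>E8_conv\<close>.\<close>

lemma sum_mult_5_conv:
  assumes N: "N > 0"
  shows "504 * full_sum N (\<lambda>a b. of_nat a ^ 5 * of_nat b) =
    (\<Sum>d | d dvd N. 20 * of_nat d ^ 7 + 21 * of_nat d ^ 5 + of_nat d - 42 * of_nat N * of_nat d ^ 5 :: rat)"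
proof -
  let ?G = "\<lambda>k::nat. of_nat k ^ 6 :: rat"
  let ?T = "full_sum N (\<lambda>a b. of_nat a ^ 3 * of_nat b ^ 3) :: rat"
  have swap: "full_sum N (\<lambda>a b. of_nat a * of_nat b ^ 5) = (full_sum N (\<lambda>a b. of_nat a ^ 5 * of_nat b) :: rat)"
    by (subst quad_sum_swap) (simp add: mult_ac)
  have "full_sum N (\<lambda>a b. ?G (a + b) - ?G (absdiff a b)) =
      full_sum N (\<lambda>a b. 12 * (of_nat a ^ 5 * of_nat b) + 40 * (of_nat a ^ 3 * of_nat b ^ 3) + 12 * (of_nat a * of_nat b ^ 5))"
    by (rule quad_sum_cong) (simp add: absdiff_even_power, simp add: eval_nat_numeral algebra_simps)
  also have "\<dots> = 24 * full_sum N (\<lambda>a b. of_nat a ^ 5 * of_nat b) + 40 * ?T"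
    unfolding quad_sum_add quad_sum_cmult swap by simp
  finally have "504 * full_sum N (\<lambda>a b. of_nat a ^ 5 * of_nat b) =
      21 * full_sum N (\<lambda>a b. ?G (a + b) - ?G (absdiff a b)) - 7 * (120 * ?T)" by simp
  also have "\<dots> = (\<Sum>d | d dvd N. 21 * (\<Sum>a\<in>{1..<d}. of_nat d ^ 6 + 2 * of_nat a ^ 6)
      - 21 * (of_nat (N div d - 1) * (2 * of_nat d ^ 6)) - 7 * (of_nat d ^ 7 - of_nat d ^ 3))"
    unfolding E8_conv[OF N] quad_sum_plain[of N ?G] quad_sum_diag_a[OF N] quad_sum_diag_x[OF N] right_diff_distrib
      sum_distrib_left[of 21 _ "{d. d dvd N}"] sum_distrib_left[of 7 _ "{d. d dvd N}"] sum_subtractf[symmetric]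
    by (intro sum.cong refl arg_cong2[where f = "(-)"] arg_cong2[where f = "(*)"]) auto
  also have "\<dots> = (\<Sum>d | d dvd N. 20 * of_nat d ^ 7 + 21 * of_nat d ^ 5 + of_nat d - 42 * of_nat N * of_nat d ^ 5)"
  proof (intro sum.cong refl, goal_cases)
    case (1 d)
    then obtain k where k: "N = d * k" "d > 0" "k > 0" using N by auto
    have 1: "of_nat (N div d - 1) = (of_nat k - 1 :: rat)" using k by (simp add: of_nat_diff)
    have "21 * (\<Sum>a\<in>{1..<d}. of_nat d ^ 6 + 2 * of_nat a ^ 6) = 
      21 * (of_nat d - 1) * of_nat d ^ 6 + 42 * (\<Sum>a\<in>{1..<d}. (of_nat a :: rat) ^ 6)"
      using k by (simp add: sum.distrib sum_distrib_left of_nat_diff)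
    then show ?case unfolding 1 power_sum_6 by (simp add: k(1), simp add: eval_nat_numeral algebra_simps)
  qed
  finally show ?thesis .
qed

lemma E4_ode_rat: "3 * fps_XD E4 = (E2 * E4 - E6 :: rat fps)"
proof (rule fps_ext)
  fix N
  let ?L = "\<lambda>m. lambert (\<lambda>d. of_nat d ^ m) :: rat fps"
  have E2: "E2 = 1 - 24 * ?L 1" and E4: "E4 = 1 + 240 * ?L 3" and E6: "E6 = 1 - 504 * ?L 5"
    by (rule fps_ext, simp add: eis_def fps_numeral_fps_const)+
  have "E2 * E4 - E6 = 240 * ?L 3 + 504 * ?L 5
      - 24 * ?L 1 - 5760 * (?L 3 * ?L 1)"
    unfolding E2 E4 E6 by (simp add: algebra_simps)
  moreover have "3 * fps_XD E4 = 720 * fps_XD (?L 3)"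
    by (rule fps_ext) (simp add: fps_numeral_fps_const eis_def)
  moreover have "fps_nth (720 * fps_XD (?L 3)) N = fps_nth (240 * ?L 3 + 504 * ?L 5
      - 24 * ?L 1 - 5760 * (?L 3 * ?L 1)) N"
  proof (cases "N = 0")
    case False
    then show ?thesis using sum_mult_3_conv[of N]
      by (simp add: fps_numeral_fps_const lambert_nth lambert_mult_nth sum.distrib sum_subtractf flip: sum_distrib_left)
  qed (simp add: fps_numeral_fps_const lambert_nth)
  ultimately show "fps_nth (3 * fps_XD E4) N = fps_nth (E2 * E4 - E6 :: rat fps) N" by (simp only:)
qed

lemma E6_ode_rat: "2 * fps_XD E6 = (E2 * E6 - E4 ^ 2 :: rat fps)"
proof (rule fps_ext)
  fix N
  let ?L = "\<lambda>m. lambert (\<lambda>d. of_nat d ^ m) :: rat fps"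
  have E2: "E2 = 1 - 24 * ?L 1" and E4: "E4 = 1 + 240 * ?L 3" and E6: "E6 = 1 - 504 * ?L 5"
    by (rule fps_ext, simp add: eis_def fps_numeral_fps_const)+
  have "E2 * E6 - E4 ^ 2 = 12096 * (?L 5 * ?L 1)
      - 24 * ?L 1 - 480 * ?L 3 - 504 * ?L 5 - 57600 * (?L 3 * ?L 3)"
    unfolding E2 E4 E6 by (simp add: algebra_simps power2_eq_square)
  moreover have "2 * fps_XD E6 = - (1008 * fps_XD (?L 5))"
    by (rule fps_ext) (simp add: fps_numeral_fps_const eis_def)
  moreover have "fps_nth (- (1008 * fps_XD (?L 5))) N = fps_nth (12096 * (?L 5 * ?L 1)
      - 24 * ?L 1 - 480 * ?L 3 - 504 * ?L 5 - 57600 * (?L 3 * ?L 3)) N"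
  proof (cases "N = 0")
    case False
    then show ?thesis using sum_mult_5_conv[of N] E8_conv[of N]
      by (simp add: fps_numeral_fps_const lambert_nth lambert_mult_nth sum.distrib sum_subtractf flip: sum_distrib_left)
  qed (simp add: fps_numeral_fps_const lambert_nth)
  ultimately show "fps_nth (2 * fps_XD E6) N = fps_nth (E2 * E6 - E4 ^ 2 :: rat fps) N" by (simp only:)
qed

text \<open>The integers embed into the rationals, so an identity proved over the rationals holds
  over the integers and from there in every ring, in particular in characteristic
  \<open>p\<close>.\<close>

lemma map_fps_of_int_transfer:
  assumes "map_fps (of_int :: int \<Rightarrow> rat) f = map_fps of_int g"
  shows "map_fps of_int f = (map_fps of_int g :: 'a::comm_ring_1 fps)"
proof -
  have "f = g" using assms by (simp add: fps_eq_iff)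
  then show ?thesis by simp
qed

lemma (in rhom) map_fps_ode:
  shows "map_fps h (12 * fps_XD E2) = 12 * fps_XD E2" "map_fps h (E2 ^ 2 - E4) = E2 ^ 2 - E4"
    "map_fps h (3 * fps_XD E4) = 3 * fps_XD E4" "map_fps h (E2 * E4 - E6) = E2 * E4 - E6"
    "map_fps h (2 * fps_XD E6) = 2 * fps_XD E6" "map_fps h (E2 * E6 - E4 ^ 2) = E2 * E6 - E4 ^ 2"
proof -
  interpret m: rhom "map_fps h" by (rule map_fps)
  show "map_fps h (12 * fps_XD E2) = 12 * fps_XD E2" "map_fps h (E2 ^ 2 - E4) = E2 ^ 2 - E4"
    "map_fps h (3 * fps_XD E4) = 3 * fps_XD E4" "map_fps h (E2 * E4 - E6) = E2 * E4 - E6"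
    "map_fps h (2 * fps_XD E6) = 2 * fps_XD E6" "map_fps h (E2 * E6 - E4 ^ 2) = E2 * E6 - E4 ^ 2"
    by (simp_all only: m.mult m.diff m.power m.numeral map_fps_XD map_fps_eis)
qed

lemma E2_ode: "12 * fps_XD E2 = (E2 ^ 2 - E4 :: 'a::comm_ring_1 fps)"
  using map_fps_of_int_transfer[of "12 * fps_XD E2" "E2 ^ 2 - E4", where 'a = 'a]
  by (simp only: rhom.map_fps_ode[OF rhom_of_int] E2_ode_rat)

lemma E4_ode: "3 * fps_XD E4 = (E2 * E4 - E6 :: 'a::comm_ring_1 fps)"
  using map_fps_of_int_transfer[of "3 * fps_XD E4" "E2 * E4 - E6", where 'a = 'a]
  by (simp only: rhom.map_fps_ode[OF rhom_of_int] E4_ode_rat)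

lemma E6_ode: "2 * fps_XD E6 = (E2 * E6 - E4 ^ 2 :: 'a::comm_ring_1 fps)"
  using map_fps_of_int_transfer[of "2 * fps_XD E6" "E2 * E6 - E4 ^ 2", where 'a = 'a]
  by (simp only: rhom.map_fps_ode[OF rhom_of_int] E6_ode_rat)

section \<open>Eisenstein series as polynomials\<close>

definition wt_hom :: "nat \<Rightarrow> 'a::zero poly poly \<Rightarrow> bool" where
  "wt_hom w Q \<longleftrightarrow> (\<forall>b c. coeff (coeff Q c) b \<noteq> 0 \<longrightarrow> 4 * b + 6 * c = w)"

lemma wt_hom_0: "wt_hom w 0" by (simp add: wt_hom_def)

lemma wt_hom_add:
  assumes "wt_hom w P" "wt_hom w Q" shows "wt_hom w (P + Q)"
  unfolding wt_hom_def
proof (intro allI impI)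
  fix b c assume "coeff (coeff (P + Q) c) b \<noteq> 0"
  then have "coeff (coeff P c) b \<noteq> 0 \<or> coeff (coeff Q c) b \<noteq> 0" by auto
  then show "4 * b + 6 * c = w" using assms unfolding wt_hom_def by blast
qed

lemma wt_hom_diff: "wt_hom w P \<Longrightarrow> wt_hom w Q \<Longrightarrow> wt_hom w (P - Q :: 'a::ab_group_add poly poly)"
  by (auto simp: wt_hom_def) metis

lemma wt_hom_sum: "(\<And>i. i \<in> A \<Longrightarrow> wt_hom w (f i)) \<Longrightarrow> wt_hom w (sum f A)"
  by (induction A rule: infinite_finite_induct) (auto simp: wt_hom_0 wt_hom_add)

lemma wt_hom_mult:
  fixes P Q :: "'a::comm_ring_1 poly poly"
  assumes "wt_hom v P" "wt_hom w Q" shows "wt_hom (v + w) (P * Q)"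
  unfolding wt_hom_def
proof (intro allI impI)
  fix b c assume "coeff (coeff (P * Q) c) b \<noteq> 0"
  then have "(\<Sum>i\<le>c. \<Sum>j\<le>b. coeff (coeff P i) j * coeff (coeff Q (c - i)) (b - j)) \<noteq> 0"
    by (simp add: coeff_mult coeff_sum)
  then obtain i j where ij: "i \<le> c" "j \<le> b" "coeff (coeff P i) j * coeff (coeff Q (c - i)) (b - j) \<noteq> 0"
    by (metis (no_types, lifting) atMost_iff sum.not_neutral_contains_not_neutral)
  then have "coeff (coeff P i) j \<noteq> 0" "coeff (coeff Q (c - i)) (b - j) \<noteq> 0" by auto
  then have "4 * j + 6 * i = v" "4 * (b - j) + 6 * (c - i) = w" using assms by (auto simp: wt_hom_def)
  then show "4 * b + 6 * c = v + w" using ij by auto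
qed

lemma wt_hom_power: "wt_hom w P \<Longrightarrow> wt_hom (n * w) (P ^ n :: 'a::comm_ring_1 poly poly)"
proof (induction n)
  case 0 then show ?case by (auto simp: wt_hom_def one_pCons coeff_pCons split: nat.splits)
next
  case (Suc n) then show ?case using wt_hom_mult[of w P] by simp
qed

definition c2 :: "'a::zero \<Rightarrow> 'a poly poly" where "c2 c = [:[:c:]:]"
definition x4 :: "'a::comm_ring_1 poly poly" where "x4 = [:[:0, 1:]:]"
definition x6 :: "'a::comm_ring_1 poly poly" where "x6 = [:0, 1:]"

lemma wt_hom_c2: "wt_hom 0 (c2 c)" and wt_hom_x4: "wt_hom 4 x4" and wt_hom_x6: "wt_hom 6 x6"
  by (auto simp: wt_hom_def c2_def x4_def x6_def coeff_pCons one_pCons split: nat.splits)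

definition qexp2 :: "'a::comm_ring_1 poly poly \<Rightarrow> 'a fps" where
  "qexp2 = poly_eval_hom (poly_eval_hom fps_const E4) E6"

lemma eval_E4E6_eq: "eval_E4E6 = qexp2"
  by (simp add: fun_eq_iff eval_E4E6_def qexp2_def poly_eval_hom_def[abs_def] eisenstein_4 eisenstein_6)

interpretation qexp2: rhom "qexp2 :: 'a::comm_ring_1 poly poly \<Rightarrow> 'a fps"
  unfolding qexp2_def by (intro rhom_poly_eval_hom rhom_fps_const)

lemma qexp2_c2: "qexp2 (c2 c) = fps_const c"
  by (simp add: qexp2_def c2_def poly_eval_hom_pCons)

lemma qexp2_x4: "qexp2 x4 = E4"
  by (simp add: qexp2_def x4_def poly_eval_hom_pCons)

lemma qexp2_x6: "qexp2 (x6 :: 'a::comm_ring_1 poly poly) = E6"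
  using rhom.one[OF rhom_poly_eval_hom[OF rhom_fps_const], of "E4 :: 'a fps"]
  by (simp add: qexp2_def x6_def poly_eval_hom_pCons)

definition mod_form :: "nat \<Rightarrow> rat fps \<Rightarrow> bool" where
  "mod_form w f \<longleftrightarrow> (\<exists>Q. wt_hom w Q \<and> qexp2 Q = f)"

lemma mod_form_mult: "mod_form v f \<Longrightarrow> mod_form w g \<Longrightarrow> mod_form (v + w) (f * g)"
  unfolding mod_form_def by (metis wt_hom_mult qexp2.mult)

lemma mod_form_sum:
  assumes "\<And>i. i \<in> A \<Longrightarrow> mod_form w (f i)" shows "mod_form w (sum f A)"
proof -
  obtain Q where "\<And>i. i \<in> A \<Longrightarrow> wt_hom w (Q i) \<and> qexp2 (Q i) = f i"
    using assms unfolding mod_form_def by metis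
  then have "wt_hom w (sum Q A)" "qexp2 (sum Q A) = sum f A"
    by (auto intro!: wt_hom_sum simp: qexp2.sum)
  then show ?thesis unfolding mod_form_def by blast
qed

lemma mod_form_const_mult:
  assumes "mod_form w f" shows "mod_form w (fps_const c * f)"
proof -
  have "mod_form 0 (fps_const c)" unfolding mod_form_def using wt_hom_c2 qexp2_c2 by blast
  from mod_form_mult[OF this assms] show ?thesis by simp
qed

text \<open>The recursion can be solved for \<open>wp_series m\<close> unless its factor
  \<open>(m - 4) (m + 3)\<close> vanishes. At \<open>m = 4\<close> it does, and \<open>E6\<close>
  enters as a new generator; at \<open>m = 2\<close> the recursion contains \<open>wp_const\<close>,
  and \<open>E4\<close> is taken as a generator.\<close>

lemma mod_form_wp_series: "mod_form (m + 2) (wp_series m)"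
proof (induction m rule: less_induct)
  case (less m)
  consider "m < 2" | "m = 2" | "m = 4" | "m \<ge> 2" "m \<noteq> 2" "m \<noteq> 4" by linarith
  then show ?case
  proof cases
    case 1
    then show ?thesis using wt_hom_0 qexp2.zero unfolding mod_form_def wp_series_lt_2[OF 1] by blast
  next
    case 2
    have "mod_form 4 E4" unfolding mod_form_def using wt_hom_x4 qexp2_x4 by blast
    then have "mod_form 4 (wp_series 2)" unfolding wp_series_2 by (rule mod_form_const_mult)
    then show ?thesis using 2 by simp
  next
    case 3
    have "mod_form 6 E6" unfolding mod_form_def using wt_hom_x6 qexp2_x6 by blast
    then have "mod_form 6 (wp_series 4)" unfolding wp_series_4 by (rule mod_form_const_mult)
    then show ?thesis using 3 by simp
  next
    case 4
    let ?S = "\<Sum>j\<le>m - 2. wp_series j * wp_series (m - 2 - j)"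
    define u where "u = (of_nat m * (of_nat m - 1) - 12 :: rat)"
    have "u = (of_nat m - 4) * (of_nat m + 3)" by (simp add: u_def algebra_simps)
    moreover have "of_nat m \<noteq> (4 :: rat)" "of_nat m + 3 \<noteq> (0 :: rat)"
      using 4 of_nat_eq_iff[of m 4, where 'a = rat] of_nat_0_le_iff[of m, where 'a = rat] by (simp, linarith)
    ultimately have u: "u \<noteq> 0" by simp
    have "fps_const u * wp_series m = fps_const 6 * ?S"
      using wp_series_rec[OF 4(1)] 4 by (simp add: u_def fps_numeral_fps_const)
    then have "(fps_const (1 / u) * fps_const u) * wp_series m = fps_const (1 / u) * (fps_const 6 * ?S)"
      by (simp only: mult.assoc)
    then have eq: "wp_series m = fps_const (1 / u) * (fps_const 6 * ?S)"
      using u by simp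
    have "mod_form (m + 2) (wp_series j * wp_series (m - 2 - j))" if "j \<le> m - 2" for j
    proof -
      have "mod_form ((j + 2) + (m - 2 - j + 2)) (wp_series j * wp_series (m - 2 - j))"
        using less 4 that by (intro mod_form_mult) auto
      moreover have "(j + 2) + (m - 2 - j + 2) = m + 2" using that 4 by simp
      ultimately show ?thesis by (simp only:)
    qed
    then show ?thesis unfolding eq by (intro mod_form_const_mult mod_form_sum) auto
  qed
qed

lemma mod_form_eisenstein:
  assumes "even w" "w \<ge> 4" "bernoulli_num w \<noteq> 0" shows "mod_form w (eisenstein w)"
proof -
  define m where "m = w - 2"
  have m: "w = m + 2" "even m" "m > 0" using assms by (auto simp: m_def)
  define u where "u = - of_nat (m + 1) * bernoulli_num (m + 2) / fact (m + 2)"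
  have u: "u \<noteq> 0" using assms(3) m(1) by (simp add: u_def del: of_nat_Suc of_nat_add fact_Suc)
  have "wp_series m = fps_const u * eisenstein w"
    using wp_series_eisenstein m assms(3) by (simp add: u_def)
  then have "(fps_const (1 / u) * fps_const u) * eisenstein w = fps_const (1 / u) * wp_series m"
    by (simp only: mult.assoc)
  then have "eisenstein w = fps_const (1 / u) * wp_series m" using u by simp
  then show ?thesis using mod_form_const_mult[OF mod_form_wp_series[of m]] m(1) by simp
qed

section \<open>Algebraic independence\<close>

lemma (in rhom) map_fps_qexp2: "map_fps h (qexp2 Q) = qexp2 (map_poly (map_poly h) Q)"
proof -
  interpret f: rhom "map_fps h" by (rule map_fps)
  have "map_fps h (poly_eval_hom fps_const E4 q) = poly_eval_hom fps_const E4 (map_poly h q)" for q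
    by (simp add: f.poly_eval_hom map_fps_const map_fps_eis poly_eval_hom_map_poly zero)
  then show ?thesis unfolding qexp2_def
    by (simp add: f.poly_eval_hom map_fps_eis poly_eval_hom_map_poly zero)
qed

section \<open>Growth of real q-expansions as \<open>q\<close> tends to 1\<close>

definition geom_fps :: "real fps" where "geom_fps = inverse (1 - fps_X)"

lemma geom_fps_nth: "fps_nth geom_fps n = 1"
  by (simp add: geom_fps_def fps_inverse_one_minus_fps_X)

lemma geom_fps_power_nonneg: "fps_nth (geom_fps ^ k) n \<ge> 0"
proof (induction k arbitrary: n)
  case 0 then show ?case by simp
next
  case (Suc k) then show ?case by (auto simp: fps_mult_nth geom_fps_nth intro!: sum_nonneg)
qed

lemma geom_fps_power_mono: "k \<le> l \<Longrightarrow> fps_nth (geom_fps ^ k) n \<le> fps_nth (geom_fps ^ l) n"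
proof (induction l rule: dec_induct)
  case (step l)
  have "fps_nth (geom_fps ^ l) n \<le> (\<Sum>i=0..n. fps_nth (geom_fps ^ l) i)"
    by (rule member_le_sum) (auto simp: geom_fps_power_nonneg)
  then show ?case using step by (simp add: fps_mult_nth geom_fps_nth mult.commute[of geom_fps])
qed simp

text \<open>The coefficients of \<open>1 / (1 - q)^(m + 1)\<close> are binomial coefficients of
  degree \<open>m\<close> in \<open>n\<close>; hence polynomial growth of coefficients is domination
  by a pole at 1.\<close>

lemma power_le_geom_fps: "real (n + 1) ^ m \<le> fact m * fps_nth (geom_fps ^ (m + 1)) n"
proof -
  have "geom_fps ^ (m + 1) = inverse ((1 - fps_const 1 * fps_X) ^ (m + 1))"
    by (simp add: geom_fps_def fps_inverse_power flip: power_Suc)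
  also have "\<dots> = Abs_fps (\<lambda>k. of_nat ((m + 1 + k - 1) choose k) * 1 ^ k)"
    by (rule one_minus_const_fps_X_neg_power') simp
  finally have 1: "fps_nth (geom_fps ^ (m + 1)) n = of_nat ((m + n) choose n)" by simp
  have "(n + 1) ^ m * fact n \<le> (fact (m + n) :: nat)"
  proof (induction m)
    case (Suc m)
    have "(n + 1) ^ Suc m * fact n = (n + 1) * ((n + 1) ^ m * fact n)" by (simp only: power_Suc mult.assoc)
    also have "\<dots> \<le> (Suc (m + n)) * fact (m + n)" using Suc by (intro mult_mono) auto
    finally show ?case by simp
  qed simp
  also have "(fact (m + n) :: nat) = fact n * fact m * ((m + n) choose n)"
    using binomial_fact_lemma[of n "m + n"] by simp
  finally have "(n + 1) ^ m \<le> fact m * ((m + n) choose n)"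
    by (metis fact_gt_zero mult.assoc mult.commute mult_le_cancel1)
  then have "real ((n + 1) ^ m) \<le> real (fact m * ((m + n) choose n))" by (rule of_nat_mono)
  then show ?thesis unfolding 1 by (simp del: of_nat_add of_nat_Suc)
qed

text \<open>Domination is required of coefficients rather than of values: this survives Cauchy
  products and yields both convergence for \<open>q < 1\<close> and the growth bound there.\<close>

definition pole_bounded :: "real fps \<Rightarrow> bool" where
  "pole_bounded f \<longleftrightarrow> (\<exists>C k. C \<ge> 0 \<and> (\<forall>n. \<bar>fps_nth f n\<bar> \<le> C * fps_nth (geom_fps ^ k) n))"

lemma pole_bounded_add:
  assumes "pole_bounded f" "pole_bounded g" shows "pole_bounded (f + g)"
proof -
  obtain C k D l where f: "C \<ge> 0" "\<And>n. \<bar>fps_nth f n\<bar> \<le> C * fps_nth (geom_fps ^ k) n"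
    and g: "D \<ge> 0" "\<And>n. \<bar>fps_nth g n\<bar> \<le> D * fps_nth (geom_fps ^ l) n"
    using assms unfolding pole_bounded_def by blast
  have "\<bar>fps_nth (f + g) n\<bar> \<le> (C + D) * fps_nth (geom_fps ^ max k l) n" for n
  proof -
    have "\<bar>fps_nth (f + g) n\<bar> \<le> C * fps_nth (geom_fps ^ k) n + D * fps_nth (geom_fps ^ l) n"
      using f(2)[of n] g(2)[of n] by simp
    also have "\<dots> \<le> C * fps_nth (geom_fps ^ max k l) n + D * fps_nth (geom_fps ^ max k l) n"
      using f(1) g(1) by (intro add_mono mult_left_mono geom_fps_power_mono) auto
    finally show ?thesis by (simp add: distrib_right)
  qed
  then show ?thesis unfolding pole_bounded_def using f(1) g(1) by (metis add_nonneg_nonneg)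
qed

lemma pole_bounded_mult:
  assumes "pole_bounded f" "pole_bounded g" shows "pole_bounded (f * g)"
proof -
  obtain C k D l where f: "C \<ge> 0" "\<And>n. \<bar>fps_nth f n\<bar> \<le> C * fps_nth (geom_fps ^ k) n"
    and g: "D \<ge> 0" "\<And>n. \<bar>fps_nth g n\<bar> \<le> D * fps_nth (geom_fps ^ l) n"
    using assms unfolding pole_bounded_def by blast
  have "\<bar>fps_nth (f * g) n\<bar> \<le> (C * D) * fps_nth (geom_fps ^ (k + l)) n" for n
  proof -
    have "\<bar>fps_nth (f * g) n\<bar> \<le> (\<Sum>i=0..n. \<bar>fps_nth f i\<bar> * \<bar>fps_nth g (n - i)\<bar>)"
      unfolding fps_mult_nth abs_mult[symmetric] by (rule sum_abs)
    also have "\<dots> \<le> (\<Sum>i=0..n. (C * fps_nth (geom_fps ^ k) i) * (D * fps_nth (geom_fps ^ l) (n - i)))"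
      by (intro sum_mono mult_mono f g) (auto intro!: mult_nonneg_nonneg f g geom_fps_power_nonneg)
    also have "\<dots> = (C * D) * fps_nth (geom_fps ^ (k + l)) n"
      unfolding power_add fps_mult_nth sum_distrib_left by (intro sum.cong) auto
    finally show ?thesis .
  qed
  then show ?thesis unfolding pole_bounded_def using f(1) g(1) by (metis mult_nonneg_nonneg)
qed

lemma pole_boundedI:
  assumes "\<And>n. \<bar>fps_nth f n\<bar> \<le> C * real (n + 1) ^ m" "C \<ge> 0"
  shows "pole_bounded f"
  unfolding pole_bounded_def
proof (intro exI conjI allI)
  show "\<bar>fps_nth f n\<bar> \<le> (C * fact m) * fps_nth (geom_fps ^ (m + 1)) n" for n
    using order.trans[OF assms(1)[of n] mult_left_mono[OF power_le_geom_fps assms(2)]] by (simp only: mult.assoc)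
  show "C * fact m \<ge> 0" using assms(2) by simp
qed

lemma pole_bounded_const: "pole_bounded (fps_const c)"
  by (rule pole_boundedI[of _ "\<bar>c\<bar>" 0]) auto

lemma pole_bounded_eis: "pole_bounded (eis c m)"
proof (rule pole_boundedI[of _ "1 + \<bar>real_of_int c\<bar>" "m + 1"])
  fix n
  show "\<bar>fps_nth (eis c m) n\<bar> \<le> (1 + \<bar>real_of_int c\<bar>) * real (n + 1) ^ (m + 1)"
  proof (cases "n = 0")
    case False
    have "\<bar>\<Sum>d | d dvd n. real d ^ m\<bar> = (\<Sum>d | d dvd n. real d ^ m)" by (simp add: sum_nonneg)
    also have "\<dots> \<le> (\<Sum>d | d dvd n. real (n + 1) ^ m)"
      using False by (intro sum_mono power_mono) (auto dest!: dvd_imp_le)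
    also have "\<dots> = real (card {d. d dvd n}) * real (n + 1) ^ m" by simp
    also have "\<dots> \<le> real (n + 1) * real (n + 1) ^ m"
    proof (intro mult_right_mono)
      have "card {d. d dvd n} \<le> card {..n}" using False by (intro card_mono) (auto dest!: dvd_imp_le)
      then show "real (card {d. d dvd n}) \<le> real (n + 1)" by simp
    qed simp
    finally have "\<bar>\<Sum>d | d dvd n. real d ^ m\<bar> \<le> real (n + 1) ^ (m + 1)" by simp
    then have "\<bar>real_of_int c\<bar> * \<bar>\<Sum>d | d dvd n. real d ^ m\<bar> \<le> (1 + \<bar>real_of_int c\<bar>) * real (n + 1) ^ (m + 1)"
      by (intro mult_mono) auto
    then show ?thesis using False by (simp add: eis_nth abs_mult)
  qed (simp add: eis_nth)
qed simp

lemma geom_fps_conv: "fps_conv_radius geom_fps \<ge> 1"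
  unfolding fps_conv_radius_def
  by (rule conv_radius_geI_ex') (auto simp: geom_fps_nth intro!: summable_geometric)

lemma pole_bounded_summable:
  assumes "pole_bounded f" "0 \<le> q" "q < 1" shows "summable (\<lambda>n. \<bar>fps_nth f n\<bar> * q ^ n)"
proof -
  obtain C k where f: "C \<ge> 0" "\<And>n. \<bar>fps_nth f n\<bar> \<le> C * fps_nth (geom_fps ^ k) n"
    using assms unfolding pole_bounded_def by blast
  have "norm q < fps_conv_radius (geom_fps ^ k)"
    using fps_conv_radius_power[of geom_fps k] geom_fps_conv assms
    by (intro less_le_trans[OF _ order.trans[OF geom_fps_conv fps_conv_radius_power]]) auto
  then have "summable (\<lambda>n. C * (fps_nth (geom_fps ^ k) n * q ^ n))"
    by (intro summable_mult summable_fps)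
  then show ?thesis
    by (rule summable_comparison_test'[where N = 0]) (use f(2) assms in \<open>auto intro!: mult_right_mono simp flip: mult.assoc\<close>)
qed

lemma pole_bounded_conv: "pole_bounded f \<Longrightarrow> fps_conv_radius f \<ge> 1"
  unfolding fps_conv_radius_def
  by (rule conv_radius_geI_ex', rule summable_norm_cancel)
     (use pole_bounded_summable in \<open>auto simp: abs_mult\<close>)

lemma pole_bounded_conv_less: "pole_bounded f \<Longrightarrow> 0 \<le> q \<Longrightarrow> q < 1 \<Longrightarrow> ereal (norm (q :: real)) < fps_conv_radius f"
  by (rule less_le_trans[OF _ pole_bounded_conv]) auto

lemma pole_bounded_eval:
  assumes "pole_bounded f"
  obtains C k where "C \<ge> 0" "\<And>q. 0 \<le> q \<Longrightarrow> q < 1 \<Longrightarrow> \<bar>eval_fps f q\<bar> \<le> C * (1 / (1 - q)) ^ k"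
proof -
  obtain C k where f: "C \<ge> 0" "\<And>n. \<bar>fps_nth f n\<bar> \<le> C * fps_nth (geom_fps ^ k) n"
    using assms unfolding pole_bounded_def by blast
  have "\<bar>eval_fps f q\<bar> \<le> C * (1 / (1 - q)) ^ k" if q: "0 \<le> q" "q < 1" for q
  proof -
    have r: "ereal (norm q) < fps_conv_radius geom_fps"
      by (rule less_le_trans[OF _ geom_fps_conv]) (use q in auto)
    have r': "ereal (norm q) < fps_conv_radius (geom_fps ^ k)"
      by (rule less_le_trans[OF r fps_conv_radius_power])
    have "eval_fps geom_fps q = 1 / (1 - q)"
      using q by (simp add: eval_fps_def geom_fps_nth suminf_geometric)
    then have G: "eval_fps (geom_fps ^ k) q = (1 / (1 - q)) ^ k" using r by (simp add: eval_fps_power)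
    have s: "summable (\<lambda>n. \<bar>fps_nth f n\<bar> * q ^ n)" by (rule pole_bounded_summable) fact+
    then have "\<bar>eval_fps f q\<bar> \<le> (\<Sum>n. \<bar>fps_nth f n\<bar> * q ^ n)"
      unfolding eval_fps_def using summable_rabs[of "\<lambda>n. fps_nth f n * q ^ n"] q by (simp add: abs_mult)
    also have "\<dots> \<le> (\<Sum>n. C * (fps_nth (geom_fps ^ k) n * q ^ n))"
      using s f(2) q summable_fps[OF r']
      by (intro suminf_le summable_mult) (auto intro!: mult_right_mono simp flip: mult.assoc)
    also have "\<dots> = C * eval_fps (geom_fps ^ k) q"
      unfolding eval_fps_def by (rule suminf_mult[OF summable_fps[OF r']])
    finally show ?thesis unfolding G .
  qed
  then show ?thesis using f(1) that by blast
qed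

lemma pole_bounded_poly:
  assumes "\<And>c. pole_bounded (h c)" "h 0 = 0" "pole_bounded x"
  shows "pole_bounded (poly_eval_hom h x p)"
proof (induction p)
  case 0 then show ?case using pole_bounded_const[of 0] by simp
next
  case (pCons c p)
  then show ?case using assms by (simp add: poly_eval_hom_pCons pole_bounded_add pole_bounded_mult)
qed

lemma pole_bounded_qexp2: "pole_bounded (qexp2 Q)"
  unfolding qexp2_def by (intro pole_bounded_poly pole_bounded_const pole_bounded_eis) auto

lemma eval_fps_poly_E4:
  fixes N :: "real poly"
  assumes q: "0 \<le> q" "q < 1"
  shows "eval_fps (poly_eval_hom fps_const E4 N) q = poly N (eval_fps E4 q)"
proof (induction N)
  case 0 then show ?case by simp
next
  case (pCons c N)
  have "pole_bounded (poly_eval_hom fps_const E4 N)"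
    by (intro pole_bounded_poly pole_bounded_const pole_bounded_eis) auto
  note b = this pole_bounded_mult[OF pole_bounded_eis this] pole_bounded_eis pole_bounded_const
  show ?case using pCons b[THEN pole_bounded_conv_less, OF q]
    by (simp add: poly_eval_hom_pCons eval_fps_add eval_fps_mult)
qed

text \<open>This is \<open>- 1728\<close> times the normalized discriminant cusp form.\<close>

definition delta_fps :: "'a::comm_ring_1 fps" where "delta_fps = E6 ^ 2 - E4 ^ 3"

lemma delta_fps_eq: "delta_fps = qexp2 (x6 ^ 2 - x4 ^ 3)"
  by (simp add: delta_fps_def qexp2.diff qexp2.power qexp2_x4 qexp2_x6)

text \<open>In the equations for \<open>E4\<close> and \<open>E6\<close> the contributions
  \<open>E4^2 E6\<close> cancel, and only the multiples of \<open>E2\<close> remain.\<close>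

lemma delta_fps_ode: "fps_XD delta_fps = (E2 * delta_fps :: 'a::comm_ring_1 fps)"
proof -
  have "fps_XD delta_fps = E6 * (2 * fps_XD E6) - E4 ^ 2 * (3 * fps_XD E4 :: 'a fps)"
    by (simp add: delta_fps_def power2_eq_square power3_eq_cube fps_XD_mult fps_XD_diff algebra_simps)
  then show ?thesis unfolding E6_ode E4_ode delta_fps_def
    by (simp add: power2_eq_square power3_eq_cube algebra_simps)
qed

lemma divisors_1: "{d. d dvd Suc 0} = {Suc 0}" by auto

lemma delta_fps_nth_1: "fps_nth (delta_fps :: 'a::comm_ring_1 fps) 1 = - 1728"
  by (simp add: delta_fps_def power2_eq_square power3_eq_cube eis_nth divisors_1)

section \<open>Estimates for \<open>E2\<close>, \<open>E4\<close> and the discriminant near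
  \<open>q = 1\<close>\<close>

lemma sum_divisors_ge:
  assumes "n > 0" "m \<ge> 1" shows "real n \<le> (\<Sum>d | d dvd n. real d ^ m)"
proof -
  have "real n \<le> real n ^ m" using assms by (simp add: self_le_power)
  also have "\<dots> \<le> (\<Sum>d | d dvd n. real d ^ m)" using assms by (intro member_le_sum) auto
  finally show ?thesis .
qed

text \<open>Termwise comparison of the divisor sum of \<open>n\<close> with \<open>n\<close> itself,
  together with \<open>sum n q^n = q / (1 - q)^2\<close>; the sign of \<open>c\<close> decides the
  direction.\<close>

lemma eval_eis_bound:
  assumes q: "0 \<le> q" "q < 1" and m: "m \<ge> 1"
  shows "c \<ge> 0 \<Longrightarrow> eval_fps (eis c m) q \<ge> 1 + c * (q / (1 - q) ^ 2)"
    and "c \<le> 0 \<Longrightarrow> eval_fps (eis c m) q \<le> 1 + c * (q / (1 - q) ^ 2)"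
proof -
  have "(\<lambda>n. q * (of_nat (Suc n) * q ^ n)) sums (q * (1 / (1 - q) ^ 2))"
    by (rule sums_mult[OF geometric_deriv_sums]) (use q in simp)
  then have "(\<lambda>n. of_nat (Suc n) * q ^ Suc n) sums (q / (1 - q) ^ 2)" by (simp add: mult_ac)
  from sums_Suc[OF this] have 1: "(\<lambda>n. of_nat n * q ^ n) sums (q / (1 - q) ^ 2)" by simp
  have A: "(\<lambda>n. fps_nth (eis c m) n * q ^ n) sums eval_fps (eis c m) q"
    by (rule sums_eval_fps[OF pole_bounded_conv_less[OF pole_bounded_eis q]])
  have "(\<lambda>n. if n = 0 then 1 else 0) sums (1::real)"
    using sums_single[of 0 "\<lambda>_. 1::real"] by simp
  from sums_add[OF this sums_mult[OF 1, of "of_int c"]]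
  have B: "(\<lambda>n. (if n = 0 then 1 else 0) + of_int c * (of_nat n * q ^ n)) sums (1 + of_int c * (q / (1 - q) ^ 2))" .
  have le: "real n * q ^ n \<le> (\<Sum>d | d dvd n. real d ^ m) * q ^ n" if "n > 0" for n
    using sum_divisors_ge[OF that m] q by (intro mult_right_mono) auto
  show "eval_fps (eis c m) q \<ge> 1 + c * (q / (1 - q) ^ 2)" if c: "c \<ge> 0"
  proof (rule sums_le[OF _ B A])
    fix n show "(if n = 0 then 1 else 0) + of_int c * (of_nat n * q ^ n) \<le> fps_nth (eis c m) n * q ^ n"
      using mult_left_mono[OF le[of n], of "real_of_int c"] c by (auto simp: eis_nth mult.assoc)
  qed
  show "eval_fps (eis c m) q \<le> 1 + c * (q / (1 - q) ^ 2)" if c: "c \<le> 0"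
  proof (rule sums_le[OF _ A B])
    fix n show "fps_nth (eis c m) n * q ^ n \<le> (if n = 0 then 1 else 0) + of_int c * (of_nat n * q ^ n)"
      using mult_left_mono_neg[OF le[of n], of "real_of_int c"] c by (auto simp: eis_nth mult.assoc)
  qed
qed

text \<open>By \<open>delta_fps_ode\<close>, \<open>\<delta>\<^sup>2 exp (48/(1-q)) / q\<^sup>2\<close> has nonpositive derivative, so
  \<open>\<delta>\<close> vanishes to infinite order at \<open>q = 1\<close>.\<close>

lemma delta_decay:
  "\<exists>K\<ge>0. \<forall>q. 1/2 \<le> q \<longrightarrow> q < 1 \<longrightarrow> (eval_fps delta_fps q)\<^sup>2 \<le> K * exp (- 48 / (1 - q :: real))"
proof -
  define \<delta> where "\<delta> = eval_fps (delta_fps :: real fps)"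
  \<comment> \<open>The function \<open>q exp (- 24 / (1 - q))\<close> solves
    \<open>q y' = (1 - 24 q / (1 - q)^2) y\<close>, whose factor bounds \<open>E2\<close> from
    above. \<open>\<phi>\<close> is the squared quotient of \<open>\<delta>\<close> by this
    solution; squaring makes the sign of \<open>\<delta>\<close> irrelevant.\<close>
  define \<phi> where "\<phi> q = (\<delta> q)\<^sup>2 * (exp (48 / (1 - q)) / q\<^sup>2)" for q
  have pb: "pole_bounded delta_fps" unfolding delta_fps_eq by (rule pole_bounded_qexp2)
  have der: "\<exists>D. (\<phi> has_real_derivative D) (at q) \<and> D \<le> 0" if q: "0 < q" "q < 1" for q
  proof -
    define \<delta>' where "\<delta>' = eval_fps (fps_deriv delta_fps) q"
    have r: "ereal (norm q) < fps_conv_radius (delta_fps :: real fps)" "ereal (norm q) < fps_conv_radius (E2 :: real fps)"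
      using q by (intro pole_bounded_conv_less pb pole_bounded_eis; simp)+
    have r': "ereal (norm q) < fps_conv_radius (fps_deriv (delta_fps :: real fps))"
      by (rule less_le_trans[OF r(1) fps_conv_radius_deriv])
    have d: "(\<delta> has_real_derivative \<delta>') (at q)"
      unfolding \<delta>_def \<delta>'_def by (rule has_field_derivative_eval_fps[OF r(1)])
    have "q * \<delta>' = eval_fps (fps_X * fps_deriv delta_fps) q"
      unfolding \<delta>'_def using r' by (simp add: eval_fps_mult)
    also have "fps_X * fps_deriv delta_fps = (E2 * delta_fps :: real fps)"
      using delta_fps_ode by (simp add: fps_XD_def)
    also have "eval_fps \<dots> q = eval_fps E2 q * \<delta> q"
      unfolding \<delta>_def using r by (simp add: eval_fps_mult)
    finally have ode: "\<delta>' = eval_fps E2 q * \<delta> q / q" using q by (simp add: field_simps)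
    define w where "w = exp (48 / (1 - q)) / q\<^sup>2"
    have "((\<lambda>q. (\<delta> q)\<^sup>2 * (exp (48 / (1 - q)) / q\<^sup>2)) has_real_derivative
        2 * \<delta> q * \<delta>' * w + (\<delta> q)\<^sup>2 * (w * (48 / (1 - q)\<^sup>2) - w * (2 / q))) (at q)"
    proof -
      have 1: "((\<lambda>q. exp (48 / (1 - q))) has_real_derivative exp (48 / (1 - q)) * (48 / (1 - q)\<^sup>2)) (at q)"
        using q by (auto intro!: derivative_eq_intros simp: power2_eq_square)
      have 2: "((\<lambda>q. q\<^sup>2) has_real_derivative 2 * q) (at q)"
        by (auto intro!: derivative_eq_intros)
      have 3: "((\<lambda>q. (\<delta> q)\<^sup>2) has_real_derivative 2 * \<delta> q * \<delta>') (at q)"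
        by (auto intro!: derivative_eq_intros d)
      have "((\<lambda>q. exp (48 / (1 - q)) / q\<^sup>2) has_real_derivative
         (exp (48 / (1 - q)) * (48 / (1 - q)\<^sup>2) * q\<^sup>2 - exp (48 / (1 - q)) * (2 * q)) / (q\<^sup>2 * q\<^sup>2)) (at q)"
        by (rule DERIV_divide[OF 1 2]) (use q in simp)
      also have "(exp (48 / (1 - q)) * (48 / (1 - q)\<^sup>2) * q\<^sup>2 - exp (48 / (1 - q)) * (2 * q)) / (q\<^sup>2 * q\<^sup>2)
         = w * (48 / (1 - q)\<^sup>2) - w * (2 / q)"
      proof -
        have "(e * (48 / u\<^sup>2) * q\<^sup>2 - e * (2 * q)) / (q\<^sup>2 * q\<^sup>2) = e / q\<^sup>2 * (48 / u\<^sup>2) - e / q\<^sup>2 * (2 / q)"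
          if "u \<noteq> 0" for e u :: real using that q by (simp add: field_simps power2_eq_square)
        from this[of "1 - q"] show ?thesis unfolding w_def using q by simp
      qed
      finally have "((\<lambda>q. exp (48 / (1 - q)) / q\<^sup>2) has_real_derivative w * (48 / (1 - q)\<^sup>2) - w * (2 / q)) (at q)" .
      from DERIV_mult[OF 3 this] show ?thesis by (rule DERIV_cong) (simp add: w_def mult_ac)
    qed
    moreover have "2 * \<delta> q * \<delta>' * w + (\<delta> q)\<^sup>2 * (w * (48 / (1 - q)\<^sup>2) - w * (2 / q)) =
        (2 * (\<delta> q)\<^sup>2 * w / q) * (eval_fps E2 q - (1 - 24 * (q / (1 - q)\<^sup>2)))"
    proof -
      have "2 * \<delta> q * (e * \<delta> q / q) * w + (\<delta> q)\<^sup>2 * (w * (48 / u) - w * (2 / q)) =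
          (2 * (\<delta> q)\<^sup>2 * w / q) * (e - (1 - 24 * (q / u)))" if "u \<noteq> 0" for e u
      proof -
        have "q * inverse q = 1" using q by simp
        then show ?thesis unfolding divide_inverse by algebra
      qed
      then show ?thesis unfolding ode using q by simp
    qed
    moreover have "\<dots> \<le> 0"
    proof (rule mult_nonneg_nonpos)
      show "0 \<le> 2 * (\<delta> q)\<^sup>2 * w / q" using q by (simp add: w_def)
      show "eval_fps E2 q - (1 - 24 * (q / (1 - q)\<^sup>2)) \<le> 0"
        using eval_eis_bound(2)[of q 1 "-24"] q by simp
    qed
    ultimately show ?thesis unfolding \<phi>_def[abs_def] by (intro exI conjI) (assumption, simp only:)
  qed
  have "(\<delta> q)\<^sup>2 \<le> \<phi> (1/2) * exp (- 48 / (1 - q))" if q: "1/2 \<le> q" "q < 1" for q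
  proof -
    have "\<phi> q \<le> \<phi> (1/2)"
      by (rule DERIV_nonpos_imp_nonincreasing[OF q(1)]) (use der q in force)
    moreover have "\<phi> (1/2) \<ge> 0" by (simp add: \<phi>_def)
    moreover have "q\<^sup>2 * exp (- 48 / (1 - q)) \<le> 1 * exp (- 48 / (1 - q))"
      using q by (intro mult_right_mono) (auto simp: power_le_one)
    ultimately have "\<phi> q * (q\<^sup>2 * exp (- 48 / (1 - q))) \<le> \<phi> (1/2) * (1 * exp (- 48 / (1 - q)))"
      by (intro mult_mono) auto
    moreover have "\<phi> q * (q\<^sup>2 * exp (- 48 / (1 - q))) = (\<delta> q)\<^sup>2"
    proof -
      have "exp (48 / (1 - q)) * exp (- 48 / (1 - q)) = 1" by (simp flip: exp_add)
      then have "(\<delta> q)\<^sup>2 * (exp (48 / (1 - q)) * exp (- 48 / (1 - q))) * (q\<^sup>2 / q\<^sup>2) = (\<delta> q)\<^sup>2" using q by simp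
      then show ?thesis unfolding \<phi>_def by (simp only: times_divide_eq_left times_divide_eq_right mult_ac)
    qed
    ultimately have "(\<delta> q)\<^sup>2 \<le> \<phi> (1/2) * (1 * exp (- 48 / (1 - q)))" by (simp only:)
    then show ?thesis by simp
  qed
  moreover have "\<phi> (1/2) \<ge> 0" by (simp add: \<phi>_def)
  ultimately show ?thesis unfolding \<delta>_def by blast
qed

lemma filterlim_pole: "filterlim (\<lambda>q::real. 1 / (1 - q)) at_top (at_left 1)"
proof -
  have "((\<lambda>q::real. 1 - q) \<longlongrightarrow> 1 - 1) (at_left 1)" by (intro tendsto_intros)
  then have "filterlim (\<lambda>q::real. inverse (1 - q)) at_top (at_left 1)"
    by (intro filterlim_inverse_at_top eventually_at_leftI[of 0]) auto
  then show ?thesis by (simp add: inverse_eq_divide)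
qed

lemma delta_times_tendsto_0:
  fixes t :: "real poly poly"
  shows "((\<lambda>q. eval_fps (delta_fps * qexp2 t) q) \<longlongrightarrow> 0) (at_left 1)"
proof -
  obtain K where K: "K \<ge> 0" "\<And>q::real. 1/2 \<le> q \<Longrightarrow> q < 1 \<Longrightarrow> (eval_fps delta_fps q)\<^sup>2 \<le> K * exp (- 48 / (1 - q))"
    using delta_decay by blast
  obtain C k where C: "C \<ge> 0" "\<And>q. 0 \<le> q \<Longrightarrow> q < 1 \<Longrightarrow> \<bar>eval_fps (qexp2 t) q\<bar> \<le> C * (1 / (1 - q)) ^ k"
    using pole_bounded_eval[OF pole_bounded_qexp2] by metis
  have pb: "pole_bounded delta_fps" unfolding delta_fps_eq by (rule pole_bounded_qexp2)
  have ev: "eventually (\<lambda>q::real. q \<in> {1/2<..<1}) (at_left 1)"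
    by (rule eventually_at_leftI[of "1/2"]) auto
  have "((\<lambda>q. (K * C\<^sup>2) * ((1 / (1 - q)) ^ (2 * k) / exp (1 / (1 - q)))) \<longlongrightarrow> (K * C\<^sup>2) * 0) (at_left 1)"
    by (intro tendsto_mult tendsto_const filterlim_compose[OF tendsto_power_div_exp_0 filterlim_pole])
  then have lim: "((\<lambda>q. (K * C\<^sup>2) * ((1 / (1 - q)) ^ (2 * k) / exp (1 / (1 - q)))) \<longlongrightarrow> 0) (at_left 1)" by simp
  have "((\<lambda>q. (eval_fps (delta_fps * qexp2 t) q)\<^sup>2) \<longlongrightarrow> 0) (at_left 1)"
  proof (rule tendsto_sandwich[OF _ _ tendsto_const lim])
    show "eventually (\<lambda>q. 0 \<le> (eval_fps (delta_fps * qexp2 t) q)\<^sup>2) (at_left 1)" by simp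
    show "eventually (\<lambda>q. (eval_fps (delta_fps * qexp2 t) q)\<^sup>2 \<le> 
        (K * C\<^sup>2) * ((1 / (1 - q)) ^ (2 * k) / exp (1 / (1 - q)))) (at_left 1)"
      using ev
    proof eventually_elim
      case (elim q)
      then have q: "1/2 \<le> q" "0 \<le> q" "q < 1" by auto
      have "(eval_fps (delta_fps * qexp2 t) q)\<^sup>2 = (eval_fps delta_fps q)\<^sup>2 * \<bar>eval_fps (qexp2 t) q\<bar>\<^sup>2"
        unfolding eval_fps_mult[OF pole_bounded_conv_less[OF pb q(2,3)] pole_bounded_conv_less[OF pole_bounded_qexp2 q(2,3)]]
        by (simp add: power_mult_distrib)
      also have "\<dots> \<le> (K * exp (- 48 / (1 - q))) * (C * (1 / (1 - q)) ^ k)\<^sup>2"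
        using q K C by (intro mult_mono power_mono) auto
      also have "\<dots> \<le> (K * exp (- (1 / (1 - q)))) * (C * (1 / (1 - q)) ^ k)\<^sup>2"
      proof (intro mult_right_mono mult_left_mono K(1))
        have "1 / (1 - q) \<le> 48 / (1 - q)" using q by (intro divide_right_mono) auto
        then show "exp (- 48 / (1 - q)) \<le> exp (- (1 / (1 - q)))" by simp
      qed simp
      also have "\<dots> = (K * C\<^sup>2) * ((1 / (1 - q)) ^ (2 * k) / exp (1 / (1 - q)))"
        unfolding exp_minus power_mult_distrib power_mult[symmetric] mult.commute[of k] divide_inverse
        by (simp only: mult_ac)
      finally show ?case .
    qed
  qed
  then have "((\<lambda>q. sqrt ((eval_fps (delta_fps * qexp2 t) q)\<^sup>2)) \<longlongrightarrow> sqrt 0) (at_left 1)"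
    by (rule tendsto_real_sqrt)
  then show ?thesis by (simp only: real_sqrt_abs real_sqrt_zero tendsto_rabs_zero_iff)
qed

lemma E4_at_top: "filterlim (\<lambda>q. eval_fps (E4 :: real fps) q) at_top (at_left 1)"
proof (rule filterlim_at_top_mono[OF filterlim_pole])
  have "eventually (\<lambda>q::real. q \<in> {1/2<..<1}) (at_left 1)"
    by (rule eventually_at_leftI[of "1/2"]) auto
  then show "eventually (\<lambda>q. 1 / (1 - q) \<le> eval_fps (E4 :: real fps) q) (at_left 1)"
  proof eventually_elim
    case (elim q)
    have "1 / (1 - q) = 1 * (1 - q) / (1 - q)\<^sup>2" using elim by (simp add: power2_eq_square)
    also have "\<dots> \<le> 240 * q / (1 - q)\<^sup>2" using elim by (intro divide_right_mono) auto
    also have "\<dots> \<le> eval_fps E4 q" using eval_eis_bound(1)[of q 3 240] elim by simp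
    finally show ?case .
  qed
qed

lemma poly_tendsto_0_at_top:
  fixes N :: "real poly"
  assumes "((\<lambda>x. poly N (f x)) \<longlongrightarrow> 0) F" "filterlim f at_top F" "F \<noteq> bot"
  shows "N = 0"
proof (rule ccontr)
  assume "N \<noteq> 0"
  have *: False if pos: "lead_coeff M > 0" and lim: "((\<lambda>x. poly M (f x)) \<longlongrightarrow> 0) F" for M :: "real poly"
  proof -
    obtain n where n: "\<And>x. x \<ge> n \<Longrightarrow> poly M x \<ge> lead_coeff M"
      using poly_pinfty_gt_lc[OF pos] by blast
    have "eventually (\<lambda>x. f x \<ge> n) F" using assms(2) by (simp add: filterlim_at_top)
    then have "eventually (\<lambda>x. lead_coeff M \<le> poly M (f x)) F" by eventually_elim (rule n)
    then have "lead_coeff M \<le> 0" by (rule tendsto_lowerbound[OF lim]) fact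
    then show False using pos by simp
  qed
  show False
  proof (cases "lead_coeff N > 0")
    case True then show ?thesis using * assms(1) by blast
  next
    case False
    then have "lead_coeff (- N) > 0" using \<open>N \<noteq> 0\<close> by (simp add: not_less order_less_le)
    moreover have "((\<lambda>x. poly (- N) (f x)) \<longlongrightarrow> 0) F" using tendsto_minus[OF assms(1)] by simp
    ultimately show ?thesis using * by blast
  qed
qed

text \<open>Division with remainder in the variable \<open>x6\<close>: the divisor is monic of
  degree 2, so remainders are linear in \<open>x6\<close> with coefficients in
  \<open>x4\<close>.\<close>

lemma divide_by_delta:
  "\<exists>s a b. f = (x6 ^ 2 - x4 ^ 3) * s + [:a, b:]" for f :: "'a::comm_ring_1 poly poly"
proof (induction f)
  case 0 have "0 = (x6 ^ 2 - x4 ^ 3) * 0 + [:0, 0:]" by simp then show ?case by blast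
next
  case (pCons c f)
  then obtain s a b where f: "f = (x6 ^ 2 - x4 ^ 3) * s + [:a, b:]" by blast
  have "pCons c f = [:c:] + x6 * f" by (simp add: x6_def)
  also have "\<dots> = (x6 ^ 2 - x4 ^ 3) * (x6 * s + [:b:]) + ([:c:] + x6 * [:a:] + x4 ^ 3 * [:b:])"
  proof -
    have "[:a, b:] = [:a:] + x6 * [:b:]" by (simp add: x6_def)
    then show ?thesis unfolding f by (simp add: algebra_simps power2_eq_square)
  qed
  also have "[:c:] + x6 * [:a:] + x4 ^ 3 * [:b:] = [:c + [:0, 1:] ^ 3 * b, a:]"
    by (simp add: x4_def x6_def power3_eq_cube)
  finally show ?case by blast
qed

text \<open>Let \<open>a + b x6\<close> be the remainder of \<open>f\<close>. Modulo the
  discriminant its norm is \<open>a^2 - b^2 x4^3\<close>, a polynomial in \<open>x4\<close> alone.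
  If \<open>f\<close> has zero expansion, the norm at \<open>E4\<close> is a multiple of
  \<open>delta_fps\<close>, so it tends to 0 while \<open>E4\<close> tends to infinity; hence it is
  the zero polynomial, and parity of degrees gives \<open>a = b = 0\<close>. Cancelling
  \<open>delta_fps\<close> then lowers the degree in \<open>x6\<close>.\<close>

lemma qexp2_real_inj: "qexp2 f = 0 \<Longrightarrow> f = (0 :: real poly poly)"
proof (induction "degree f" arbitrary: f rule: less_induct)
  case less
  let ?m = "x6 ^ 2 - x4 ^ 3 :: real poly poly"
  obtain s a b where f: "f = ?m * s + [:a, b:]" using divide_by_delta by blast
  let ?N = "a ^ 2 - b ^ 2 * [:0, 1:] ^ 3"
  have "[:?N:] = [:a, b:] * [:a, - b:] + [:b ^ 2:] * ?m"
    by (simp add: x4_def x6_def power2_eq_square power3_eq_cube algebra_simps)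
  also have "[:a, b:] = f - ?m * s" by (simp add: f)
  finally have N: "[:?N:] = f * [:a, - b:] + ?m * ([:b ^ 2:] - s * [:a, - b:])" by (simp add: algebra_simps)
  have "poly_eval_hom fps_const E4 ?N = qexp2 [:?N:]" by (simp add: qexp2_def poly_eval_hom_const)
  also have "\<dots> = delta_fps * qexp2 ([:b ^ 2:] - s * [:a, - b:])"
    unfolding N qexp2.add qexp2.mult less(2) delta_fps_eq by simp
  finally have eq: "poly_eval_hom fps_const E4 ?N = delta_fps * qexp2 ([:b ^ 2:] - s * [:a, - b:])" .
  have "((\<lambda>q. poly ?N (eval_fps E4 q)) \<longlongrightarrow> 0) (at_left 1)"
  proof (rule Lim_transform_eventually[OF delta_times_tendsto_0])
    have "eventually (\<lambda>q::real. q \<in> {0<..<1}) (at_left 1)"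
      by (rule eventually_at_leftI[of 0]) auto
    then show "\<forall>\<^sub>F q in at_left 1. eval_fps (delta_fps * qexp2 ([:b ^ 2:] - s * [:a, - b:])) q = poly ?N (eval_fps E4 q)"
      unfolding eq[symmetric] by eventually_elim (rule eval_fps_poly_E4; simp)
  qed
  then have "?N = 0" by (rule poly_tendsto_0_at_top[OF _ E4_at_top]) simp
  then have ab: "a ^ 2 = b ^ 2 * [:0, 1:] ^ 3" by simp
  have b: "b = 0"
  proof (rule ccontr)
    assume b: "b \<noteq> 0"
    then have a: "a \<noteq> 0" using ab by auto
    have "2 * degree a = degree (a ^ 2)" using a by (simp add: degree_power_eq)
    also have "\<dots> = 2 * degree b + 3" unfolding ab using b by (simp add: degree_mult_eq degree_power_eq)
    finally show False by presburger
  qed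
  then have a: "a = 0" using ab by simp
  have f': "f = ?m * s" using f a b by simp
  have "delta_fps \<noteq> (0 :: real fps)" using delta_fps_nth_1[where 'a = real] by auto
  then have "qexp2 s = 0" using less(2) unfolding f' qexp2.mult delta_fps_eq[symmetric] by simp
  moreover have "degree s < degree f" if "s \<noteq> 0"
  proof -
    have "?m = [:- ([:0, 1:] ^ 3), 0, 1:]" by (simp add: x4_def x6_def power2_eq_square power3_eq_cube)
    then have "degree ?m = 2" "?m \<noteq> 0" by simp_all
    then show ?thesis unfolding f' using that by (simp add: degree_mult_eq)
  qed
  ultimately have "s = 0" using less(1) by blast
  then show "f = 0" using f' by simp
qed

lemma qexp2_rat_inj:
  assumes "qexp2 f = (0 :: rat fps)" shows "f = 0"
proof -
  interpret r: rhom "of_rat :: rat \<Rightarrow> real" by (rule rhom_of_rat)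
  have "qexp2 (map_poly (map_poly (of_rat :: rat \<Rightarrow> real)) f) = 0"
    unfolding r.map_fps_qexp2[symmetric] assms by (simp add: fps_eq_iff)
  then have "map_poly (map_poly (of_rat :: rat \<Rightarrow> real)) f = 0" by (rule qexp2_real_inj)
  then have "coeff (coeff (map_poly (map_poly (of_rat :: rat \<Rightarrow> real)) f) i) j = 0" for i j by simp
  then show ?thesis by (simp add: coeff_map_poly poly_eq_iff)
qed

section \<open>Homogeneous forms are determined by their \<open>q\<close>-expansions\<close>

text \<open>The constant term of \<open>g(X) = 0\<close> says \<open>g(1) = 0\<close>. Splitting off
  the linear factor and cancelling \<open>X - 1\<close>, which is nonzero, lowers the degree. This
  works in every characteristic.\<close>

lemma fps_transcendental:
  fixes X :: "'k::field fps"
  assumes "fps_nth X 0 = 1" "X \<noteq> 1" shows "poly_eval_hom fps_const X g = 0 \<Longrightarrow> g = 0"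
proof (induction "degree g" arbitrary: g rule: less_induct)
  case less
  interpret e: rhom "poly_eval_hom fps_const X" by (intro rhom_poly_eval_hom rhom_fps_const)
  have "fps_nth (poly_eval_hom fps_const X f) 0 = poly f 1" for f
    using assms(1) by (induction f) (simp_all add: poly_eval_hom_pCons)
  then have "poly g 1 = 0" using less(2) by (metis fps_zero_nth)
  then obtain h where g: "g = [:- 1, 1:] * h" using poly_eq_0_iff_dvd by (metis dvdE)
  have "poly_eval_hom fps_const X [:- 1, 1:] = X - 1" by (simp add: poly_eval_hom_pCons flip: fps_const_neg)
  then have "(X - 1) * poly_eval_hom fps_const X h = 0" using less(2) unfolding g e.mult by simp
  then have h: "poly_eval_hom fps_const X h = 0" using assms(2) by simp
  have "degree h < degree g" if "h \<noteq> 0" unfolding g using that by (subst degree_mult_eq) auto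
  then have "h = 0" using less(1) h by blast
  then show ?case using g by simp
qed

text \<open>With \<open>Y = E4 / E6\<close>, homogeneity gives \<open>f(E4, E6) Y\<^sup>w\<^sup>/\<^sup>2 = f(X, X)\<close> for
  \<open>X = E4\<^sup>3 / E6\<^sup>2\<close>; distinct monomials of equal weight have distinct total degrees.\<close>

lemma wt_hom_qexp2_inj:
  fixes f :: "'k::field poly poly"
  assumes f: "wt_hom w f" "qexp2 f = 0" and char: "(1728 :: 'k) \<noteq> 0"
  shows "f = 0"
proof (rule ccontr)
  assume "f \<noteq> 0"
  define a where "a b c = coeff (coeff f c) b" for b c
  define B where "B = Max ((\<lambda>c. degree (coeff f c)) ` {..degree f})"
  have B: "degree (coeff f c) \<le> B" for c
  proof (cases "c \<le> degree f")
    case True then show ?thesis unfolding B_def by (intro Max_ge) auto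
  next
    case False then show ?thesis by (simp add: coeff_eq_0)
  qed
  define Y where "Y = E4 * inverse (E6 :: 'k fps)"
  define X where "X = E4 * Y ^ 2"
  have E6Y: "E6 * Y = E4"
  proof -
    have "E6 * inverse (E6 :: 'k fps) = 1" by (rule inverse_mult_eq_1') (simp add: eis_nth)
    then show ?thesis unfolding Y_def by (simp add: mult.left_commute)
  qed
  have X': "X = E6 * Y ^ 3" unfolding X_def E6Y[symmetric] by (simp add: power2_eq_square power3_eq_cube mult_ac)
  have "fps_nth X 0 = 1" by (simp add: X_def Y_def power2_eq_square eis_nth)
  \<comment> \<open>\<open>X = 1\<close> would mean \<open>E4^3 = E6^2\<close>, contradicting the
    coefficient \<open>- 1728\<close> of \<open>delta_fps\<close>; this is where the characteristic
    enters.\<close>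
  moreover have "X \<noteq> 1"
  proof
    assume "X = 1"
    then have "E4 * Y ^ 2 = 1" by (simp only: X_def)
    moreover have "E4 * (E6 * Y) ^ 2 = E6 ^ 2 * (E4 * Y ^ 2)" by (simp only: power_mult_distrib mult_ac)
    ultimately have "E4 * (E6 * Y) ^ 2 = E6 ^ 2" by (simp only: mult_1_right)
    then have "delta_fps = (0 :: 'k fps)"
      unfolding E6Y delta_fps_def by (simp add: power2_eq_square power3_eq_cube mult_ac)
    then have "(- 1728 :: 'k) = 0" using delta_fps_nth_1[where 'a = 'k] by simp
    then show False using char by (metis neg_equal_0_iff_equal)
  qed
  moreover define g where "g = (\<Sum>c\<le>degree f. \<Sum>b\<le>B. monom (a b c) (b + c))"
  have "poly_eval_hom fps_const X g = 0"
  proof -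
    interpret e: rhom "poly_eval_hom fps_const X" by (intro rhom_poly_eval_hom rhom_fps_const)
    have m: "poly_eval_hom fps_const X (monom r n) = fps_const r * X ^ n" for r n
      by (simp add: poly_eval_hom_def map_poly_monom poly_monom)
    have q: "qexp2 f = (\<Sum>c\<le>degree f. (\<Sum>b\<le>B. fps_const (a b c) * E4 ^ b) * E6 ^ c)"
      unfolding qexp2_def a_def using B
      by (simp add: poly_eval_hom_altdef[where n = "degree f"] poly_eval_hom_altdef[where n = B])
    have "poly_eval_hom fps_const X g = (\<Sum>c\<le>degree f. \<Sum>b\<le>B. fps_const (a b c) * X ^ (b + c))"
      unfolding g_def by (simp only: e.sum m)
    also have "\<dots> = (\<Sum>c\<le>degree f. \<Sum>b\<le>B. Y ^ (w div 2) * (fps_const (a b c) * E4 ^ b * E6 ^ c))"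
    proof (intro sum.cong refl)
      fix b c
      show "fps_const (a b c) * X ^ (b + c) = Y ^ (w div 2) * (fps_const (a b c) * E4 ^ b * E6 ^ c)"
      proof (cases "a b c = 0")
        case False
        then have "4 * b + 6 * c = w" using f(1) by (simp add: wt_hom_def a_def)
        then have w: "w div 2 = 2 * b + 3 * c" by auto
        have "X ^ (b + c) = (E4 * Y ^ 2) ^ b * (E6 * Y ^ 3) ^ c"
          by (simp only: power_add X_def[symmetric] X'[symmetric])
        moreover have "Y ^ (2 * b + 3 * c) = (Y ^ 2) ^ b * (Y ^ 3) ^ c" by (simp only: power_add power_mult)
        ultimately show ?thesis unfolding w by (simp only: power_mult_distrib mult_ac)
      qed simp
    qed
    also have "\<dots> = Y ^ (w div 2) * qexp2 f"
      unfolding q by (simp only: sum_distrib_left sum_distrib_right mult.assoc)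
    finally show ?thesis using f(2) by simp
  qed
  ultimately have g: "g = 0" using fps_transcendental by blast
  obtain b0 c0 where a0: "a b0 c0 \<noteq> 0"
    using \<open>f \<noteq> 0\<close> unfolding a_def by (metis leading_coeff_0_iff)
  then have le: "c0 \<le> degree f" "b0 \<le> B"
    using B[of c0] unfolding a_def by (metis coeff_0 le_degree, meson le_degree order.trans)
  have "coeff g (b0 + c0) = (\<Sum>c\<le>degree f. \<Sum>b\<le>B. if b = b0 \<and> c = c0 then a b0 c0 else 0)"
    unfolding g_def coeff_sum coeff_monom
  proof (intro sum.cong refl)
    fix b c
    show "(if b + c = b0 + c0 then a b c else 0) = (if b = b0 \<and> c = c0 then a b0 c0 else 0)"
    proof (cases "b + c = b0 + c0 \<and> a b c \<noteq> 0")
      case True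
      then have "4 * b + 6 * c = 4 * b0 + 6 * c0" using f(1) a0 by (simp add: wt_hom_def a_def)
      then have "b = b0 \<and> c = c0" using True by linarith
      then show ?thesis by auto
    qed (use a0 in auto)
  qed
  also have "\<dots> = (\<Sum>c\<le>degree f. if c = c0 then a b0 c0 else 0)"
    using le by (intro sum.cong refl) (auto simp: sum.delta)
  also have "\<dots> = a b0 c0" using le by simp
  finally show False using a0 g by simp
qed

section \<open>Congruences for Bernoulli numbers\<close>

locale prime_ge_5 =
  fixes p :: nat
  assumes p: "prime p" "p \<ge> 5"
begin

text \<open>Membership in the localization of the integers at \<open>p\<close>; the fraction need
  not be in lowest terms, which keeps the closure proofs free of gcd arguments.\<close>

definition pint :: "rat \<Rightarrow> bool" where
  "pint r \<longleftrightarrow> (\<exists>a b. \<not> int p dvd b \<and> r * of_int b = of_int a)"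

lemma prime_int_p: "prime (int p)" using p(1) by simp

lemma pint_of_int: "pint (of_int a)"
  unfolding pint_def by (rule exI[of _ a], rule exI[of _ 1]) (use p in auto)

lemma pint_of_nat: "pint (of_nat a)"
  using pint_of_int[of "int a"] by simp

lemma pint_numeral: "pint (numeral k)" and pint_0: "pint 0" and pint_1: "pint 1"
  using pint_of_nat[of "numeral k"] pint_of_nat[of 0] pint_of_nat[of 1] by simp_all

lemma pint_add: assumes "pint r" "pint s" shows "pint (r + s)"
proof -
  obtain a b c d where *: "\<not> int p dvd b" "r * of_int b = of_int a" "\<not> int p dvd d" "s * of_int d = of_int c"
    using assms unfolding pint_def by blast
  have "(r + s) * of_int (b * d) = (r * of_int b) * of_int d + (s * of_int d) * of_int b"
    by (simp add: algebra_simps)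
  also have "\<dots> = of_int (a * d + c * b)" by (simp add: *)
  finally show ?thesis unfolding pint_def using * prime_int_p prime_dvd_mult_iff by blast
qed

lemma pint_mult: assumes "pint r" "pint s" shows "pint (r * s)"
proof -
  obtain a b c d where *: "\<not> int p dvd b" "r * of_int b = of_int a" "\<not> int p dvd d" "s * of_int d = of_int c"
    using assms unfolding pint_def by blast
  have "(r * s) * of_int (b * d) = (r * of_int b) * (s * of_int d)" by (simp add: algebra_simps)
  also have "\<dots> = of_int (a * c)" by (simp add: *)
  finally show ?thesis unfolding pint_def using * prime_int_p prime_dvd_mult_iff by blast
qed

lemma pint_minus: "pint r \<Longrightarrow> pint (- r)"
  using pint_mult[OF pint_of_int[of "-1"]] by simp

lemma pint_diff: "pint r \<Longrightarrow> pint s \<Longrightarrow> pint (r - s)"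
  using pint_add[OF _ pint_minus] by fastforce

lemma pint_sum: "(\<And>i. i \<in> A \<Longrightarrow> pint (f i)) \<Longrightarrow> pint (sum f A)"
  by (induction A rule: infinite_finite_induct) (auto simp: pint_0 pint_add)

lemma pint_divide_int: 
  assumes "pint r" "\<not> int p dvd n" shows "pint (r / of_int n)"
proof -
  have "n \<noteq> 0" using assms by auto
  then have "pint (1 / of_int n)" unfolding pint_def using assms(2) by (intro exI[of _ 1] exI[of _ n]) auto
  from pint_mult[OF assms(1) this] show ?thesis by simp
qed

text \<open>A number congruent modulo \<open>p\<close> to an integer prime to \<open>p\<close> is a
  unit of the local ring.\<close>

lemma pint_divide_unit:
  assumes "pint r" "pint s" "\<not> int p dvd c" shows "pint (r / (of_int c + of_nat p * s))"
proof -
  obtain a b where s: "\<not> int p dvd b" "s * of_int b = of_int a" using assms unfolding pint_def by blast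
  have n: "\<not> int p dvd (c * b + int p * a)"
    using s(1) assms(3) by (simp add: dvd_add_left_iff prime_dvd_mult_iff[OF prime_int_p])
  have b: "of_int b \<noteq> (0::rat)" using s(1) by auto
  have "of_int (c * b + int p * a) = (of_int c + of_nat p * s) * (of_int b :: rat)"
    using s(2) by (simp add: algebra_simps)
  then have "r / (of_int c + of_nat p * s) = (r * of_int b) / of_int (c * b + int p * a)" using b by simp
  then show ?thesis using pint_divide_int[OF pint_mult[OF assms(1) pint_of_int] n] by simp
qed

lemma not_p_dvd: "0 < n \<Longrightarrow> n < int p \<Longrightarrow> \<not> int p dvd n"
  using zdvd_imp_le by force

definition pdvd :: "rat \<Rightarrow> bool" where "pdvd r \<longleftrightarrow> (\<exists>s. pint s \<and> r = of_nat p * s)"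

lemma pdvdI: "pint s \<Longrightarrow> pdvd (of_nat p * s)"
  unfolding pdvd_def by blast

lemma pdvd_mult: "pdvd r \<Longrightarrow> pint s \<Longrightarrow> pdvd (s * r)"
  unfolding pdvd_def by (metis mult.left_commute pint_mult)

lemma pdvd_add: "pdvd r \<Longrightarrow> pdvd s \<Longrightarrow> pdvd (r + s)"
  unfolding pdvd_def by (metis distrib_left pint_add)

lemma pdvd_sum: "(\<And>i. i \<in> A \<Longrightarrow> pdvd (f i)) \<Longrightarrow> pdvd (sum f A)"
proof (induction A rule: infinite_finite_induct)
  case (infinite A) then show ?case using pdvdI[OF pint_0] by simp
next
  case empty then show ?case using pdvdI[OF pint_0] by simp
next
  case (insert x A) then show ?case by (simp add: pdvd_add)
qed

lemma pdvd_of_int_iff: "pdvd (of_int a) \<longleftrightarrow> int p dvd a"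
proof
  assume "pdvd (of_int a)"
  then obtain s where "pint s" and a: "of_int a = of_nat p * s" unfolding pdvd_def by blast
  then obtain n d where "\<not> int p dvd d" "s * of_int d = of_int n" unfolding pint_def by blast
  note s = a this
  then have "of_int (a * d) = (of_int (int p * n) :: rat)" by (simp add: mult.assoc)
  then have "a * d = int p * n" by (simp only: of_int_eq_iff)
  then show "int p dvd a" using s(2) prime_dvd_mult_iff[OF prime_int_p, of a d] by auto
next
  assume "int p dvd a"
  then obtain k where "a = int p * k" by auto
  then show "pdvd (of_int a)" using pdvdI[OF pint_of_int[of k]] by simp
qed

text \<open>The prime divides \<open>n!\<close> but neither \<open>k!\<close> nor
  \<open>(n - k)!\<close>. The cases used are \<open>n = p\<close> and
  \<open>n = p + 2\<close>.\<close>

lemma p_dvd_choose: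
  assumes "k < p" "n - k < p" "p \<le> n" shows "p dvd (n choose k)"
proof -
  have "p dvd fact n" using p assms by (intro dvd_fact) auto
  then have "p dvd fact k * fact (n - k) * (n choose k)"
    using assms by (subst binomial_fact_lemma) auto
  moreover have "\<not> p dvd fact k" "\<not> p dvd fact (n - k)"
    using assms p by (auto simp: prime_dvd_fact_iff)
  ultimately show ?thesis using p(1) by (simp add: prime_dvd_mult_iff)
qed

lemma fermat_int: "int p dvd int d ^ p - int d"
proof (induction d)
  case 0 then show ?case using p by (simp add: power_0_left)
next
  case (Suc d)
  have "{..p} = insert 0 (insert p {0<..<p})" using p by auto
  then have "(int d + 1) ^ p = 1 + int d ^ p + (\<Sum>k\<in>{0<..<p}. int (p choose k) * int d ^ k)"
    using p by (simp add: binomial_ring)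
  then have eq: "int (Suc d) ^ p - int (Suc d) = (int d ^ p - int d) + (\<Sum>k\<in>{0<..<p}. int (p choose k) * int d ^ k)"
    by (simp add: add.commute)
  have "int p dvd (\<Sum>k\<in>{0<..<p}. int (p choose k) * int d ^ k)"
    using p_dvd_choose[of _ p] by (intro dvd_sum dvd_mult2) auto
  then show ?case unfolding eq using Suc by simp
qed

lemma bernoulli_num_pint: "n < p - 1 \<Longrightarrow> pint (bernoulli_num n)"
proof (induction n rule: less_induct)
  case (less n)
  show ?case
  proof (cases "n = 0")
    case True then show ?thesis by (simp add: bernoulli_num_0 pint_1)
  next
    case False
    have "bernoulli_num n = - (\<Sum>k<n. of_nat ((n + 1) choose k) * bernoulli_num k) / of_int (int n + 1)"
      using bernoulli_num_rec[of n] False by (simp add: field_simps)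
    moreover have "pint \<dots>"
      using less by (intro pint_divide_int pint_minus pint_sum pint_mult pint_of_nat not_p_dvd) auto
    ultimately show ?thesis by simp
  qed
qed

text \<open>The von Staudt-Clausen congruence at index \<open>p - 1\<close>. In the recurrence all
  terms except \<open>k = 0\<close> have a binomial coefficient divisible by \<open>p\<close> and a
  p-integral Bernoulli number.\<close>

lemma bernoulli_num_p_minus_1: "\<exists>u. pint u \<and> of_nat p * bernoulli_num (p - 1) = of_nat p * u - 1"
proof -
  have "pdvd (\<Sum>k\<in>{0<..<p - 1}. of_nat (p choose k) * bernoulli_num k)"
  proof (intro pdvd_sum)
    fix k assume k: "k \<in> {0<..<p - 1}"
    then have "p dvd (p choose k)" by (intro p_dvd_choose) auto
    then have "pdvd (of_nat (p choose k))" using pdvd_of_int_iff[of "int (p choose k)"] by simp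
    then show "pdvd (of_nat (p choose k) * bernoulli_num k)"
      using pdvd_mult bernoulli_num_pint[of k] k by (subst mult.commute) auto
  qed
  then obtain u where u: "pint u" "(\<Sum>k\<in>{0<..<p - 1}. of_nat (p choose k) * bernoulli_num k) = of_nat p * u"
    unfolding pdvd_def by blast
  have "of_nat p * bernoulli_num (p - 1) = - (\<Sum>k<p - 1. of_nat (p choose k) * bernoulli_num k)"
    using bernoulli_num_rec[of "p - 1"] p by simp
  also have "{..<p - 1} = insert 0 {0<..<p - 1}" using p by auto
  also have "- (\<Sum>k\<in>insert 0 {0<..<p - 1}. of_nat (p choose k) * bernoulli_num k) = of_nat p * (- u) - 1"
    by (subst sum.insert) (auto simp: bernoulli_num_0 u(2) simp del: One_nat_def)
  finally show ?thesis using pint_minus[OF u(1)] by blast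
qed

end

text \<open>For odd \<open>m\<close> one of \<open>j\<close> and \<open>m - 2 - j\<close> is odd, so
  the quadratic part vanishes by induction; the factor \<open>(m - 4) (m + 3)\<close> is nonzero, as
  its only natural root is even. The constant terms give the vanishing of the odd Bernoulli
  numbers.\<close>

lemma wp_series_odd: "odd m \<Longrightarrow> wp_series m = 0"
proof (induction m rule: less_induct)
  case (less m)
  show ?case
  proof (cases "m < 2")
    case True then show ?thesis by (rule wp_series_lt_2)
  next
    case False
    have "wp_series j * wp_series (m - 2 - j) = 0" if "j \<le> m - 2" for j
    proof (cases "odd j")
      case True then show ?thesis using less that False by simp
    next
      case False': False
      have "odd (m - 2 - j)" using less(2) False' that False by simp
      then show ?thesis using less(1)[of "m - 2 - j"] False by simp
    qed
    then have "(\<Sum>j\<le>m - 2. wp_series j * wp_series (m - 2 - j)) = 0" by (intro sum.neutral) simp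
    moreover have "m \<ge> 2" "m \<noteq> 2" using False less(2) by auto
    ultimately have "fps_const (of_nat m * (of_nat m - 1) - 12 :: rat) * wp_series m = 0"
      using wp_series_rec[of m] by (simp only: if_False mult_zero_right add_0)
    moreover have "(of_nat m * (of_nat m - 1) - 12 :: rat) \<noteq> 0"
    proof
      assume "(of_nat m * (of_nat m - 1) - 12 :: rat) = 0"
      then have "(of_nat m - 4) * (of_nat m + 3) = (0 :: rat)" by (simp add: algebra_simps)
      then have "of_nat m = (4 :: rat)" using of_nat_0_le_iff[of m, where 'a = rat] by auto
      then have "m = 4" using of_nat_eq_iff[of m 4, where 'a = rat] by simp
      then show False using less(2) by simp
    qed
    ultimately show ?thesis by simp
  qed
qed

lemma bernoulli_num_odd: "odd n \<Longrightarrow> n \<ge> 3 \<Longrightarrow> bernoulli_num n = 0"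
proof -
  assume n: "odd n" "n \<ge> 3"
  define m where "m = n - 2"
  have m: "n = m + 2" "m > 0" "odd m" using n by (auto simp: m_def)
  have "fps_nth (wp_series m) 0 = 0" using wp_series_odd[OF m(3)] by simp
  then have "of_nat (m + 1) * bernoulli_num (m + 2) / fact (m + 2) = 0"
    unfolding wp_series_nth[OF m(2)] by simp
  then show ?thesis unfolding m(1) by (simp del: of_nat_Suc of_nat_add fact_Suc)
qed

section \<open>Congruences for the Eisenstein series of weights \<open>p - 1\<close> and
  \<open>p + 1\<close>\<close>

context prime_ge_5
begin

lemma p_odd: "odd p" using p prime_odd_nat by auto

text \<open>An instance of Kummer's congruence. Modulo \<open>p\<close> only the indices 0, 1, 2 and
  \<open>p - 1\<close> contribute to the recurrence, which becomes
  \<open>2 B = - (1/6 - 1/3)\<close> for \<open>B = bernoulli_num (p + 1)\<close>.\<close>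

lemma bernoulli_num_p_plus_1: "\<exists>t. pint t \<and> 12 * bernoulli_num (p + 1) = 1 + of_nat p * t"
proof -
  let ?B = "bernoulli_num" and ?p = "of_nat p :: rat"
  obtain u where u: "pint u" "?p * ?B (p - 1) = ?p * u - 1" using bernoulli_num_p_minus_1 by blast
  have "pdvd (\<Sum>k\<in>{3..p - 2}. of_nat ((p + 2) choose k) * ?B k)"
  proof (intro pdvd_sum)
    fix k assume k: "k \<in> {3..p - 2}"
    then have "p dvd ((p + 2) choose k)" by (intro p_dvd_choose) auto
    then have "pdvd (of_nat ((p + 2) choose k))" using pdvd_of_int_iff[of "int ((p + 2) choose k)"] by simp
    then show "pdvd (of_nat ((p + 2) choose k) * ?B k)"
      using pdvd_mult bernoulli_num_pint[of k] k by (subst mult.commute) auto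
  qed
  then obtain v where v: "pint v" "(\<Sum>k\<in>{3..p - 2}. of_nat ((p + 2) choose k) * ?B k) = ?p * v"
    unfolding pdvd_def by blast
  \<comment> \<open>Index \<open>p - 1\<close> is the only one in the recurrence with a
    \<open>p\<close> in the denominator; the factor \<open>p\<close> of the binomial coefficient
    \<open>(p + 2) choose 3\<close> compensates for it.\<close>
  have sub: "(p + 2) choose (p - 1) = (p + 2) choose 3" "(p + 2) choose p = (p + 2) choose 2"
    using binomial_symmetric[of "p - 1" "p + 2"] binomial_symmetric[of p "p + 2"] p by auto
  have c2: "of_nat ((p + 2) choose 2) = (?p + 2) * (?p + 1) / 2"
    by (simp add: binomial_gbinomial gbinomial_prod_rev eval_nat_numeral field_simps)
  have c3: "of_nat ((p + 2) choose 3) = (?p + 2) * (?p + 1) * ?p / 6"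
    by (simp add: binomial_gbinomial gbinomial_prod_rev eval_nat_numeral field_simps)
  have "{..<p + 1} = {0, 1, 2} \<union> {3..p - 2} \<union> {p - 1, p}" using p by auto
  then have "(\<Sum>k<p + 1. of_nat ((p + 2) choose k) * ?B k) =
      (\<Sum>k\<in>{0, 1, 2} \<union> {3..p - 2} \<union> {p - 1, p}. of_nat ((p + 2) choose k) * ?B k)" by simp
  also have "\<dots> = (\<Sum>k\<in>{0, 1, 2}. of_nat ((p + 2) choose k) * ?B k) + ?p * v
      + (\<Sum>k\<in>{p - 1, p}. of_nat ((p + 2) choose k) * ?B k)"
    unfolding v(2)[symmetric] using p by (subst sum.union_disjoint; (subst sum.union_disjoint)?) auto
  also have "(\<Sum>k\<in>{0, 1, 2}. of_nat ((p + 2) choose k) * ?B k) = 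
      1 - (?p + 2) / 2 + (?p + 2) * (?p + 1) / 12"
  proof -
    have sum3: "(\<Sum>k\<in>{0, 1, 2::nat}. f k) = f 0 + f 1 + f 2" for f :: "nat \<Rightarrow> rat"
      by (simp add: add.assoc)
    show ?thesis unfolding sum3 bernoulli_num_0 bernoulli_num_1 bernoulli_num_2 c2 by simp
  qed
  also have "(\<Sum>k\<in>{p - 1, p}. of_nat ((p + 2) choose k) * ?B k) = (?p + 2) * (?p + 1) / 6 * (?p * ?B (p - 1))"
  proof -
    have "(\<Sum>k\<in>{p - 1, p}. f k) = f (p - 1) + f p" for f :: "nat \<Rightarrow> rat"
      using p by (subst sum.insert) auto
    moreover have "?B p = 0" using p p_odd by (intro bernoulli_num_odd) auto
    ultimately show ?thesis by (simp only: sub c3) simp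
  qed
  finally have sum: "(\<Sum>k<p + 1. of_nat ((p + 2) choose k) * ?B k) =
     1 - (?p + 2) / 2 + (?p + 2) * (?p + 1) / 12 + ?p * v + (?p + 2) * (?p + 1) / 6 * (?p * u - 1)"
    unfolding u(2) .
  have rec: "(?p + 2) * ?B (p + 1) = - (1 - (?p + 2) / 2 + (?p + 2) * (?p + 1) / 12 + ?p * v + (?p + 2) * (?p + 1) / 6 * (?p * u - 1))"
    using bernoulli_num_rec[of "p + 1"] unfolding sum[symmetric] by (simp add: add_ac)
  \<comment> \<open>Integrality comes first because the witness \<open>?t\<close> below itself
    contains \<open>?B (p + 1)\<close>.\<close>
  have pB: "pint (?B (p + 1))"
  proof -
    let ?r = "- (1 - (?p + 2) / of_int 2 + (?p + 2) * (?p + 1) / of_int (2 * 6) + ?p * v + (?p + 2) * (?p + 1) / of_int 6 * (?p * u - 1))"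
    have n: "\<not> int p dvd 2" "\<not> int p dvd 6" "\<not> int p dvd 2 * 6"
    proof -
      show 2: "\<not> int p dvd 2" using p by (intro not_p_dvd) auto
      have "\<not> int p dvd 3" using p by (intro not_p_dvd) auto
      then have "\<not> int p dvd 2 * 3" using 2 prime_dvd_mult_iff[OF prime_int_p] by blast
      then show 6: "\<not> int p dvd 6" by simp
      show "\<not> int p dvd 2 * 6" using 2 6 prime_dvd_mult_iff[OF prime_int_p] by blast
    qed
    have "pint ?r"
      by (intro pint_add pint_minus pint_diff pint_mult pint_divide_int n pint_1 pint_numeral pint_of_nat u v)
    then have "pint (?r / (of_int 2 + of_nat p * 1))" by (rule pint_divide_unit[OF _ pint_1 n(1)])
    moreover have "?B (p + 1) = ?r / (of_int 2 + of_nat p * 1)"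
    proof -
      have "?p + 2 \<noteq> 0" using of_nat_0_le_iff[of p, where 'a = rat] by linarith
      then have "?B (p + 1) = ((?p + 2) * ?B (p + 1)) / (?p + 2)" by simp
      then show ?thesis unfolding rec by (simp add: add.commute)
    qed
    ultimately show ?thesis by simp
  qed
  let ?t = "(- 12 * ?B (p + 1) + 9 + ?p - 12 * v - 2 * (?p * ?p + 3 * ?p + 2) * u) / of_int 2"
  have "\<not> int p dvd 2" using p by (intro not_p_dvd) auto
  then have "pint ?t"
    by (intro pint_divide_int pint_add pint_diff pint_mult pint_minus pint_numeral pint_of_nat u v pB)
  moreover have "12 * ?B (p + 1) = 1 + ?p * ?t" using rec by (simp add: field_simps)
  ultimately show ?thesis by blast
qed

lemma bernoulli_num_nonzero: "bernoulli_num (p - 1) \<noteq> 0" "bernoulli_num (p + 1) \<noteq> 0"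
proof -
  have *: "\<not> pdvd (of_int 1)" using pdvd_of_int_iff[of 1] p by simp
  show "bernoulli_num (p - 1) \<noteq> 0"
    using bernoulli_num_p_minus_1 * by (auto simp: pdvd_def)
  show "bernoulli_num (p + 1) \<noteq> 0"
  proof
    assume "bernoulli_num (p + 1) = 0"
    then obtain t where t: "pint t" "0 = 1 + of_nat p * t" using bernoulli_num_p_plus_1 by auto
    then have "of_int 1 = of_nat p * (- t)" by simp
    then show False using * pdvdI[OF pint_minus[OF t(1)]] by simp
  qed
qed

text \<open>The factor \<open>2 w / B_w\<close> at \<open>w = p - 1\<close> equals
  \<open>2 p (p - 1) / (p B_w)\<close>, whose denominator is congruent to
  \<open>- 1\<close>.\<close>

lemma eisenstein_p_minus_1: "pdvd (fps_nth (eisenstein (p - 1)) n - of_int (fps_nth 1 n))"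
proof (cases "n = 0")
  case True then show ?thesis using pdvdI[OF pint_0] by (simp add: eisenstein_nth)
next
  case False
  obtain u where u: "pint u" "of_nat p * bernoulli_num (p - 1) = of_nat p * u - 1" using bernoulli_num_p_minus_1 by blast
  let ?s = "\<Sum>d | d dvd n. of_nat d ^ (p - 1 - 1) :: rat"
  have "bernoulli_num (p - 1) = (of_int (-1) + of_nat p * u) / of_nat p" using u(2) p by (simp add: field_simps)
  then have eq: "fps_nth (eisenstein (p - 1)) n - of_int (fps_nth 1 n) = of_nat p * ((- (2 * of_nat (p - 1) * ?s)) / (of_int (-1) + of_nat p * u))"
    using False by (simp add: eisenstein_nth)
  have "\<not> int p dvd - 1" using p by simp
  then have "pint ((- (2 * of_nat (p - 1) * ?s)) / (of_int (-1) + of_nat p * u))"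
    unfolding of_nat_power[symmetric]
    by (intro pint_divide_unit u pint_minus pint_mult pint_sum pint_of_nat pint_numeral)
  then show ?thesis unfolding eq by (rule pdvdI)
qed

text \<open>Since \<open>12 B_(p+1)\<close> is congruent to 1, the leading factor is congruent to
  \<open>- 24\<close>; Fermat's little theorem replaces \<open>d^p\<close> by \<open>d\<close> in
  the divisor sum.\<close>

lemma eisenstein_p_plus_1: "pdvd (fps_nth (eisenstein (p + 1)) n - of_int (fps_nth E2 n))"
proof (cases "n = 0")
  case True then show ?thesis using pdvdI[OF pint_0] by (simp add: eisenstein_nth eis_nth)
next
  case False
  obtain t where t: "pint t" "12 * bernoulli_num (p + 1) = 1 + of_nat p * t" using bernoulli_num_p_plus_1 by blast
  define s1 where "s1 = (\<Sum>d | d dvd n. int d)"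
  define sp where "sp = (\<Sum>d | d dvd n. int d ^ p)"
  have "int p dvd sp - s1"
    unfolding sp_def s1_def sum_subtractf[symmetric]
  proof (rule dvd_sum)
    fix d
    show "int p dvd int d ^ p - int d" by (rule fermat_int)
  qed
  then obtain m where m: "sp = s1 + int p * m" by (metis add_diff_cancel_left' diff_add_cancel dvdE add.commute)
  define e where "e = of_int 1 + of_nat p * t"
  have e: "bernoulli_num (p + 1) = e / 12" using t(2) by (simp add: e_def)
  have e0: "e \<noteq> 0" using e bernoulli_num_nonzero(2) by auto
  have "fps_nth (eisenstein (p + 1)) n = - 24 * (of_nat p + 1) * of_int sp / e"
    unfolding eisenstein_nth e using False by (simp add: sp_def) (simp add: field_simps e0)
  then have "fps_nth (eisenstein (p + 1)) n - of_int (fps_nth E2 n) = - 24 * (of_nat p + 1) * of_int sp / e + 24 * of_int s1"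
    using False by (simp add: eis_nth s1_def)
  also have "\<dots> = of_nat p * ((- 24 * (of_int sp + of_int m - t * of_int s1)) / e)"
    using e0 by (simp add: field_simps m) (simp add: e_def algebra_simps)
  finally show ?thesis
  proof (rule ssubst)
    have "\<not> int p dvd 1" using p by simp
    then show "pdvd (of_nat p * ((- 24 * (of_int sp + of_int m - t * of_int s1)) / e))"
      unfolding e_def by (intro pdvdI pint_divide_unit t pint_mult pint_minus pint_numeral pint_add pint_diff pint_of_int)
  qed
qed

end

section \<open>Reduction modulo \<open>p\<close>\<close>

lemma ex_common_denominator:
  "\<exists>D>0. \<forall>j. of_int D * coeff (q :: rat poly) j \<in> \<int>"
proof (induction q)
  case 0 then show ?case by (intro exI[of _ 1]) auto
next
  case (pCons c q)
  then obtain D where D: "D > 0" "\<And>j. of_int D * coeff q j \<in> \<int>" by blast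
  obtain n d where c: "quotient_of c = (n, d)" by force
  then have d: "d > 0" "c = of_int n / of_int d" using quotient_of_denom_pos quotient_of_div by blast+
  have "of_int (d * D) * coeff (pCons c q) j \<in> \<int>" for j
  proof (cases j)
    case 0
    have "of_int (d * D) * c = of_int (D * n)" using d by (simp add: mult.commute)
    then show ?thesis using 0 by (simp del: of_int_mult)
  next
    case (Suc i)
    have "of_int (d * D) * coeff q i = of_int d * (of_int D * coeff q i)" by (simp add: mult.assoc)
    then show ?thesis using D(2)[of i] Suc by (metis Ints_mult Ints_of_int coeff_pCons_Suc)
  qed
  then show ?case using D d by (intro exI[of _ "d * D"]) auto
qed

lemma ex_common_denominator2:
  "\<exists>D>0. \<forall>i j. of_int D * coeff (coeff (Q :: rat poly poly) i) j \<in> \<int>"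
proof (induction Q)
  case 0 then show ?case by (intro exI[of _ 1]) auto
next
  case (pCons q Q)
  then obtain D where D: "D > 0" "\<And>i j. of_int D * coeff (coeff Q i) j \<in> \<int>" by blast
  obtain d where d: "d > 0" "\<And>j. of_int d * coeff q j \<in> \<int>" using ex_common_denominator by blast
  have "of_int (d * D) * coeff (coeff (pCons q Q) i) j \<in> \<int>" for i j
  proof (cases i)
    case 0
    have "of_int (d * D) * coeff q j = of_int D * (of_int d * coeff q j)" by simp
    then show ?thesis using 0 d(2)[of j] by (metis Ints_mult Ints_of_int coeff_pCons_0)
  next
    case (Suc i)
    have "of_int (d * D) * coeff (coeff Q i) j = of_int d * (of_int D * coeff (coeff Q i) j)" by simp
    then show ?thesis using D(2)[of i j] Suc by (metis Ints_mult Ints_of_int coeff_pCons_Suc)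
  qed
  then show ?case using D d by (intro exI[of _ "d * D"]) auto
qed

lemma red_rat_0: "red_rat 0 = 0"
  by (simp add: red_rat_def)

definition red2 :: "rat poly poly \<Rightarrow> 'k::field poly poly" where
  "red2 = map_poly (map_poly red_rat)"

lemma red2_coeff: "coeff (coeff (red2 Q) i) j = red_rat (coeff (coeff Q i) j)"
  by (simp add: red2_def coeff_map_poly red_rat_0)

lemma wt_hom_red2: "wt_hom w Q \<Longrightarrow> wt_hom w (red2 Q)"
  unfolding wt_hom_def red2_coeff by (metis red_rat_0)

locale prime_ge_5_field = prime_ge_5 +
  fixes K :: "'k::field itself"
  assumes char: "CHAR('k) = p"
begin

lemma of_int_eq_0: "(of_int a :: 'k) = 0 \<longleftrightarrow> int p dvd a"
  using of_int_eq_0_iff_char_dvd[of a, where 'a = 'k] by (simp add: char)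

lemma char_1728: "(1728 :: 'k) \<noteq> 0"
proof -
  have 2: "\<not> int p dvd 2" and 3: "\<not> int p dvd 3" by (rule not_p_dvd; use p in simp)+
  have "(1728 :: int) = 2 ^ 6 * 3 ^ 3" by simp
  then have "\<not> int p dvd 1728"
    using 2 3 prime_dvd_mult_iff[OF prime_int_p] prime_dvd_power[OF prime_int_p] by metis
  then show ?thesis using of_int_eq_0[of 1728] by simp
qed

text \<open>\<open>red_rat\<close> is not additive on all rationals, since denominators divisible by
  \<open>p\<close> become 0. It is therefore accessed only after clearing a denominator prime to
  \<open>p\<close>.\<close>

lemma red_rat_eq:
  assumes "of_int D * r = of_int a" "\<not> int p dvd D"
  shows "of_int D * red_rat r = (of_int a :: 'k)"
proof -
  obtain n d where r: "quotient_of r = (n, d)" by force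
  then have d: "d > 0" "coprime n d" "r = of_int n / of_int d"
    using quotient_of_denom_pos quotient_of_coprime quotient_of_div by blast+
  have "of_int (D * n) = (of_int (a * d) :: rat)" using assms(1) d by (simp add: field_simps)
  then have eq: "D * n = a * d" by (simp only: of_int_eq_iff)
  then have "d dvd D" using d(2) by (metis coprime_commute coprime_dvd_mult_left_iff dvd_triv_right)
  then have "\<not> int p dvd d" using assms(2) dvd_trans by blast
  then have d0: "(of_int d :: 'k) \<noteq> 0" by (simp add: of_int_eq_0)
  have "(of_int (D * n) :: 'k) = of_int (a * d)" by (simp only: eq)
  then show ?thesis using d0 by (simp add: red_rat_def r field_simps)
qed

text \<open>Take the least positive common denominator \<open>m\<close>. If \<open>p\<close> divided
  it, \<open>m Q\<close> would reduce modulo \<open>p\<close> to a homogeneous form with zero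
  q-expansion, hence to 0; then \<open>m / p\<close> would be a smaller common denominator.\<close>

lemma ex_integral_multiple:
  assumes Q: "wt_hom w Q" and z: "\<And>n. pint (fps_nth (qexp2 Q) n)"
  obtains D where "\<not> int p dvd D" "\<And>i j. of_int D * coeff (coeff Q i) j \<in> \<int>"
proof -
  define P where "P = (\<lambda>m::nat. m > 0 \<and> (\<forall>i j. of_int (int m) * coeff (coeff Q i) j \<in> \<int>))"
  obtain D0 where "D0 > 0" "\<forall>i j. of_int D0 * coeff (coeff Q i) j \<in> \<int>" using ex_common_denominator2 by blast
  then have "P (nat D0)" by (simp add: P_def)
  define m where "m = (LEAST m. P m)"
  have m: "P m" unfolding m_def by (rule LeastI) fact
  have "\<not> int p dvd int m"
  proof
    assume "int p dvd int m"
    then obtain l where l: "m = p * l" by auto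
    then have l0: "0 < l" "l < m" using m p by (auto simp: P_def)
    define Q' where "Q' = map_poly (map_poly (\<lambda>r. \<lfloor>of_nat m * r\<rfloor>)) Q"
    have Q': "coeff (coeff Q' i) j = \<lfloor>of_nat m * coeff (coeff Q i) j\<rfloor>" for i j
      by (simp add: Q'_def coeff_map_poly)
    have of_Q': "of_int (coeff (coeff Q' i) j) = of_nat m * coeff (coeff Q i) j" for i j
      using m by (auto simp: Q' P_def elim!: Ints_cases)
    interpret r: rhom "of_int :: int \<Rightarrow> rat" by (rule rhom_of_int)
    interpret k: rhom "of_int :: int \<Rightarrow> 'k" by (rule rhom_of_int)
    have "map_poly (map_poly of_int) Q' = c2 (of_nat m) * Q"
      by (intro poly_eqI) (simp add: coeff_map_poly of_Q' c2_def)
    then have "map_fps of_int (qexp2 Q') = fps_const (of_nat m) * qexp2 Q"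
      unfolding r.map_fps_qexp2 by (simp add: qexp2.mult qexp2_c2)
    then have "of_int (fps_nth (qexp2 Q') n) = of_nat m * fps_nth (qexp2 Q) n" for n
      by (metis map_fps_nth fps_mult_left_const_nth)
    then have eq: "of_int (fps_nth (qexp2 Q') n) = of_nat p * (of_nat l * fps_nth (qexp2 Q) n)" for n
      by (simp add: l)
    have "pdvd (of_int (fps_nth (qexp2 Q') n))" for n
      unfolding eq by (rule pdvdI[OF pint_mult[OF pint_of_nat z]])
    then have "(of_int (fps_nth (qexp2 Q') n) :: 'k) = 0" for n by (simp add: of_int_eq_0 pdvd_of_int_iff)
    then have "map_fps (of_int :: int \<Rightarrow> 'k) (qexp2 Q') = 0" by (simp add: fps_eq_iff)
    then have q0: "qexp2 (map_poly (map_poly (of_int :: int \<Rightarrow> 'k)) Q') = 0" by (simp only: k.map_fps_qexp2)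
    have "wt_hom w (map_poly (map_poly (of_int :: int \<Rightarrow> 'k)) Q')"
      unfolding wt_hom_def
    proof (intro allI impI)
      fix b c assume "coeff (coeff (map_poly (map_poly (of_int :: int \<Rightarrow> 'k)) Q') c) b \<noteq> 0"
      then have "coeff (coeff Q c) b \<noteq> 0" by (auto simp: coeff_map_poly Q')
      then show "4 * b + 6 * c = w" using Q by (simp add: wt_hom_def)
    qed
    then have "map_poly (map_poly (of_int :: int \<Rightarrow> 'k)) Q' = 0" by (rule wt_hom_qexp2_inj[OF _ q0 char_1728])
    then have "coeff (coeff (map_poly (map_poly (of_int :: int \<Rightarrow> 'k)) Q') i) j = 0" for i j by simp
    then have "(of_int (coeff (coeff Q' i) j) :: 'k) = 0" for i j by (simp add: coeff_map_poly)
    then have dv: "int p dvd coeff (coeff Q' i) j" for i j by (simp only: of_int_eq_0)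
    have "of_int (int l) * coeff (coeff Q i) j \<in> \<int>" for i j
    proof -
      obtain t where "coeff (coeff Q' i) j = int p * t" using dv by blast
      then have "of_nat m * coeff (coeff Q i) j = of_nat p * of_int t" using of_Q'[of i j] by simp
      then have "of_int (int l) * coeff (coeff Q i) j = of_int t" using p by (simp add: l)
      then show ?thesis by simp
    qed
    then have "P l" using l0 by (simp add: P_def)
    then show False using l0(2) not_less_Least[of l P] unfolding m_def[symmetric] by simp
  qed
  then show ?thesis using that[of "int m"] m by (simp add: P_def)
qed

lemma qexp2_red2:
  assumes Q: "wt_hom w Q" and z: "\<And>n. pdvd (fps_nth (qexp2 Q) n - of_int (fps_nth z n))"
  shows "qexp2 (red2 Q :: 'k poly poly) = map_fps of_int z"
proof -
  have "pint (fps_nth (qexp2 Q) n)" for n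
  proof -
    obtain s where "pint s" "fps_nth (qexp2 Q) n = of_nat p * s + of_int (fps_nth z n)"
      using z[of n] unfolding pdvd_def by (metis diff_add_cancel)
    then show ?thesis by (simp add: pint_add pint_mult pint_of_nat pint_of_int)
  qed
  then obtain D where D: "\<not> int p dvd D" "\<And>i j. of_int D * coeff (coeff Q i) j \<in> \<int>"
    using ex_integral_multiple[OF Q] by blast
  define Q' where "Q' = map_poly (map_poly (\<lambda>r. \<lfloor>of_int D * r\<rfloor>)) Q"
  have Q': "coeff (coeff Q' i) j = \<lfloor>of_int D * coeff (coeff Q i) j\<rfloor>" for i j
    by (simp add: Q'_def coeff_map_poly)
  have of_Q': "of_int D * coeff (coeff Q i) j = of_int (coeff (coeff Q' i) j)" for i j
    using D(2)[of i j] by (auto simp: Q' elim!: Ints_cases)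
  interpret r: rhom "of_int :: int \<Rightarrow> rat" by (rule rhom_of_int)
  interpret k: rhom "of_int :: int \<Rightarrow> 'k" by (rule rhom_of_int)
  have "map_poly (map_poly of_int) Q' = c2 (of_int D) * Q"
    by (intro poly_eqI) (simp add: coeff_map_poly of_Q' c2_def)
  then have "map_fps of_int (qexp2 Q') = fps_const (of_int D) * qexp2 Q"
    unfolding r.map_fps_qexp2 by (simp add: qexp2.mult qexp2_c2)
  then have J: "of_int (fps_nth (qexp2 Q') n) = of_int D * fps_nth (qexp2 Q) n" for n
    by (metis map_fps_nth fps_mult_left_const_nth)
  have "(of_int (fps_nth (qexp2 Q') n) :: 'k) = of_int D * of_int (fps_nth z n)" for n
  proof -
    have "pdvd (of_int D * (fps_nth (qexp2 Q) n - of_int (fps_nth z n)))"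
      by (rule pdvd_mult[OF z pint_of_int])
    also have "of_int D * (fps_nth (qexp2 Q) n - of_int (fps_nth z n)) = of_int (fps_nth (qexp2 Q') n - D * fps_nth z n)"
      by (simp add: J right_diff_distrib)
    finally have "(of_int (fps_nth (qexp2 Q') n - D * fps_nth z n) :: 'k) = 0"
      by (simp only: of_int_eq_0 pdvd_of_int_iff)
    then show ?thesis by simp
  qed
  then have "map_fps (of_int :: int \<Rightarrow> 'k) (qexp2 Q') = fps_const (of_int D) * map_fps of_int z"
    by (simp add: fps_eq_iff)
  moreover have "map_poly (map_poly (of_int :: int \<Rightarrow> 'k)) Q' = c2 (of_int D) * red2 Q"
    by (intro poly_eqI) (simp add: coeff_map_poly c2_def red2_coeff red_rat_eq[OF of_Q' D(1)])
  ultimately have "fps_const (of_int D :: 'k) * qexp2 (red2 Q) = fps_const (of_int D) * map_fps of_int z"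
    unfolding k.map_fps_qexp2 by (simp add: qexp2.mult qexp2_c2)
  moreover have "fps_const (of_int D :: 'k) \<noteq> 0" using D(1) by (simp add: of_int_eq_0)
  ultimately show ?thesis by simp
qed

lemma the_eval_E4E6:
  assumes "even w" "w \<ge> 4" "bernoulli_num w \<noteq> 0"
  shows "wt_hom w (THE Q. eval_E4E6 Q = eisenstein w)"
    and "qexp2 (THE Q. eval_E4E6 Q = eisenstein w) = eisenstein w"
proof -
  obtain Q where Q: "wt_hom w Q" "qexp2 Q = eisenstein w"
    using mod_form_eisenstein[OF assms] unfolding mod_form_def by blast
  have "(THE Q. eval_E4E6 Q = eisenstein w) = Q"
  proof (rule the_equality)
    show "eval_E4E6 Q = eisenstein w" by (simp add: eval_E4E6_eq Q)
    fix Q' assume "eval_E4E6 Q' = eisenstein w"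
    then have "qexp2 (Q' - Q) = 0" by (simp add: eval_E4E6_eq qexp2.diff Q)
    then show "Q' = Q" using qexp2_rat_inj by fastforce
  qed
  then show "wt_hom w (THE Q. eval_E4E6 Q = eisenstein w)" "qexp2 (THE Q. eval_E4E6 Q = eisenstein w) = eisenstein w"
    using Q by simp_all
qed

lemma red2_polyA: "wt_hom (p - 1) (red2 (polyA p) :: 'k poly poly)" "qexp2 (red2 (polyA p) :: 'k poly poly) = 1"
  and red2_polyB: "wt_hom (p + 1) (red2 (polyB p) :: 'k poly poly)" "qexp2 (red2 (polyB p) :: 'k poly poly) = E2"
proof -
  have "even (p - 1)" "p - 1 \<ge> 4" "even (p + 1)" "p + 1 \<ge> 4" using p_odd p by auto
  note A = the_eval_E4E6[OF this(1,2) bernoulli_num_nonzero(1), folded polyA_def]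
    and B = the_eval_E4E6[OF this(3,4) bernoulli_num_nonzero(2), folded polyB_def]
  interpret k: rhom "of_int :: int \<Rightarrow> 'k" by (rule rhom_of_int)
  interpret kf: rhom "map_fps (of_int :: int \<Rightarrow> 'k)" by (rule k.map_fps)
  show "wt_hom (p - 1) (red2 (polyA p) :: 'k poly poly)" "wt_hom (p + 1) (red2 (polyB p) :: 'k poly poly)"
    using A(1) B(1) by (auto intro: wt_hom_red2)
  show "qexp2 (red2 (polyA p) :: 'k poly poly) = 1"
    using qexp2_red2[OF A(1), of 1] eisenstein_p_minus_1 by (simp add: A(2) kf.one del: fps_one_nth)
  show "qexp2 (red2 (polyB p) :: 'k poly poly) = E2"
    using qexp2_red2[OF B(1), of E2] eisenstein_p_plus_1 by (simp add: B(2) k.map_fps_eis)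
qed

end

section \<open>Derivations of \<open>k[e\<^sub>2, e\<^sub>4, e\<^sub>6]\<close>\<close>

locale derivation =
  fixes D :: "'a::comm_ring_1 \<Rightarrow> 'a"
  assumes add: "D (f + g) = D f + D g" and mult: "D (f * g) = D f * g + f * D g"
begin

lemma zero: "D 0 = 0"
  using add[of 0 0] by simp

lemma minus: "D (- f) = - D f"
  using add[of f "- f"] by (simp add: zero minus_unique)

lemma diff: "D (f - g) = D f - D g"
  using add[of f "- g"] by (simp add: minus)

lemma one: "D 1 = 0"
  using mult[of 1 1] by simp

lemma of_nat: "D (of_nat n) = 0"
  by (induction n) (auto simp: zero one add)

lemma numeral: "D (numeral n) = 0"
  using of_nat[of "numeral n"] by simp

lemma power2: "D (f ^ 2) = 2 * f * D f"
  by (simp add: power2_eq_square mult algebra_simps)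

lemma sum: "D (sum f A) = (\<Sum>a\<in>A. D (f a))"
  by (induction A rule: infinite_finite_induct) (auto simp: zero add)

lemma map_poly: "derivation (map_poly D)"
  by unfold_locales (rule poly_eqI; simp add: coeff_map_poly zero add coeff_mult sum mult sum.distrib)+

lemma funpow_zero: "(D ^^ n) 0 = 0"
  by (induction n) (auto simp: zero)

lemma funpow_add: "(D ^^ n) (f + g) = (D ^^ n) f + (D ^^ n) g"
  by (induction n) (auto simp: add)

lemma leibniz: "(D ^^ n) (f * g) = (\<Sum>i\<le>n. of_nat (n choose i) * ((D ^^ i) f * (D ^^ (n - i)) g))"
proof (induction n)
  case 0 then show ?case by simp
next
  case (Suc n)
  define t where "t i = (D ^^ i) f * (D ^^ (Suc n - i)) g" for i
  have "(D ^^ Suc n) (f * g) = (\<Sum>i\<le>n. of_nat (n choose i) * (t (Suc i) + t i))"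
    unfolding funpow.simps o_def Suc sum t_def
    by (intro sum.cong refl) (simp add: mult of_nat Suc_diff_le)
  also have "\<dots> = (\<Sum>i\<le>n. of_nat (n choose i) * t (Suc i)) + (\<Sum>i\<le>n. of_nat (n choose i) * t i)"
    by (simp add: distrib_left sum.distrib)
  also have "(\<Sum>i\<le>n. of_nat (n choose i) * t i) = t 0 + (\<Sum>i\<le>n. of_nat (n choose Suc i) * t (Suc i))"
  proof -
    have "(\<Sum>i\<le>n. of_nat (n choose i) * t i) = (\<Sum>i\<le>Suc n. of_nat (n choose i) * t i)" by (simp add: binomial_eq_0)
    also have "\<dots> = t 0 + (\<Sum>i\<le>n. of_nat (n choose Suc i) * t (Suc i))" by (subst sum.atMost_Suc_shift) simp
    finally show ?thesis .
  qed
  also have "(\<Sum>i\<le>n. of_nat (n choose i) * t (Suc i)) + (t 0 + (\<Sum>i\<le>n. of_nat (n choose Suc i) * t (Suc i))) =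
      (\<Sum>i\<le>Suc n. of_nat (Suc n choose i) * t i)"
    by (subst sum.atMost_Suc_shift) (simp add: distrib_right sum.distrib)
  finally show ?case unfolding t_def .
qed

text \<open>In Leibniz' rule for the \<open>p\<close>-th iterate all inner binomial coefficients are
  divisible by \<open>p\<close>.\<close>

lemma derivation_funpow_char:
  assumes "prime p" "CHAR('a) = p"
  shows "derivation (D ^^ p)"
proof
  show "(D ^^ p) (f + g) = (D ^^ p) f + (D ^^ p) g" for f g by (rule funpow_add)
  fix f g
  have p: "p > 0" using assms(1) by (rule prime_gt_0_nat)
  have "(D ^^ p) (f * g) = (\<Sum>i\<le>p. of_nat (p choose i) * ((D ^^ i) f * (D ^^ (p - i)) g))" by (rule leibniz)
  also have "\<dots> = (\<Sum>i\<in>{0, p}. of_nat (p choose i) * ((D ^^ i) f * (D ^^ (p - i)) g))"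
  proof (intro sum.mono_neutral_right ballI)
    fix i assume i: "i \<in> {..p} - {0, p}"
    have "p dvd fact i * fact (p - i) * (p choose i)"
      using i p by (subst binomial_fact_lemma) (auto intro: dvd_fact)
    moreover have "\<not> p dvd fact i" "\<not> p dvd fact (p - i)"
      using i assms(1) by (auto simp: prime_dvd_fact_iff)
    ultimately have "p dvd (p choose i)" using assms(1) by (simp add: prime_dvd_mult_iff)
    then have "of_nat (p choose i) = (0 :: 'a)" using assms(2) by (simp add: of_nat_eq_0_iff_char_dvd)
    then show "of_nat (p choose i) * ((D ^^ i) f * (D ^^ (p - i)) g) = 0" by simp
  qed auto
  also have "\<dots> = (D ^^ p) f * g + f * (D ^^ p) g" using p by simp
  finally show "(D ^^ p) (f * g) = (D ^^ p) f * g + f * (D ^^ p) g" .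
qed

end

lemma derivation_pderiv: "derivation (pderiv :: 'a::idom poly \<Rightarrow> 'a poly)"
  by unfold_locales (simp_all add: pderiv_add pderiv_mult mult.commute add.commute)

interpretation d_e2: derivation "d_e2 :: 'k::idom poly3 \<Rightarrow> 'k poly3"
proof -
  have eq: "d_e2 = map_poly (map_poly (pderiv :: 'k poly \<Rightarrow> 'k poly))" by (simp add: fun_eq_iff d_e2_def)
  show "derivation (d_e2 :: 'k poly3 \<Rightarrow> 'k poly3)"
    unfolding eq by (intro derivation.map_poly derivation_pderiv)
qed

interpretation d_e4: derivation "d_e4 :: 'k::idom poly3 \<Rightarrow> 'k poly3"
proof -
  have eq: "d_e4 = map_poly (pderiv :: 'k poly poly \<Rightarrow> 'k poly poly)" by (simp add: fun_eq_iff d_e4_def)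
  show "derivation (d_e4 :: 'k poly3 \<Rightarrow> 'k poly3)"
    unfolding eq by (intro derivation.map_poly derivation_pderiv)
qed

interpretation d_e6: derivation "d_e6 :: 'k::idom poly3 \<Rightarrow> 'k poly3"
proof -
  have eq: "d_e6 = (pderiv :: 'k poly3 \<Rightarrow> 'k poly3)" by (simp add: fun_eq_iff d_e6_def)
  show "derivation (d_e6 :: 'k poly3 \<Rightarrow> 'k poly3)" unfolding eq by (rule derivation_pderiv)
qed

interpretation vfield: derivation "vfield a b c :: 'k::idom poly3 \<Rightarrow> 'k poly3"
  by unfold_locales (simp_all add: vfield_def d_e2.add d_e4.add d_e6.add d_e2.mult d_e4.mult d_e6.mult algebra_simps)

lemma d_vars:
  "d_e2 (const3 c) = 0" "d_e2 var_e2 = 1" "d_e2 var_e4 = 0" "d_e2 var_e6 = (0 :: 'k::idom poly3)"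
  "d_e4 (const3 c) = 0" "d_e4 var_e2 = 0" "d_e4 var_e4 = 1" "d_e4 var_e6 = (0 :: 'k::idom poly3)"
  "d_e6 (const3 c) = 0" "d_e6 var_e2 = 0" "d_e6 var_e4 = 0" "d_e6 var_e6 = (1 :: 'k::idom poly3)"
  by (simp_all add: d_e2_def d_e4_def d_e6_def const3_def var_e2_def var_e4_def var_e6_def map_poly_pCons pderiv_pCons one_pCons pderiv_1)

lemma vfield_vars:
  "vfield a b c (const3 r) = 0" "vfield a b c var_e2 = a" "vfield a b c var_e4 = b" "vfield a b c var_e6 = (c :: 'k::idom poly3)"
  by (simp_all add: vfield_def d_vars)

text \<open>The twist \<open>\<phi>\<close> allows two uses: with the identity for comparing
  derivations, and with \<open>qexp3\<close> for comparing \<open>ramanujan\<close> with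
  \<open>q d/dq\<close> on expansions.\<close>

lemma derivation_along_eq_0:
  fixes D \<phi> :: "'k::idom poly3 \<Rightarrow> 'b::comm_ring_1"
  assumes add: "\<And>f g. D (f + g) = D f + D g" and mult: "\<And>f g. D (f * g) = D f * \<phi> g + \<phi> f * D g"
    and vars: "\<And>c. D (const3 c) = 0" "D var_e2 = 0" "D var_e4 = 0" "D var_e6 = 0"
  shows "D f = 0"
proof -
  have D0: "D 0 = 0" using add[of 0 0] by simp
  have 1: "D [:[:q:]:] = 0" for q
  proof (induction q)
    case 0 then show ?case using D0 by simp
  next
    case (pCons c q)
    have eq: "[:[:pCons c q:]:] = const3 c + var_e2 * [:[:q:]:]" by (simp add: const3_def var_e2_def)
    show ?case unfolding eq add mult using pCons(2) vars by simp
  qed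
  have 2: "D [:r:] = 0" for r
  proof (induction r)
    case 0 then show ?case using D0 by simp
  next
    case (pCons q r)
    have eq: "[:pCons q r:] = [:[:q:]:] + var_e4 * [:r:]" by (simp add: var_e4_def)
    show ?case unfolding eq add mult using pCons(2) 1[of q] vars by simp
  qed
  show ?thesis
  proof (induction f)
    case 0 then show ?case using D0 by simp
  next
    case (pCons r f)
    have eq: "pCons r f = [:r:] + var_e6 * f" by (simp add: var_e6_def)
    show ?case unfolding eq add mult using pCons(2) 2[of r] vars by simp
  qed
qed

lemma derivation_unique:
  fixes D D' :: "'k::idom poly3 \<Rightarrow> 'k poly3"
  assumes "derivation D" "derivation D'" "\<And>c. D (const3 c) = 0" "\<And>c. D' (const3 c) = 0"
    and "D var_e2 = D' var_e2" "D var_e4 = D' var_e4" "D var_e6 = D' var_e6"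
  shows "D f = D' f"
proof -
  interpret D: derivation D by fact
  interpret D': derivation D' by fact
  have "(\<lambda>f. D f - D' f) f = 0"
    by (rule derivation_along_eq_0[where \<phi> = "\<lambda>f. f"])
       (simp_all add: D.add D'.add D.mult D'.mult assms algebra_simps)
  then show ?thesis by simp
qed

lemma derivation_commutator:
  assumes "derivation D" "derivation D'" shows "derivation (\<lambda>f. D (D' f) - D' (D f))"
proof -
  interpret D: derivation D by fact
  interpret D': derivation D' by fact
  show ?thesis by unfold_locales (simp_all add: D.add D'.add D.mult D'.mult algebra_simps)
qed

interpretation ramanujan: derivation "ramanujan :: 'k::field poly3 \<Rightarrow> 'k poly3"
  unfolding ramanujan_def by (rule vfield.derivation_axioms)

lemma ramanujan_vars:
  "ramanujan (const3 c) = 0"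
  "ramanujan var_e2 = const3 (inverse 12) * (var_e2 ^ 2 - var_e4)"
  "ramanujan var_e4 = const3 (inverse 3) * (var_e2 * var_e4 - var_e6)"
  "ramanujan var_e6 = const3 (inverse 2) * (var_e2 * var_e6 - var_e4 ^ 2)"
  by (simp_all add: ramanujan_def vfield_vars)

section \<open>Commutators with the Euler field and with the derivative along
  \<open>e2\<close>\<close>

definition euler :: "'k::idom poly3 \<Rightarrow> 'k poly3" where
  "euler = vfield (2 * var_e2) (4 * var_e4) (6 * var_e6)"

interpretation euler: derivation "euler :: 'k::idom poly3 \<Rightarrow> 'k poly3"
  unfolding euler_def by (rule vfield.derivation_axioms)

lemma euler_vars:
  "euler (const3 c) = 0" "euler var_e2 = 2 * var_e2" "euler var_e4 = 4 * var_e4" "euler var_e6 = 6 * (var_e6 :: 'k::idom poly3)"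
  by (simp_all add: euler_def vfield_vars)

lemma const3_mult: "const3 c * const3 d = const3 (c * d)"
  by (simp add: const3_def)

lemma const3_numeral: "numeral n = const3 (numeral n :: 'k::idom)"
  by (simp add: const3_def numeral_poly)

context
  fixes K :: "'k::field itself"
  assumes two: "(2 :: 'k) \<noteq> 0" and three: "(3 :: 'k) \<noteq> 0"
begin

lemma twelve: "(12 :: 'k) \<noteq> 0"
proof -
  have "(12 :: 'k) = 2 * 2 * 3" by simp
  then show ?thesis using two three by (metis mult_eq_0_iff)
qed

lemma const3_inverse:
  "12 * const3 (inverse 12 :: 'k) = 1" "3 * const3 (inverse 3 :: 'k) = 1" "2 * const3 (inverse 2 :: 'k) = 1"
  using twelve two three unfolding const3_numeral const3_mult by (simp_all add: const3_def one_pCons)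

lemma d_e2_ramanujan_commutator: "12 * (d_e2 (ramanujan f) - ramanujan (d_e2 f)) = euler (f :: 'k poly3)"
proof -
  interpret C: derivation "\<lambda>f :: 'k poly3. d_e2 (ramanujan f) - ramanujan (d_e2 f)"
    by (rule derivation_commutator d_e2.derivation_axioms ramanujan.derivation_axioms)+
  define i12 i3 i2 where "i12 = const3 (inverse 12 :: 'k)" and "i3 = const3 (inverse 3 :: 'k)" and "i2 = const3 (inverse 2 :: 'k)"
  have i: "12 * i12 = 1" "3 * i3 = 1" "2 * i2 = 1"
    unfolding i12_def i3_def i2_def by (rule const3_inverse)+
  have d: "d_e2 i12 = 0" "d_e2 i3 = 0" "d_e2 i2 = 0" by (simp_all add: i12_def i3_def i2_def d_vars)
  have r: "ramanujan var_e2 = i12 * (var_e2 ^ 2 - var_e4)" "ramanujan var_e4 = i3 * (var_e2 * var_e4 - var_e6)"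
    "ramanujan var_e6 = i2 * (var_e2 * var_e6 - var_e4 ^ 2)"
    by (simp_all only: ramanujan_vars i12_def i3_def i2_def)
  show ?thesis
  proof (rule derivation_unique[where D = "\<lambda>f :: 'k poly3. 12 * (d_e2 (ramanujan f) - ramanujan (d_e2 f))" and D' = euler])
    show "derivation (\<lambda>f :: 'k poly3. 12 * (d_e2 (ramanujan f) - ramanujan (d_e2 f)))"
      by unfold_locales (simp_all only: C.add C.mult, simp_all only: algebra_simps)
    have "12 * (i12 * (2 * var_e2)) = (2 * var_e2 :: 'k poly3)" using i by algebra
    then show "12 * (d_e2 (ramanujan var_e2) - ramanujan (d_e2 var_e2)) = euler (var_e2 :: 'k poly3)"
      by (simp only: r euler_vars d_e2.mult d_e2.diff d_e2.power2 d d_vars ramanujan.one mult_zero_left mult_1_right add_0 diff_0_right)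
    have "12 * (i3 * var_e4) = (4 * var_e4 :: 'k poly3)" using i by algebra
    then show "12 * (d_e2 (ramanujan var_e4) - ramanujan (d_e2 var_e4)) = euler (var_e4 :: 'k poly3)"
      by (simp add: r euler_vars d_e2.mult d_e2.diff d d_vars ramanujan.zero)
    have "12 * (i2 * var_e6) = (6 * var_e6 :: 'k poly3)" using i by algebra
    then show "12 * (d_e2 (ramanujan var_e6) - ramanujan (d_e2 var_e6)) = euler (var_e6 :: 'k poly3)"
      by (simp add: r euler_vars d_e2.mult d_e2.diff d_e2.power2 d d_vars ramanujan.zero)
  qed (simp_all add: euler.derivation_axioms ramanujan_vars euler_vars d_vars d_e2.zero ramanujan.zero)
qed

text \<open>\<open>euler\<close> multiplies a form of weight \<open>w\<close> by \<open>w\<close>,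
  and \<open>ramanujan\<close> raises weights by 2; as both sides are derivations, the three
  variables suffice.\<close>

lemma euler_ramanujan_commutator: "euler (ramanujan f) = ramanujan (euler f) + 2 * ramanujan (f :: 'k poly3)"
proof -
  interpret C: derivation "\<lambda>f :: 'k poly3. euler (ramanujan f) - ramanujan (euler f)"
    by (rule derivation_commutator euler.derivation_axioms ramanujan.derivation_axioms)+
  define i12 i3 i2 where "i12 = const3 (inverse 12 :: 'k)" and "i3 = const3 (inverse 3 :: 'k)" and "i2 = const3 (inverse 2 :: 'k)"
  have d: "euler i12 = 0" "euler i3 = 0" "euler i2 = 0" by (simp_all only: i12_def i3_def i2_def euler_vars)
  have r: "ramanujan var_e2 = i12 * (var_e2 ^ 2 - var_e4)" "ramanujan var_e4 = i3 * (var_e2 * var_e4 - var_e6)"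
    "ramanujan var_e6 = i2 * (var_e2 * var_e6 - var_e4 ^ 2)"
    by (simp_all only: ramanujan_vars i12_def i3_def i2_def)
  note expand = r euler.mult euler.diff euler.power2 d euler_vars ramanujan.mult ramanujan.numeral mult_zero_left add_0
  have "euler (ramanujan f) - ramanujan (euler f) = 2 * ramanujan f"
  proof (rule derivation_unique[where D = "\<lambda>f :: 'k poly3. euler (ramanujan f) - ramanujan (euler f)" and D' = "\<lambda>f. 2 * ramanujan f"])
    show "derivation (\<lambda>f :: 'k poly3. 2 * ramanujan f)"
      by unfold_locales (simp_all only: ramanujan.add ramanujan.mult, simp_all only: algebra_simps)
    show "euler (ramanujan var_e2) - ramanujan (euler var_e2) = 2 * ramanujan (var_e2 :: 'k poly3)"
      unfolding expand by algebra
    show "euler (ramanujan var_e4) - ramanujan (euler var_e4) = 2 * ramanujan (var_e4 :: 'k poly3)"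
      unfolding expand by algebra
    show "euler (ramanujan var_e6) - ramanujan (euler var_e6) = 2 * ramanujan (var_e6 :: 'k poly3)"
      unfolding expand by algebra
  qed (simp_all add: C.derivation_axioms ramanujan_vars euler_vars euler.zero ramanujan.zero)
  then show ?thesis by (simp add: diff_eq_eq add.commute)
qed

lemma euler_ramanujan_funpow:
  "euler ((ramanujan ^^ n) f) = (ramanujan ^^ n) (euler f) + of_nat (2 * n) * (ramanujan ^^ n) (f :: 'k poly3)"
proof (induction n)
  case (Suc n)
  have "euler ((ramanujan ^^ Suc n) f) = ramanujan (euler ((ramanujan ^^ n) f)) + 2 * (ramanujan ^^ Suc n) f"
    by (simp add: euler_ramanujan_commutator)
  also have "\<dots> = (ramanujan ^^ Suc n) (euler f) + of_nat (2 * n) * (ramanujan ^^ Suc n) f + 2 * (ramanujan ^^ Suc n) f"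
    unfolding Suc by (simp add: ramanujan.add ramanujan.mult ramanujan.of_nat ramanujan.numeral)
  finally show ?case by (simp add: algebra_simps)
qed simp

lemma d_e2_ramanujan_funpow:
  "12 * d_e2 ((ramanujan ^^ n) f) = 12 * (ramanujan ^^ n) (d_e2 f) + of_nat n * (ramanujan ^^ (n - 1)) (euler f)
     + of_nat (n * (n - 1)) * (ramanujan ^^ (n - 1)) (f :: 'k poly3)"
proof (induction n)
  case (Suc n)
  let ?R = "ramanujan :: 'k poly3 \<Rightarrow> 'k poly3"
  \<comment> \<open>At \<open>n = 0\<close> the exponent \<open>n - 1\<close> is truncated, but the
    factor \<open>n\<close> makes both sides vanish.\<close>
  have R: "of_nat n * ?R ((?R ^^ (n - 1)) g) = of_nat n * (?R ^^ n) g" for g by (cases n) auto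
  have R': "of_nat (n * (n - 1)) * ?R ((?R ^^ (n - 1)) g) = of_nat (n * (n - 1)) * (?R ^^ n) g" for g by (cases n) auto
  have "12 * d_e2 ((?R ^^ Suc n) f) = ?R (12 * d_e2 ((?R ^^ n) f)) + euler ((?R ^^ n) f)"
    using d_e2_ramanujan_commutator[of "(?R ^^ n) f"]
    by (simp add: ramanujan.mult ramanujan.numeral algebra_simps)
  also have "?R (12 * d_e2 ((?R ^^ n) f)) = 12 * (?R ^^ Suc n) (d_e2 f) + of_nat n * (?R ^^ n) (euler f)
     + of_nat (n * (n - 1)) * (?R ^^ n) f"
    unfolding Suc ramanujan.add ramanujan.mult ramanujan.of_nat ramanujan.numeral R R' by (simp add: R R')
  also have "euler ((?R ^^ n) f) = (?R ^^ n) (euler f) + of_nat (2 * n) * (?R ^^ n) f"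
    by (rule euler_ramanujan_funpow)
  also have "12 * (?R ^^ Suc n) (d_e2 f) + of_nat n * (?R ^^ n) (euler f) + of_nat (n * (n - 1)) * (?R ^^ n) f +
      ((?R ^^ n) (euler f) + of_nat (2 * n) * (?R ^^ n) f) =
     12 * (?R ^^ Suc n) (d_e2 f) + of_nat (Suc n) * (?R ^^ n) (euler f) + (of_nat (n * (n - 1)) + of_nat (2 * n)) * (?R ^^ n) f"
    by (simp add: algebra_simps)
  also have "of_nat (n * (n - 1)) + of_nat (2 * n) = (of_nat (Suc n * (Suc n - 1)) :: 'k poly3)"
  proof -
    have "n * (n - 1) + 2 * n = Suc n * (Suc n - 1)" by (cases n) auto
    then show ?thesis by (metis of_nat_add)
  qed
  finally show ?case by simp
qed simp

end

section \<open>Coefficients and weights\<close>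

definition cf :: "'k::zero poly poly poly \<Rightarrow> nat \<Rightarrow> nat \<Rightarrow> nat \<Rightarrow> 'k" where
  "cf f a b c = coeff (coeff (coeff f c) b) a"

lemma cf_add: "cf (f + g) a b c = cf f a b c + cf g a b c"
  and cf_diff: "cf (f' - g') a b c = cf f' a b c - cf (g' :: 'k::ab_group_add poly poly poly) a b c"
  by (simp_all add: cf_def)

lemma cf_eqI: "(\<And>a b c. cf f a b c = cf g a b c) \<Longrightarrow> f = g"
  unfolding cf_def by (intro poly_eqI) simp

lemma cf_const3_mult: "cf (const3 r * f) a b c = r * cf f a b c"
  by (simp add: cf_def const3_def)

lemma cf_var_mult:
  "cf (var_e2 * f) a b c = (if a = 0 then 0 else cf f (a - 1) b c)"
  "cf (var_e4 * f) a b c = (if b = 0 then 0 else cf f a (b - 1) c)"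
  "cf (var_e6 * f) a b c = (if c = 0 then 0 else cf f a b (c - 1))"
  by (auto simp: cf_def var_e2_def var_e4_def var_e6_def coeff_pCons split: nat.splits)

lemma cf_derivs:
  "cf (d_e2 f) a b c = of_nat (Suc a) * cf f (Suc a) b c"
  "cf (d_e4 f) a b c = of_nat (Suc b) * cf f a (Suc b) c"
  "cf (d_e6 f) a b c = of_nat (Suc c) * cf f a b (Suc c)"
  by (simp_all add: cf_def d_e2_def d_e4_def d_e6_def coeff_map_poly coeff_pderiv of_nat_poly del: of_nat_Suc)

lemma cf_ramanujan:
  fixes f :: "'k::field poly3"
  shows "cf (ramanujan f) a b c =
    inverse 12 * ((if a < 2 then 0 else of_nat (a - 1) * cf f (a - 1) b c)
      - (if b = 0 then 0 else of_nat (Suc a) * cf f (Suc a) (b - 1) c))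
    + inverse 3 * ((if a = 0 then 0 else of_nat b * cf f (a - 1) b c)
      - (if c = 0 then 0 else of_nat (Suc b) * cf f a (Suc b) (c - 1)))
    + inverse 2 * ((if a = 0 then 0 else of_nat c * cf f (a - 1) b c)
      - (if b < 2 then 0 else of_nat (Suc c) * cf f a (b - 2) (Suc c)))"
proof -
  have "ramanujan f = const3 (inverse 12) * (var_e2 * (var_e2 * d_e2 f) - var_e4 * d_e2 f)
     + const3 (inverse 3) * (var_e2 * (var_e4 * d_e4 f) - var_e6 * d_e4 f)
     + const3 (inverse 2) * (var_e2 * (var_e6 * d_e6 f) - var_e4 * (var_e4 * d_e6 f))"
    by (simp add: ramanujan_def vfield_def power2_eq_square algebra_simps)
  then have "cf (ramanujan f) a b c = 
    inverse 12 * (cf (var_e2 * (var_e2 * d_e2 f)) a b c - cf (var_e4 * d_e2 f) a b c)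
    + inverse 3 * (cf (var_e2 * (var_e4 * d_e4 f)) a b c - cf (var_e6 * d_e4 f) a b c)
    + inverse 2 * (cf (var_e2 * (var_e6 * d_e6 f)) a b c - cf (var_e4 * (var_e4 * d_e6 f)) a b c)"
    by (simp only: cf_add cf_diff cf_const3_mult)
  moreover have "cf (var_e2 * (var_e2 * d_e2 f)) a b c = (if a < 2 then 0 else of_nat (a - 1) * cf f (a - 1) b c)"
  proof -
    consider "a = 0" | "a = 1" | k where "a = Suc (Suc k)" by (cases a; cases "a - 1") auto
    then show ?thesis by cases (simp_all add: cf_var_mult cf_derivs)
  qed
  moreover have "cf (var_e4 * (var_e4 * d_e6 f)) a b c = (if b < 2 then 0 else of_nat (Suc c) * cf f a (b - 2) (Suc c))"
  proof -
    consider "b = 0" | "b = 1" | k where "b = Suc (Suc k)" by (cases b; cases "b - 1") auto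
    then show ?thesis by cases (simp_all add: cf_var_mult cf_derivs)
  qed
  moreover have "cf (var_e2 * (var_e4 * d_e4 f)) a b c = (if a = 0 then 0 else of_nat b * cf f (a - 1) b c)"
    by (cases b) (simp_all add: cf_var_mult cf_derivs)
  moreover have "cf (var_e2 * (var_e6 * d_e6 f)) a b c = (if a = 0 then 0 else of_nat c * cf f (a - 1) b c)"
    by (cases c) (simp_all add: cf_var_mult cf_derivs)
  moreover have "cf (var_e4 * d_e2 f) a b c = (if b = 0 then 0 else of_nat (Suc a) * cf f (Suc a) (b - 1) c)"
    "cf (var_e6 * d_e4 f) a b c = (if c = 0 then 0 else of_nat (Suc b) * cf f a (Suc b) (c - 1))"
    by (simp_all add: cf_var_mult cf_derivs)
  ultimately show ?thesis by (simp only:)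
qed

definition wt_hom3 :: "nat \<Rightarrow> 'k::zero poly poly poly \<Rightarrow> bool" where
  "wt_hom3 w f \<longleftrightarrow> (\<forall>a b c. cf f a b c \<noteq> 0 \<longrightarrow> 2 * a + 4 * b + 6 * c = w)"

lemma wt_hom3_ramanujan:
  assumes "wt_hom3 w (f :: 'k::field poly3)" shows "wt_hom3 (w + 2) (ramanujan f)"
  unfolding wt_hom3_def
proof (intro allI impI)
  fix a b c assume nz: "cf (ramanujan f) a b c \<noteq> 0"
  have w: "cf f a b c \<noteq> 0 \<Longrightarrow> 2 * a + 4 * b + 6 * c = w" for a b c using assms by (simp add: wt_hom3_def)
  show "2 * a + 4 * b + 6 * c = w + 2"
  proof (rule ccontr)
    assume neq: "2 * a + 4 * b + 6 * c \<noteq> w + 2"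
    have "a \<noteq> 0 \<Longrightarrow> cf f (a - 1) b c = 0" using w[of "a - 1" b c] neq by (cases a) auto
    moreover have "b \<noteq> 0 \<Longrightarrow> cf f (Suc a) (b - 1) c = 0" using w[of "Suc a" "b - 1" c] neq by (cases b) auto
    moreover have "c \<noteq> 0 \<Longrightarrow> cf f a (Suc b) (c - 1) = 0" using w[of a "Suc b" "c - 1"] neq by (cases c) auto
    moreover have "b \<ge> 2 \<Longrightarrow> cf f a (b - 2) (Suc c) = 0" using w[of a "b - 2" "Suc c"] neq by (cases b; cases "b - 1") auto
    ultimately have "cf (ramanujan f) a b c = 0" unfolding cf_ramanujan by auto
    then show False using nz by simp
  qed
qed

lemma wt_hom3_ramanujan_funpow:
  "wt_hom3 w (f :: 'k::field poly3) \<Longrightarrow> wt_hom3 (w + 2 * n) ((ramanujan ^^ n) f)"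
proof (induction n)
  case (Suc n)
  then show ?case using wt_hom3_ramanujan[of "w + 2 * n" "(ramanujan ^^ n) f"] by (simp add: add.commute add.left_commute)
qed simp

lemma cf_vars:
  "cf (var_e2 :: 'k::idom poly3) a b c = (if a = 1 \<and> b = 0 \<and> c = 0 then 1 else 0)"
  "cf (var_e4 :: 'k::idom poly3) a b c = (if a = 0 \<and> b = 1 \<and> c = 0 then 1 else 0)"
  "cf (var_e6 :: 'k::idom poly3) a b c = (if a = 0 \<and> b = 0 \<and> c = 1 then 1 else 0)"
  by (auto simp: cf_def var_e2_def var_e4_def var_e6_def coeff_pCons one_pCons split: nat.splits)

lemma wt_hom3_vars: "wt_hom3 2 (var_e2 :: 'k::idom poly3)" "wt_hom3 4 (var_e4 :: 'k poly3)" "wt_hom3 6 (var_e6 :: 'k poly3)"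
  by (auto simp: wt_hom3_def cf_vars split: if_splits)

section \<open>The \<open>q\<close>-expansion on \<open>k[e\<^sub>2, e\<^sub>4, e\<^sub>6]\<close>\<close>

definition qexp3 :: "'k::idom poly3 \<Rightarrow> 'k fps" where
  "qexp3 = poly_eval_hom (poly_eval_hom (poly_eval_hom fps_const E2) E4) E6"

interpretation qexp3: rhom "qexp3 :: 'k::idom poly3 \<Rightarrow> 'k fps"
  unfolding qexp3_def by (intro rhom_poly_eval_hom rhom_fps_const)

lemma qexp3_const3: "qexp3 (const3 c) = fps_const c"
  by (simp add: qexp3_def const3_def poly_eval_hom_pCons)

lemma qexp3_vars: "qexp3 (var_e2 :: 'k::idom poly3) = E2" "qexp3 (var_e4 :: 'k poly3) = E4" "qexp3 (var_e6 :: 'k poly3) = E6"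
proof -
  have 1: "poly_eval_hom fps_const (E2 :: 'k fps) 1 = 1"
    by (rule rhom.one[OF rhom_poly_eval_hom[OF rhom_fps_const]])
  have 2: "poly_eval_hom (poly_eval_hom fps_const (E2 :: 'k fps)) E4 1 = 1"
    by (rule rhom.one[OF rhom_poly_eval_hom[OF rhom_poly_eval_hom[OF rhom_fps_const]]])
  show "qexp3 (var_e2 :: 'k poly3) = E2" "qexp3 (var_e4 :: 'k poly3) = E4" "qexp3 (var_e6 :: 'k poly3) = E6"
    using 1 2 by (simp_all add: qexp3_def var_e2_def var_e4_def var_e6_def poly_eval_hom_pCons)
qed

definition lift3 :: "'k::idom poly poly \<Rightarrow> 'k poly3" where
  "lift3 = map_poly (map_poly (\<lambda>c. [:c:]))"

interpretation lift3: rhom "lift3 :: 'k::idom poly poly \<Rightarrow> 'k poly3"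
  unfolding lift3_def by (intro rhom.map_poly rhom_const_poly)

lemma lift3_vars: "lift3 (c2 c) = const3 c" "lift3 x4 = (var_e4 :: 'k::idom poly3)" "lift3 x6 = (var_e6 :: 'k poly3)"
  by (simp_all add: lift3_def c2_def const3_def x4_def x6_def var_e4_def var_e6_def map_poly_pCons one_pCons)

lemma qexp3_lift3: "qexp3 (lift3 g) = qexp2 g"
proof -
  have "poly_eval_hom (poly_eval_hom fps_const E2) E4 (map_poly (\<lambda>c. [:c:]) q) = poly_eval_hom fps_const E4 q" for q :: "'a poly"
    by (simp add: poly_eval_hom_map_poly poly_eval_hom_const)
  then show ?thesis by (simp add: qexp3_def qexp2_def lift3_def poly_eval_hom_map_poly)
qed

lemma tilde_lift3: "tildeA p = lift3 (red2 (polyA p))" "tildeB p = lift3 (red2 (polyB p))"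
proof -
  have "reduce_e4e6 Q = lift3 (red2 Q :: 'k::field poly poly)" for Q
  proof -
    have "map_poly (\<lambda>c. [:red_rat c:]) q = map_poly (\<lambda>c. [:c:]) (map_poly red_rat q :: 'k poly)" for q
      by (simp add: map_poly_map_poly red_rat_0 o_def)
    then have eq: "map_poly (\<lambda>c. [:red_rat c:]) = (\<lambda>q. map_poly (\<lambda>c. [:c:]) (map_poly red_rat q :: 'k poly))"
      by (simp add: fun_eq_iff)
    show ?thesis unfolding reduce_e4e6_def eq lift3_def red2_def
      by (simp add: map_poly_map_poly o_def)
  qed
  then show "tildeA p = lift3 (red2 (polyA p))" "tildeB p = lift3 (red2 (polyB p))"
    by (simp_all add: tildeA_def tildeB_def)
qed

lemma ex_lift3:
  assumes "\<And>a b c. cf f a b c \<noteq> 0 \<Longrightarrow> a = 0" "wt_hom3 w f"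
  shows "\<exists>g. wt_hom w g \<and> lift3 g = f"
proof (intro exI conjI)
  let ?g = "map_poly (map_poly (\<lambda>q. coeff q 0)) f"
  have g: "coeff (coeff ?g c) b = cf f 0 b c" for b c by (simp add: coeff_map_poly cf_def)
  show "wt_hom w ?g" using assms(2) unfolding wt_hom_def wt_hom3_def g by force
  show "lift3 ?g = f"
  proof (rule cf_eqI)
    fix a b c
    have "cf (lift3 ?g) a b c = (if a = 0 then cf f 0 b c else 0)"
      by (simp add: cf_def lift3_def coeff_map_poly coeff_pCons split: nat.split)
    then show "cf (lift3 ?g) a b c = cf f a b c" using assms(1)[of a b c] by auto
  qed
qed

section \<open>The \<open>p\<close>-th power\<close>

context prime_ge_5_field
begin

lemma numerals_nonzero: "(2 :: 'k) \<noteq> 0" "(3 :: 'k) \<noteq> 0"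
proof -
  have "\<not> int p dvd 2" "\<not> int p dvd 3" by (rule not_p_dvd; use p in simp)+
  then show "(2 :: 'k) \<noteq> 0" "(3 :: 'k) \<noteq> 0" using of_int_eq_0[of 2] of_int_eq_0[of 3] by simp_all
qed

abbreviation R :: "'k poly3 \<Rightarrow> 'k poly3" where "R \<equiv> ramanujan"

lemma of_nat_eq_0: "(of_nat n :: 'k) = 0 \<longleftrightarrow> p dvd n"
  using of_int_eq_0[of "int n"] by simp

text \<open>For \<open>n = p\<close> the commutator formula has coefficients \<open>p\<close> and
  \<open>p (p - 1)\<close>, both zero in \<open>k\<close>, and \<open>ramanujan\<close> annihilates
  the constants 0 and 1.\<close>

lemma d_e2_funpow_p:
  assumes "d_e2 f \<in> {0, 1}" shows "d_e2 ((R ^^ p) f) = 0"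
proof -
  have p0: "of_nat p = (0 :: 'k poly3)" using char by (simp add: of_nat_eq_0_iff_char_dvd)
  have "R 1 = 0" by (rule ramanujan.one)
  then have "(R ^^ p) 1 = 0"
    using p ramanujan.funpow_zero[of "p - 1"] funpow_Suc_right[of "p - 1" R] by (metis Suc_pred' comp_apply prime_gt_0_nat)
  then have "(R ^^ p) (d_e2 f) = 0" using assms ramanujan.funpow_zero by auto
  then have "12 * d_e2 ((R ^^ p) f) = 0"
    using d_e2_ramanujan_funpow[OF numerals_nonzero, of p f] by (simp add: p0)
  moreover have "(12 :: 'k poly3) \<noteq> 0"
    using const3_inverse(1)[OF numerals_nonzero] by (metis mult_zero_left zero_neq_one)
  ultimately show ?thesis by simp
qed

lemma cf_funpow_p_dvd:
  assumes "d_e2 f \<in> {0, 1}" "cf ((R ^^ p) f) a b c \<noteq> 0" shows "p dvd a"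
proof (cases a)
  case (Suc a')
  have "of_nat (Suc a') * cf ((R ^^ p) f) (Suc a') b c = cf (d_e2 ((R ^^ p) f)) a' b c" by (simp only: cf_derivs)
  also have "\<dots> = 0" unfolding d_e2_funpow_p[OF assms(1)] by (simp add: cf_def)
  finally show ?thesis using assms(2) Suc of_nat_eq_0 by (metis mult_eq_0_iff)
qed simp

lemma inverse_combination:
  "inverse 12 * (of_nat n * x) + inverse 3 * x = (of_nat (n + 4) * inverse 12 * x :: 'k)"
  "inverse 12 * (of_nat n * x) + inverse 2 * x = (of_nat (n + 6) * inverse 12 * x :: 'k)"
proof -
  define i where "i = inverse (12 :: 'k)"
  have i: "12 * i = 1" using twelve[OF numerals_nonzero] by (simp add: i_def)
  have "3 * (4 * i) = 1" and "2 * (6 * i) = 1" using i by simp_all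
  then have eq: "inverse 3 = 4 * i" "inverse 2 = 6 * i" using inverse_unique by blast+
  show "inverse 12 * (of_nat n * x) + inverse 3 * x = (of_nat (n + 4) * inverse 12 * x :: 'k)"
    "inverse 12 * (of_nat n * x) + inverse 2 * x = (of_nat (n + 6) * inverse 12 * x :: 'k)"
    unfolding eq i_def[symmetric] by (simp_all add: algebra_simps)
qed

text \<open>Each application of \<open>ramanujan\<close> takes \<open>e2^n e4\<close> to
  \<open>(n/12 + 1/3) e2^(n+1) e4\<close> plus other monomials. Pure powers of \<open>e2\<close> are
  tracked as well, since \<open>- e4 d/de2\<close> would turn them into further contributions to
  this coefficient.\<close>

lemma cf_funpow_e4:
  "cf ((R ^^ n) var_e4) m 0 0 = 0 \<and> cf ((R ^^ n) var_e4) n 1 0 = (\<Prod>i<n. of_nat (i + 4) * inverse 12)"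
proof (induction n arbitrary: m)
  case 0 then show ?case by (simp add: cf_vars)
next
  case (Suc n)
  let ?g = "(R ^^ n) var_e4"
  have 0: "cf ?g m 0 0 = 0" for m using Suc by blast
  have 1: "cf (R ?g) m 0 0 = 0" by (simp add: cf_ramanujan 0)
  have 2: "cf (R ?g) (Suc n) 1 0 = inverse 12 * (of_nat n * cf ?g n 1 0) + inverse 3 * cf ?g n 1 0"
    by (auto simp: cf_ramanujan 0)
  have c: "cf ?g n 1 0 = (\<Prod>i<n. of_nat (i + 4) * inverse 12)" using Suc by blast
  show ?case unfolding funpow.simps o_apply prod.lessThan_Suc 2 inverse_combination c
    using 1 by (simp only: mult.commute simp_thms)
qed

text \<open>The factor is now \<open>n/12 + 1/2\<close>. Monomials \<open>e2^m e4\<close> must be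
  excluded because \<open>- e6 d/de4\<close> sends them to \<open>e2^m e6\<close>, and pure powers
  of \<open>e2\<close> because they would produce such monomials.\<close>

lemma cf_funpow_e6:
  "cf ((R ^^ n) var_e6) m 0 0 = 0 \<and> cf ((R ^^ n) var_e6) m 1 0 = 0 \<and>
   cf ((R ^^ n) var_e6) n 0 1 = (\<Prod>i<n. of_nat (i + 6) * inverse 12)"
proof (induction n arbitrary: m)
  case 0 then show ?case by (simp add: cf_vars)
next
  case (Suc n)
  let ?g = "(R ^^ n) var_e6"
  have 0: "cf ?g m 0 0 = 0" "cf ?g m 1 0 = 0" "cf ?g m (Suc 0) 0 = 0" for m using Suc by auto
  have 1: "cf (R ?g) m 0 0 = 0" "cf (R ?g) m 1 0 = 0" by (simp_all add: cf_ramanujan 0)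
  have 2: "cf (R ?g) (Suc n) 0 1 = inverse 12 * (of_nat n * cf ?g n 0 1) + inverse 2 * cf ?g n 0 1"
    by (auto simp: cf_ramanujan 0)
  have c: "cf ?g n 0 1 = (\<Prod>i<n. of_nat (i + 6) * inverse 12)" using Suc by blast
  show ?case unfolding funpow.simps o_apply prod.lessThan_Suc 2 inverse_combination c
    using 1 by (simp only: mult.commute simp_thms)
qed

text \<open>Among \<open>p\<close> consecutive integers one is divisible by \<open>p\<close>. The
  bound \<open>p + 1\<close> covers \<open>k = 6\<close> at \<open>p = 5\<close>.\<close>

lemma prod_eq_0: "k \<le> p + 1 \<Longrightarrow> (\<Prod>i<p. of_nat (i + k) * inverse 12 :: 'k) = 0"
proof -
  assume k: "k \<le> p + 1"
  have "\<exists>i<p. p dvd (i + k)"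
  proof (cases "k \<le> p")
    case True
    then show ?thesis using p by (cases "k = 0") (auto intro: exI[of _ "p - k"] exI[of _ 0])
  next
    case False
    then have "k = p + 1" using k by simp
    then have "(p - 1) + k = 2 * p" using p by simp
    then show ?thesis using p by (intro exI[of _ "p - 1"]) (auto simp del: mult_2)
  qed
  then show ?thesis by (auto simp only: prod_zero_iff finite_lessThan lessThan_iff mult_eq_0_iff of_nat_eq_0)
qed

lemma funpow_p_e2_free:
  assumes "(v, w) \<in> {(var_e2, 2), (var_e4, 4), (var_e6, 6 :: nat)}" and nz: "cf ((R ^^ p) v) a b c \<noteq> 0"
  shows "a = 0"
proof (rule ccontr)
  assume a: "a \<noteq> 0"
  have "d_e2 v \<in> {0, 1}" using assms(1) by (auto simp: d_vars)
  then have "p dvd a" using nz by (rule cf_funpow_p_dvd)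
  then obtain k where k: "a = p * k" by auto
  have "wt_hom3 w v" using assms(1) wt_hom3_vars by auto
  from wt_hom3_ramanujan_funpow[OF this, of p] have w: "2 * a + 4 * b + 6 * c = w + 2 * p"
    using nz unfolding wt_hom3_def by blast
  \<comment> \<open>\<open>a \<ge> 2 p\<close> would give \<open>4 p \<le> w + 2 p\<close>,
    impossible because \<open>w \<le> 6 < 2 p\<close>.\<close>
  have "k = 1"
  proof (rule ccontr)
    assume "k \<noteq> 1"
    then have "k \<ge> 2" using a k by (cases k) auto
    then have "p * 2 \<le> a" unfolding k by (rule mult_le_mono2)
    then show False using w p assms(1) by auto
  qed
  then have a: "a = p" using k by simp
  with w have w': "4 * b + 6 * c = w" by simp
  from assms(1) consider "w = 2" | "v = var_e4" "w = 4" | "v = var_e6" "w = 6" by auto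
  then show False
  proof cases
    case 1 then show False using w' by presburger
  next
    case 2
    then have "b = 1" "c = 0" using w' by presburger+
    then show False using nz cf_funpow_e4[of p p] prod_eq_0[of 4] p by (simp add: 2(1) a)
  next
    case 3
    then have "b = 0" "c = 1" using w' by presburger+
    then show False using nz cf_funpow_e6[of p p] prod_eq_0[of 6] p by (simp add: 3(1) a)
  qed
qed

lemma fps_XD_qexp3: "fps_XD (qexp3 f) = qexp3 (R f)"
proof -
  define i12 i3 i2 where "i12 = fps_const (inverse 12 :: 'k)" and "i3 = fps_const (inverse 3 :: 'k)" and "i2 = fps_const (inverse 2 :: 'k)"
  have i: "12 * i12 = 1" "3 * i3 = 1" "2 * i2 = 1"
    using const3_inverse[OF numerals_nonzero, THEN arg_cong[where f = qexp3]]
    by (simp_all add: qexp3.mult qexp3.numeral qexp3.one qexp3_const3 i12_def i3_def i2_def)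
  have "(\<lambda>f. fps_XD (qexp3 f) - qexp3 (R f)) f = 0"
  proof (rule derivation_along_eq_0[where \<phi> = qexp3 and D = "\<lambda>f. fps_XD (qexp3 f) - qexp3 (R f)"], goal_cases)
    case (1 f g) then show ?case by (simp add: qexp3.add ramanujan.add)
  next
    case (2 f g) then show ?case by (simp add: qexp3.add qexp3.mult ramanujan.mult fps_XD_mult algebra_simps)
  next
    case (3 c) then show ?case by (simp add: qexp3_const3 ramanujan_vars qexp3.zero fps_XD_def)
  next
    case 4
    have "fps_XD E2 = i12 * (12 * fps_XD E2)" using i(1) by algebra
    then show ?case unfolding E2_ode
      by (simp only: ramanujan_vars qexp3.mult qexp3.diff qexp3.power qexp3_vars qexp3_const3 i12_def diff_self)
  next
    case 5
    have "fps_XD E4 = i3 * (3 * fps_XD E4)" using i(2) by algebra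
    then show ?case unfolding E4_ode
      by (simp only: ramanujan_vars qexp3.mult qexp3.diff qexp3.power qexp3_vars qexp3_const3 i3_def diff_self)
  next
    case 6
    have "fps_XD E6 = i2 * (2 * fps_XD E6)" using i(3) by algebra
    then show ?case unfolding E6_ode
      by (simp only: ramanujan_vars qexp3.mult qexp3.diff qexp3.power qexp3_vars qexp3_const3 i2_def diff_self)
  qed
  then show ?thesis by simp
qed

text \<open>\<open>q d/dq\<close> multiplies the \<open>n\<close>-th coefficient by
  \<open>n\<close>, and \<open>n^p = n\<close> in \<open>k\<close>.\<close>

lemma qexp3_funpow_p: "qexp3 ((R ^^ p) f) = qexp3 (R f)"
proof -
  have "qexp3 ((R ^^ n) f) = (fps_XD ^^ n) (qexp3 f)" for n
    by (induction n) (simp_all flip: fps_XD_qexp3)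
  also have "(fps_XD ^^ p) (qexp3 f) = fps_XD (qexp3 f)"
  proof (rule fps_ext)
    fix n
    have "(of_int (int n ^ p - int n) :: 'k) = 0" using fermat_int of_int_eq_0 by blast
    then have "(of_nat n ^ p :: 'k) = of_nat n" by simp
    then show "fps_nth ((fps_XD ^^ p) (qexp3 f)) n = fps_nth (fps_XD (qexp3 f)) n"
      by (simp add: fps_mult_fps_XD_shift)
  qed
  finally show ?thesis by (simp only: fps_XD_qexp3)
qed

lemma funpow_p_eqI:
  assumes "(v, w) \<in> {(var_e2, 2), (var_e4, 4), (var_e6, 6 :: nat)}"
    and g: "wt_hom (w + 2 * p) g" "qexp2 g = qexp3 (R v)"
  shows "(R ^^ p) v = lift3 g"
proof -
  have "wt_hom3 w v" using assms(1) wt_hom3_vars by auto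
  then have "wt_hom3 (w + 2 * p) ((R ^^ p) v)" by (rule wt_hom3_ramanujan_funpow)
  then obtain g' where g': "wt_hom (w + 2 * p) g'" "lift3 g' = (R ^^ p) v"
    using ex_lift3 funpow_p_e2_free[OF assms(1)] by metis
  have "qexp2 (g' - g) = 0"
    using g(2) qexp3_funpow_p[of v] unfolding g'(2)[symmetric] qexp3_lift3 by (simp add: qexp2.diff)
  with wt_hom_diff[OF g'(1) g(1)] have "g' - g = 0" by (rule wt_hom_qexp2_inj[OF _ _ char_1728])
  then show ?thesis using g'(2) by simp
qed

lemma ramanujan_funpow_p:
  "(ramanujan :: 'k poly3 \<Rightarrow> 'k poly3) ^^ p =
    vfield
      (const3 (inverse 12) * ((tildeB p)\<^sup>2 - var_e4 * (tildeA p)\<^sup>2))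
      (const3 (inverse 3) * (tildeA p * (var_e4 * tildeB p - var_e6 * tildeA p)))
      (const3 (inverse 2) * (tildeA p * (var_e6 * tildeB p - var_e4\<^sup>2 * tildeA p)))"
proof -
  define A B where "A = (red2 (polyA p) :: 'k poly poly)" and "B = (red2 (polyB p) :: 'k poly poly)"
  have t: "tildeA p = lift3 A" "tildeB p = lift3 B" by (simp_all add: tilde_lift3 A_def B_def)
  have A: "wt_hom (p - 1) A" "qexp2 A = 1" and B: "wt_hom (p + 1) B" "qexp2 B = E2"
    using red2_polyA red2_polyB by (simp_all add: A_def B_def)
  have w: "wt_hom w g \<Longrightarrow> w = w' \<Longrightarrow> wt_hom w' g" for w w' and g :: "'k poly poly" by simp
  have e2: "(R ^^ p) var_e2 = lift3 (c2 (inverse 12) * (B ^ 2 - x4 * A ^ 2))"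
  proof (rule funpow_p_eqI[where w = 2])
    have "wt_hom (2 + 2 * p) (B ^ 2)" "wt_hom (2 + 2 * p) (x4 * A ^ 2)"
      using p by (auto intro: w[OF wt_hom_power[OF B(1)]] w[OF wt_hom_mult[OF wt_hom_x4 wt_hom_power[OF A(1)]]])
    then show "wt_hom (2 + 2 * p) (c2 (inverse 12) * (B ^ 2 - x4 * A ^ 2))"
      by (intro w[OF wt_hom_mult[OF wt_hom_c2 wt_hom_diff]]) auto
    show "qexp2 (c2 (inverse 12) * (B ^ 2 - x4 * A ^ 2)) = qexp3 (R var_e2)"
      by (simp add: A B ramanujan_vars qexp2.mult qexp2.diff qexp2.power qexp2_c2 qexp2_x4 qexp3.mult qexp3.diff qexp3.power qexp3_vars qexp3_const3)
  qed simp
  have e4: "(R ^^ p) var_e4 = lift3 (c2 (inverse 3) * (A * (x4 * B - x6 * A)))"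
  proof (rule funpow_p_eqI[where w = 4])
    have "wt_hom (p + 5) (x4 * B)" "wt_hom (p + 5) (x6 * A)"
      using p by (auto intro: w[OF wt_hom_mult[OF wt_hom_x4 B(1)]] w[OF wt_hom_mult[OF wt_hom_x6 A(1)]])
    from w[OF wt_hom_mult[OF wt_hom_c2 wt_hom_mult[OF A(1) wt_hom_diff[OF this]]]]
    show "wt_hom (4 + 2 * p) (c2 (inverse 3) * (A * (x4 * B - x6 * A)))" using p by simp
    show "qexp2 (c2 (inverse 3) * (A * (x4 * B - x6 * A))) = qexp3 (R var_e4)"
      by (simp add: A B ramanujan_vars qexp2.mult qexp2.diff qexp2.power qexp2_c2 qexp2_x4 qexp2_x6 qexp3.mult qexp3.diff qexp3.power qexp3_vars qexp3_const3 mult.commute)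
  qed simp
  have e6: "(R ^^ p) var_e6 = lift3 (c2 (inverse 2) * (A * (x6 * B - x4 ^ 2 * A)))"
  proof (rule funpow_p_eqI[where w = 6])
    have "wt_hom (p + 7) (x6 * B)" "wt_hom (p + 7) (x4 ^ 2 * A)"
      using p by (auto intro: w[OF wt_hom_mult[OF wt_hom_x6 B(1)]] w[OF wt_hom_mult[OF wt_hom_power[OF wt_hom_x4] A(1)]])
    from w[OF wt_hom_mult[OF wt_hom_c2 wt_hom_mult[OF A(1) wt_hom_diff[OF this]]]]
    show "wt_hom (6 + 2 * p) (c2 (inverse 2) * (A * (x6 * B - x4 ^ 2 * A)))" using p by simp
    show "qexp2 (c2 (inverse 2) * (A * (x6 * B - x4 ^ 2 * A))) = qexp3 (R var_e6)"
      by (simp add: A B ramanujan_vars qexp2.mult qexp2.diff qexp2.power qexp2_c2 qexp2_x4 qexp2_x6 qexp3.mult qexp3.diff qexp3.power qexp3_vars qexp3_const3 mult.commute)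
  qed simp
  have const: "(R ^^ p) (const3 c) = 0" for c
  proof -
    have "(R ^^ Suc (p - 1)) (const3 c) = 0"
      by (simp only: funpow_Suc_right o_apply ramanujan_vars ramanujan.funpow_zero)
    then show ?thesis using p by simp
  qed
  note l = lift3.mult lift3.diff lift3.power lift3_vars
  \<comment> \<open>The \<open>p\<close>-th iterate is again a derivation, so agreement on constants
    and the three variables suffices.\<close>
  show ?thesis
  proof (rule ext, rule derivation_unique[where D = "R ^^ p"])
    show "derivation (R ^^ p)"
      by (rule ramanujan.derivation_funpow_char) (use p char in auto)
  qed (simp_all only: vfield.derivation_axioms const vfield_vars e2 e4 e6 t l)
qed

end

theorem theorem1:
  fixes p :: nat
  assumes "prime p" and "p \<ge> 5" and "CHAR('k::field) = p"
  shows "(ramanujan :: 'k poly3 \<Rightarrow> 'k poly3) ^^ p =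
    vfield
      (const3 (inverse 12) * ((tildeB p)\<^sup>2 - var_e4 * (tildeA p)\<^sup>2))
      (const3 (inverse 3) * (tildeA p * (var_e4 * tildeB p - var_e6 * tildeA p)))
      (const3 (inverse 2) * (tildeA p * (var_e6 * tildeB p - var_e4\<^sup>2 * tildeA p)))"
proof -
  interpret prime_ge_5_field p "TYPE('k)" using assms by unfold_locales
  show ?thesis by (rule ramanujan_funpow_p)
qed

end
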